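(* Let $d_1,d_2,\alpha,\beta$ be integers with $0\le\alpha<d_1$ and $0\le\beta<d_2$. Let $\mathcal{T}$ be a regular T-mesh without holes which is diagonalizable (for the parameters $d_1,d_2,\alpha,\beta$) and has no vanished l-edges. Then $$\dim\mathcal{S}(d_{1}, d_{2}, \alpha, \beta, \mathcal{T}) = (d_{1}+1)(d_{2}+1) + (C^{h}-T^{h})(d_{1}+1)(d_{2}-\beta) + (C^{v}-T^{v})(d_{2}+1)(d_{1}-\alpha) + V(d_{1}-\alpha)(d_{2}-\beta),$$ where $C^h, C^v$ are the numbers of horizontal and vertical cross-cuts, $T^h,T^v$ the numbers of horizontal and vertical interior l-edges, and $V$ the number of interior vertices of $\mathcal{T}$.
   Context: **T-meshes.** A T-mesh $\mathcal{T}$ is a finite collection of axis-aligned closed rectangles $F_i$ (faces, cells) in $\mathbb{R}^2$ with union the domain $\Omega$, such that distinct rectangles intersect only at points on their edges. The vertices of the rectangles are the vertices of $\mathcal{T}$; the line segment connecting two adjacent vertices on a grid line is an edge of $\mathcal{T}$. A T-junction is a vertex of one rectangle lying in the interior of a side of another rectangle. $\Omega$ need not be rectangular. $\mathcal{T}$ is regular if for each vertex the set of all rectangles containing it has connected interior. $\mathcal{T}$ is without holes if the (connected) domain $\Omega$ has no holes. A vertex is a boundary vertex if it lies on the boundary of $\Omega$, and an interior vertex otherwise. An edge lying on the boundary of $\Omega$ is a boundary edge; other edges are interior edges. **l-edges.** An l-edge is a maximal line segment composed of connected (collinear) interior edges; its two end points are T-junctions or boundary vertices. It is an interior l-edge if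 both end points are interior vertices, a cross-cut if both end points are boundary vertices, and a ray if exactly one end point is a boundary vertex. The vertices on an l-edge are all mesh vertices lying on it, including its end points. **Vanished l-edges.** $N^h$ is the least integer $\ge \frac{d_1+1}{d_1-\alpha}$ and $N^v$ is the least integer $\ge\frac{d_2+1}{d_2-\beta}$. A horizontal (resp. vertical) interior l-edge is vanished if the number of vertices on it is less than $N^h$ (resp. $N^v$). **Diagonalizable.** Let $n_e=T^h+T^v$ be the number of interior l-edges. For an ordering $e_1,\dots,e_{n_e}$ of all interior l-edges, the new-vertex-vector $\nu$ is defined by: $\nu_1$ is the number of vertices on $e_1$, and $\nu_j$ is the number of vertices on $e_j$ that are not on any $e_k$ with $k<j$. $\mathcal{T}$ is diagonalizable if there is an ordering of all its interior l-edges such that, for every $j$, $\nu_j\ge N^h$ if $e_j$ is horizontal and $\nu_j\ge N^v$ if $e_j$ is vertical. **Spline space.** $\mathcal{S}(d_1,d_2,\alpha,\beta,\mathcal{T})$ is the real vector space of functions $f\in C^{\alpha,\beta}(\Omega)$ whose restriction to each cell of $\mathcal{T}$ is a polynomial of bi-degree $(d_1,d_2)$ (degree at most $d_1$ in $x$ and at most $d_2$ in $y$). Here $C^{\alpha,\beta}(\Omega)$ is the space of bivariate functions continuous of order $\alpha$ in the $x$ direction and of order $\beta$ in the $y$ direction; that is, the difference of the two polynomial pieces on the two sides of an interior edge is divisible by $(x-x_0)^{\alpha+1}$ if the edge lies on $x=x_0$, and by $(y-y_0)^{\beta+1}$ if it lies on $y=y_0$. *)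

theory Defs
  imports
    "HOL-Analysis.Analysis"
    "HOL-Computational_Algebra.Polynomial"
    "HOL-Library.Function_Algebras"
begin

section \<open>Real-valued functions as a real vector space\<close>

instantiation "fun" :: (type, real_vector) real_vector
begin

definition scaleR_fun :: "real \<Rightarrow> ('a \<Rightarrow> 'b) \<Rightarrow> 'a \<Rightarrow> 'b" where
  "scaleR_fun r f = (\<lambda>x. r *\<^sub>R f x)"

instance
  by standard (simp_all add: scaleR_fun_def fun_eq_iff scaleR_add_right scaleR_add_left)

end

lemma scaleR_fun_apply [simp]: "(r *\<^sub>R f) x = r *\<^sub>R f x"
  by (simp add: scaleR_fun_def)

section \<open>T-meshes\<close>

type_synonym point = "real \<times> real"

definition is_rectangle :: "point set \<Rightarrow> bool" where
  "is_rectangle F \<longleftrightarrow> (\<exists>a b c d. a < b \<and> c < d \<and> F = {a..b} \<times> {c..d})"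

definition corners :: "point set \<Rightarrow> point set" where
  "corners F = {z. \<exists>a b c d. a < b \<and> c < d \<and> F = {a..b} \<times> {c..d} \<and> z \<in> {a, b} \<times> {c, d}}"

definition domain :: "point set set \<Rightarrow> point set" where
  "domain T = \<Union>T"

text \<open>The edges of a rectangle, taken together, are its frontier.\<close>

definition tmesh :: "point set set \<Rightarrow> bool" where
  "tmesh T \<longleftrightarrow> finite T \<and> T \<noteq> {} \<and> (\<forall>F\<in>T. is_rectangle F) \<and>
     (\<forall>F\<in>T. \<forall>G\<in>T. F \<noteq> G \<longrightarrow> F \<inter> G \<subseteq> frontier F \<inter> frontier G)"

definition vertices :: "point set set \<Rightarrow> point set" where
  "vertices T = (\<Union>F\<in>T. corners F)"

definition boundary_vertices :: "point set set \<Rightarrow> point set" where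
  "boundary_vertices T = vertices T \<inter> frontier (domain T)"

definition interior_vertices :: "point set set \<Rightarrow> point set" where
  "interior_vertices T = vertices T - frontier (domain T)"

definition regular_tmesh :: "point set set \<Rightarrow> bool" where
  "regular_tmesh T \<longleftrightarrow> (\<forall>v\<in>vertices T. connected (interior (\<Union>{F\<in>T. v \<in> F})))"

text \<open>The domain is bounded, so a hole is a bounded component of its complement; there is none
  exactly when the complement is connected.\<close>

definition without_holes :: "point set set \<Rightarrow> bool" where
  "without_holes T \<longleftrightarrow> connected (domain T) \<and> connected (- domain T)"

section \<open>Edges and l-edges\<close>

definition horizontal :: "point set \<Rightarrow> bool" where
  "horizontal s \<longleftrightarrow> (\<exists>y. \<forall>z\<in>s. snd z = y)"

definition vertical :: "point set \<Rightarrow> bool" where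
  "vertical s \<longleftrightarrow> (\<exists>x. \<forall>z\<in>s. fst z = x)"

text \<open>An edge joins two vertices, runs along the sides of the cells, and has no further vertex
  on it.\<close>

definition edges :: "point set set \<Rightarrow> point set set" where
  "edges T = {closed_segment p q | p q.
     p \<noteq> q \<and> (horizontal (closed_segment p q) \<or> vertical (closed_segment p q)) \<and>
     closed_segment p q \<subseteq> (\<Union>F\<in>T. frontier F) \<and>
     closed_segment p q \<inter> vertices T = {p, q}}"

definition interior_edges :: "point set set \<Rightarrow> point set set" where
  "interior_edges T = {e \<in> edges T. \<not> e \<subseteq> frontier (domain T)}"

definition edge_chain :: "point set set \<Rightarrow> point set \<Rightarrow> bool" where
  "edge_chain T s \<longleftrightarrow> (\<exists>p q. p \<noteq> q \<and> s = closed_segment p q) \<and> (horizontal s \<or> vertical s) \<and>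
     (\<exists>A \<subseteq> interior_edges T. s = \<Union>A)"

definition l_edges :: "point set set \<Rightarrow> point set set" where
  "l_edges T = {s. edge_chain T s \<and> (\<forall>s'. edge_chain T s' \<and> s \<subseteq> s' \<longrightarrow> s' = s)}"

definition endpoints :: "point set \<Rightarrow> point set" where
  "endpoints s = {p. \<exists>q. s = closed_segment p q}"

definition interior_l_edges :: "point set set \<Rightarrow> point set set" where
  "interior_l_edges T = {s \<in> l_edges T. endpoints s \<subseteq> interior_vertices T}"

definition cross_cuts :: "point set set \<Rightarrow> point set set" where
  "cross_cuts T = {s \<in> l_edges T. endpoints s \<subseteq> boundary_vertices T}"

definition num_h_cross_cuts :: "point set set \<Rightarrow> nat" where
  "num_h_cross_cuts T = card {s \<in> cross_cuts T. horizontal s}"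

definition num_v_cross_cuts :: "point set set \<Rightarrow> nat" where
  "num_v_cross_cuts T = card {s \<in> cross_cuts T. vertical s}"

definition num_h_interior_l_edges :: "point set set \<Rightarrow> nat" where
  "num_h_interior_l_edges T = card {s \<in> interior_l_edges T. horizontal s}"

definition num_v_interior_l_edges :: "point set set \<Rightarrow> nat" where
  "num_v_interior_l_edges T = card {s \<in> interior_l_edges T. vertical s}"

section \<open>Vanished l-edges and diagonalizability\<close>

text \<open>\<open>min_vertices d a\<close> is the least integer that is at least \<open>(d + 1) / (d - a)\<close>, for \<open>a < d\<close>.
  The thresholds for horizontal and vertical l-edges are \<open>min_vertices d1 \<alpha>\<close> and \<open>min_vertices d2 \<beta>\<close>.\<close>

definition min_vertices :: "nat \<Rightarrow> nat \<Rightarrow> int" where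
  "min_vertices d a = \<lceil>(real d + 1) / (real d - real a)\<rceil>"

definition vanished :: "nat \<Rightarrow> nat \<Rightarrow> nat \<Rightarrow> nat \<Rightarrow> point set set \<Rightarrow> point set \<Rightarrow> bool" where
  "vanished d1 d2 \<alpha> \<beta> T s \<longleftrightarrow> s \<in> interior_l_edges T \<and>
     (horizontal s \<and> int (card (vertices T \<inter> s)) < min_vertices d1 \<alpha> \<or>
      vertical s \<and> int (card (vertices T \<inter> s)) < min_vertices d2 \<beta>)"

text \<open>With the list indexed from 0, entry \<open>j\<close> corresponds to \<open>\<nu>\<close> at position \<open>j + 1\<close>.\<close>

definition new_vertex_vector :: "point set set \<Rightarrow> point set list \<Rightarrow> nat \<Rightarrow> nat" where
  "new_vertex_vector T es j = card {v \<in> vertices T. v \<in> es ! j \<and> (\<forall>k<j. v \<notin> es ! k)}"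

definition diagonalizable :: "nat \<Rightarrow> nat \<Rightarrow> nat \<Rightarrow> nat \<Rightarrow> point set set \<Rightarrow> bool" where
  "diagonalizable d1 d2 \<alpha> \<beta> T \<longleftrightarrow>
     (\<exists>es. distinct es \<and> set es = interior_l_edges T \<and>
       (\<forall>j<length es.
          (horizontal (es ! j) \<longrightarrow> min_vertices d1 \<alpha> \<le> int (new_vertex_vector T es j)) \<and>
          (vertical (es ! j) \<longrightarrow> min_vertices d2 \<beta> \<le> int (new_vertex_vector T es j))))"

section \<open>The spline space\<close>

text \<open>A bivariate polynomial is a polynomial in \<open>y\<close> whose coefficients are polynomials in \<open>x\<close>.\<close>

definition eval2 :: "real poly poly \<Rightarrow> point \<Rightarrow> real" where
  "eval2 P z = poly (poly P [:snd z:]) (fst z)"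

definition bidegree_le :: "nat \<Rightarrow> nat \<Rightarrow> real poly poly \<Rightarrow> bool" where
  "bidegree_le d1 d2 P \<longleftrightarrow> degree P \<le> d2 \<and> (\<forall>i. degree (coeff P i) \<le> d1)"

abbreviation X_minus :: "real \<Rightarrow> real poly poly" where
  "X_minus x0 \<equiv> [:[:- x0, 1:]:]"

abbreviation Y_minus :: "real \<Rightarrow> real poly poly" where
  "Y_minus y0 \<equiv> [:[:- y0:], 1:]"

definition smooth_across ::
    "nat \<Rightarrow> nat \<Rightarrow> point set \<Rightarrow> real poly poly \<Rightarrow> real poly poly \<Rightarrow> bool" where
  "smooth_across \<alpha> \<beta> e P Q \<longleftrightarrow>
     (\<forall>x0. (\<forall>z\<in>e. fst z = x0) \<longrightarrow> X_minus x0 ^ (\<alpha> + 1) dvd P - Q) \<and>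
     (\<forall>y0. (\<forall>z\<in>e. snd z = y0) \<longrightarrow> Y_minus y0 ^ (\<beta> + 1) dvd P - Q)"

text \<open>Functions on the domain are represented by their extension by zero to the whole plane.
  The cells on the two sides of an interior edge are the cells containing that edge; the
  condition is trivial for \<open>F = G\<close>.\<close>

definition spline_space ::
    "nat \<Rightarrow> nat \<Rightarrow> nat \<Rightarrow> nat \<Rightarrow> point set set \<Rightarrow> (point \<Rightarrow> real) set" where
  "spline_space d1 d2 \<alpha> \<beta> T = {f. (\<forall>z. z \<notin> domain T \<longrightarrow> f z = 0) \<and>
     (\<exists>p. (\<forall>F\<in>T. bidegree_le d1 d2 (p F) \<and> (\<forall>z\<in>F. f z = eval2 (p F) z)) \<and>
          (\<forall>e\<in>interior_edges T. \<forall>F\<in>T. \<forall>G\<in>T.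
             e \<subseteq> F \<and> e \<subseteq> G \<longrightarrow> smooth_across \<alpha> \<beta> e (p F) (p G)))}"

lemma eval2_0 [simp]: "eval2 0 z = 0"
  by (simp add: eval2_def)

lemma eval2_add: "eval2 (P + Q) z = eval2 P z + eval2 Q z"
  by (simp add: eval2_def)

lemma eval2_smult: "eval2 (smult [:c:] P) z = c * eval2 P z"
  by (simp add: eval2_def)

lemma bidegree_le_0 [simp]: "bidegree_le d1 d2 0"
  by (simp add: bidegree_le_def)

lemma bidegree_le_add:
  "bidegree_le d1 d2 P \<Longrightarrow> bidegree_le d1 d2 Q \<Longrightarrow> bidegree_le d1 d2 (P + Q)"
  by (simp add: bidegree_le_def degree_add_le)

lemma bidegree_le_smult: "bidegree_le d1 d2 P \<Longrightarrow> bidegree_le d1 d2 (smult [:c:] P)"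
  by (auto simp: bidegree_le_def)

lemma smooth_across_0 [simp]: "smooth_across \<alpha> \<beta> e 0 0"
  by (simp add: smooth_across_def)

lemma smooth_across_add:
  assumes "smooth_across \<alpha> \<beta> e P Q" "smooth_across \<alpha> \<beta> e P' Q'"
  shows "smooth_across \<alpha> \<beta> e (P + P') (Q + Q')"
proof -
  have eq: "P + P' - (Q + Q') = (P - Q) + (P' - Q')" by (rule add_diff_add)
  show ?thesis
    using assms unfolding smooth_across_def eq by (intro conjI allI impI dvd_add) blast+
qed

lemma smooth_across_smult:
  assumes "smooth_across \<alpha> \<beta> e P Q"
  shows "smooth_across \<alpha> \<beta> e (smult c P) (smult c Q)"
proof -
  have eq: "smult c P - smult c Q = smult c (P - Q)" by (simp add: smult_diff_right)
  show ?thesis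
    using assms unfolding smooth_across_def eq by (intro conjI allI impI dvd_smult) blast+
qed

lemma spline_spaceI:
  assumes "\<And>z. z \<notin> domain T \<Longrightarrow> f z = 0"
    and "\<And>F. F \<in> T \<Longrightarrow> bidegree_le d1 d2 (p F)"
    and "\<And>F z. F \<in> T \<Longrightarrow> z \<in> F \<Longrightarrow> f z = eval2 (p F) z"
    and "\<And>e F G. e \<in> interior_edges T \<Longrightarrow> F \<in> T \<Longrightarrow> G \<in> T \<Longrightarrow> e \<subseteq> F \<Longrightarrow> e \<subseteq> G \<Longrightarrow>
           smooth_across \<alpha> \<beta> e (p F) (p G)"
  shows "f \<in> spline_space d1 d2 \<alpha> \<beta> T"
  unfolding spline_space_def mem_Collect_eq
  by (intro conjI allI impI ballI exI[of _ p]) (erule conjE | rule assms | assumption)+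

lemma spline_spaceE:
  assumes "f \<in> spline_space d1 d2 \<alpha> \<beta> T"
  obtains p where "\<And>z. z \<notin> domain T \<Longrightarrow> f z = 0"
    and "\<And>F. F \<in> T \<Longrightarrow> bidegree_le d1 d2 (p F)"
    and "\<And>F z. F \<in> T \<Longrightarrow> z \<in> F \<Longrightarrow> f z = eval2 (p F) z"
    and "\<And>e F G. e \<in> interior_edges T \<Longrightarrow> F \<in> T \<Longrightarrow> G \<in> T \<Longrightarrow> e \<subseteq> F \<Longrightarrow> e \<subseteq> G \<Longrightarrow>
           smooth_across \<alpha> \<beta> e (p F) (p G)"
proof -
  from assms obtain p where "\<forall>z. z \<notin> domain T \<longrightarrow> f z = 0"
    "\<forall>F\<in>T. bidegree_le d1 d2 (p F) \<and> (\<forall>z\<in>F. f z = eval2 (p F) z)"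
    "\<forall>e\<in>interior_edges T. \<forall>F\<in>T. \<forall>G\<in>T.
       e \<subseteq> F \<and> e \<subseteq> G \<longrightarrow> smooth_across \<alpha> \<beta> e (p F) (p G)"
    unfolding spline_space_def mem_Collect_eq by (elim conjE exE) (rule that, assumption+)
  then show ?thesis by (intro that[of p]) (simp_all del: split_paired_All)
qed

lemma subspace_spline_space: "subspace (spline_space d1 d2 \<alpha> \<beta> T)"
proof (rule subspaceI)
  show "0 \<in> spline_space d1 d2 \<alpha> \<beta> T"
    by (rule spline_spaceI[where p = "\<lambda>_. 0"]) simp_all
next
  fix f g assume f: "f \<in> spline_space d1 d2 \<alpha> \<beta> T" and g: "g \<in> spline_space d1 d2 \<alpha> \<beta> T"
  from f obtain p where p: "\<And>z. z \<notin> domain T \<Longrightarrow> f z = 0"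
    "\<And>F. F \<in> T \<Longrightarrow> bidegree_le d1 d2 (p F)"
    "\<And>F z. F \<in> T \<Longrightarrow> z \<in> F \<Longrightarrow> f z = eval2 (p F) z"
    "\<And>e F G. e \<in> interior_edges T \<Longrightarrow> F \<in> T \<Longrightarrow> G \<in> T \<Longrightarrow> e \<subseteq> F \<Longrightarrow> e \<subseteq> G \<Longrightarrow>
       smooth_across \<alpha> \<beta> e (p F) (p G)"
    by (rule spline_spaceE) (rule that, (assumption | blast)+)
  from g obtain q where q: "\<And>z. z \<notin> domain T \<Longrightarrow> g z = 0"
    "\<And>F. F \<in> T \<Longrightarrow> bidegree_le d1 d2 (q F)"
    "\<And>F z. F \<in> T \<Longrightarrow> z \<in> F \<Longrightarrow> g z = eval2 (q F) z"
    "\<And>e F G. e \<in> interior_edges T \<Longrightarrow> F \<in> T \<Longrightarrow> G \<in> T \<Longrightarrow> e \<subseteq> F \<Longrightarrow> e \<subseteq> G \<Longrightarrow>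
       smooth_across \<alpha> \<beta> e (q F) (q G)"
    by (rule spline_spaceE) (rule that, (assumption | blast)+)
  show "f + g \<in> spline_space d1 d2 \<alpha> \<beta> T"
  proof (rule spline_spaceI[where p = "\<lambda>F. p F + q F"])
    show "(f + g) z = 0" if "z \<notin> domain T" for z
      using p(1)[OF that] q(1)[OF that] by simp
    show "bidegree_le d1 d2 (p F + q F)" if "F \<in> T" for F
      by (rule bidegree_le_add[OF p(2)[OF that] q(2)[OF that]])
    show "(f + g) z = eval2 (p F + q F) z" if "F \<in> T" "z \<in> F" for F z
      using p(3)[OF that] q(3)[OF that] by (simp add: eval2_add)
    show "smooth_across \<alpha> \<beta> e (p F + q F) (p G + q G)"
      if "e \<in> interior_edges T" "F \<in> T" "G \<in> T" "e \<subseteq> F" "e \<subseteq> G" for e F G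
      by (rule smooth_across_add[OF p(4)[OF that] q(4)[OF that]])
  qed
next
  fix c :: real and f assume f: "f \<in> spline_space d1 d2 \<alpha> \<beta> T"
  from f obtain p where p: "\<And>z. z \<notin> domain T \<Longrightarrow> f z = 0"
    "\<And>F. F \<in> T \<Longrightarrow> bidegree_le d1 d2 (p F)"
    "\<And>F z. F \<in> T \<Longrightarrow> z \<in> F \<Longrightarrow> f z = eval2 (p F) z"
    "\<And>e F G. e \<in> interior_edges T \<Longrightarrow> F \<in> T \<Longrightarrow> G \<in> T \<Longrightarrow> e \<subseteq> F \<Longrightarrow> e \<subseteq> G \<Longrightarrow>
       smooth_across \<alpha> \<beta> e (p F) (p G)"
    by (rule spline_spaceE) (rule that, (assumption | blast)+)
  show "c *\<^sub>R f \<in> spline_space d1 d2 \<alpha> \<beta> T"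
  proof (rule spline_spaceI[where p = "\<lambda>F. smult [:c:] (p F)"])
    show "(c *\<^sub>R f) z = 0" if "z \<notin> domain T" for z
      using p(1)[OF that] by simp
    show "bidegree_le d1 d2 (smult [:c:] (p F))" if "F \<in> T" for F
      by (rule bidegree_le_smult[OF p(2)[OF that]])
    show "(c *\<^sub>R f) z = eval2 (smult [:c:] (p F)) z" if "F \<in> T" "z \<in> F" for F z
      using p(3)[OF that] by (simp add: eval2_smult)
    show "smooth_across \<alpha> \<beta> e (smult [:c:] (p F)) (smult [:c:] (p G))"
      if "e \<in> interior_edges T" "F \<in> T" "G \<in> T" "e \<subseteq> F" "e \<subseteq> G" for e F G
      by (rule smooth_across_smult[OF p(4)[OF that]])
  qed
qed

end

theory Submission
  imports Defs
begin

text \<open>Extend a spline by zero outside the domain. Its jump across a horizontal line, as a function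
  of \<open>x\<close>, is constant except at vertices, where it changes by a multiple
  \<open>(x - a) ^ (\<alpha> + 1) * (y - b) ^ (\<beta> + 1) * w\<close>, and the jump across the vertical line through
  the vertex \<open>(a, b)\<close> changes by the same amount. So a spline is determined by one of its pieces, by
  the cofactor \<open>w\<close> of each interior vertex and, for each cross-cut, by the jump at its first edge;
  at an end point of any other l-edge inside the domain the jump starts from zero. The only
  conditions on these data are that along each interior l-edge the changes add up to zero. For a
  diagonalizable mesh these conditions are independent: on a horizontal l-edge, the powers
  \<open>(x - a) ^ (\<alpha> + 1)\<close> at its new vertices generate all polynomials in \<open>x\<close> of degree \<open>d1\<close> with
  cofactors of degree \<open>d1 - \<alpha> - 1\<close>.

  Conversely, prescribed jumps that are balanced at all interior vertices come from a piecewise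
  polynomial. Regard them as a flow along the lines of the tensor product grid spanned by the mesh. Since the
  complement of the domain is connected, an imbalance at a grid point outside the open domain can
  be carried off to infinity along grid edges outside the open domain; a flow balanced everywhere
  in the plane has a stream function, obtained by summing the vertical jumps from left to right.\<close>

section \<open>Dimensions of spaces of functions\<close>

text \<open>Cross-cuts and interior l-edges enter the formula with opposite signs because the
  balance condition of an interior l-edge, after division by the power that belongs to its line,
  lives in the same polynomial space as the free jump of a cross-cut. Rays contribute nothing: their
  jump is zero beyond the interior end and unrestricted at the boundary end. The threshold is the
  least number of vertices whose cofactors, with d1 - \<alpha> (or d2 - \<beta>) coefficients each
  along the l-edge, can reach the d1 + 1 (or d2 + 1) coefficients of a condition. The obstacle is
  the way back from jumps to pieces. The domain need not be a rectangle, so its cells have no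
  natural order in which jumps could be summed, and around a hole the jumps on a closed path need
  not add up to zero. Extending the flow to the whole plane grid makes a plain sum along horizontal
  lines available.\<close>

lemma dim_kernel_image:
  fixes f :: "'a::real_vector \<Rightarrow> 'b::real_vector"
  assumes f: "linear f" and V: "subspace V" and fin: "V \<subseteq> span S" "finite S"
  shows "dim V = dim {v\<in>V. f v = 0} + dim (f ` V)"
proof -
  let ?K = "{v\<in>V. f v = 0}"
  obtain B where B: "B \<subseteq> ?K" "independent B" "?K \<subseteq> span B"
    by (rule basis_exists)
  obtain C where C: "B \<subseteq> C" "C \<subseteq> V" "independent C" "V \<subseteq> span C"
    using B(1,2) by (elim maximal_independent_subset_extend[of B V, rotated]) auto
  have finC: "finite C"
    using independent_span_bound[OF fin(2) C(3)] C(2) fin(1) by blast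
  then have finB: "finite B" using C(1) finite_subset by blast
  let ?D = "C - B"
  have inj: "inj_on f (span ?D)"
  proof (subst linear_inj_on_iff_eq_0[OF f subspace_span], intro ballI impI)
    fix x assume x: "x \<in> span ?D" "f x = 0"
    have "x \<in> V"
      using x(1) C(2) V span_minimal[of ?D V] by blast
    then have "x \<in> span B" using B(3) x(2) by blast
    then obtain u where u: "x = (\<Sum>v\<in>B. u v *\<^sub>R v)"
      using span_finite[OF finB] by auto
    obtain w where w: "x = (\<Sum>v\<in>?D. w v *\<^sub>R v)"
      using x(1) span_finite[of ?D] finC by auto
    \<comment> \<open>A vector in the spans of both \<open>B\<close> and \<open>?D\<close> gives
      this linear relation on the independent set \<open>C\<close>.\<close>
    let ?h = "\<lambda>v. if v \<in> B then u v else - w v"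
    have "(\<Sum>v\<in>C. ?h v *\<^sub>R v) = (\<Sum>v\<in>B. ?h v *\<^sub>R v) + (\<Sum>v\<in>?D. ?h v *\<^sub>R v)"
      using sum.subset_diff[OF C(1) finC, of "\<lambda>v. ?h v *\<^sub>R v"] by (simp add: add.commute)
    also have "(\<Sum>v\<in>B. ?h v *\<^sub>R v) = x" using u by simp
    also have "(\<Sum>v\<in>?D. ?h v *\<^sub>R v) = - x"
      by (simp add: w sum_negf[symmetric])
    finally have "(\<Sum>v\<in>C. ?h v *\<^sub>R v) = 0" by simp
    then have "?h v = 0" if "v \<in> C" for v
      using independentD[OF C(3) finC order_refl, of ?h, OF _ that] by blast
    then have "u v = 0" if "v \<in> B" for v using that C(1) by (metis subsetD)
    then show "x = 0" using u by simp
  qed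
  have "dim V = card C" using basis_card_eq_dim[OF C(2,4,3)] by simp
  moreover have "dim ?K = card B" using basis_card_eq_dim[OF B(1,3,2)] by simp
  moreover have "dim (f ` V) = card (f ` ?D)"
  proof (rule basis_card_eq_dim[symmetric])
    show "f ` ?D \<subseteq> f ` V" using C(2) by blast
    have "f ` C \<subseteq> span (f ` ?D)"
    proof
      fix y assume "y \<in> f ` C"
      then obtain c where c: "c \<in> C" "y = f c" by blast
      show "y \<in> span (f ` ?D)"
      proof (cases "c \<in> B")
        case True then have "f c = 0" using B(1) by blast
        then show ?thesis using c span_zero by simp
      next
        case False then show ?thesis using c by (intro span_base) auto
      qed
    qed
    then have "span (f ` C) \<subseteq> span (f ` ?D)" by (simp add: span_minimal)
    then show "f ` V \<subseteq> span (f ` ?D)"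
      using C(4) linear_span_image[OF f, of C] by blast
    show "independent (f ` ?D)"
      using linear_independent_injective_image[OF f _ inj] independent_mono[OF C(3)] by blast
  qed
  moreover have "card (f ` ?D) = card ?D"
    by (intro card_image inj_on_subset[OF inj]) (simp add: span_superset)
  moreover have "card C = card B + card ?D"
    using C(1) finB finC by (simp add: card_Diff_subset card_mono)
  ultimately show ?thesis by simp
qed

lemma dim_zero_space: "dim {0 :: 'a::real_vector} = 0"
  using dim_span[of "{} :: 'a set"] dim_eq_card_independent[of "{} :: 'a set"] independent_empty
  by simp

lemma dim_image_inj:
  fixes f :: "'a::real_vector \<Rightarrow> 'b::real_vector"
  assumes "linear f" "subspace V" "V \<subseteq> span S" "finite S" "\<And>v. v \<in> V \<Longrightarrow> f v = 0 \<Longrightarrow> v = 0"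
  shows "dim (f ` V) = dim V"
proof -
  have "{v\<in>V. f v = 0} = {0}"
    using assms(5) linear_0[OF assms(1)] subspace_0[OF assms(2)] by auto
  then show ?thesis using dim_kernel_image[OF assms(1-4)] by (simp add: dim_zero_space)
qed

text \<open>A spline and its coordinates are tied together through a family of polynomials, so no
  map is at hand in either direction. Partners of a basis extend to a linear map; additivity, and
  the fact that zero is related only to zero, make the relation the graph of that map.\<close>

lemma dim_linear_relation:
  fixes U :: "'a::real_vector set" and V :: "'b::real_vector set"
  assumes U: "subspace U" "U \<subseteq> span S" "finite S"
    and R0: "R 0 0"
    and Radd: "\<And>v u v' u'. R v u \<Longrightarrow> R v' u' \<Longrightarrow> R (v + v') (u + u')"
    and Rscale: "\<And>c v u. R v u \<Longrightarrow> R (c *\<^sub>R v) (c *\<^sub>R u)"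
    and sub: "\<And>v u. R v u \<Longrightarrow> v \<in> V"
    and ex1: "\<And>v. v \<in> V \<Longrightarrow> \<exists>u\<in>U. R v u" and ex2: "\<And>u. u \<in> U \<Longrightarrow> \<exists>v. R v u"
    and inj1: "\<And>u. R 0 u \<Longrightarrow> u = 0" and inj2: "\<And>v. R v 0 \<Longrightarrow> v = 0"
  shows "dim V = dim U"
proof -
  obtain B where B: "B \<subseteq> U" "independent B" "U \<subseteq> span B"
    by (rule basis_exists)
  define g where "g b = (SOME v. R v b)" for b
  have g: "R (g b) b" if "b \<in> B" for b
    unfolding g_def using ex2[of b] that B(1) by (metis someI_ex subsetD)
  obtain L where L: "linear L" "\<forall>b\<in>B. L b = g b"
    using linear_independent_extend[OF B(2)] by blast
  have RL: "R (L u) u" if "u \<in> span B" for u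
    using that
  proof (induction rule: span_induct_alt)
    case base then show ?case using R0 linear_0[OF L(1)] by simp
  next
    case (step c x y)
    have "R (L x) x" using g[OF step(1)] L(2) step(1) by simp
    then show ?case
      using Radd[OF Rscale[of _ _ c] step(2)] linear_add[OF L(1)] linear_scale[OF L(1)] by metis
  qed
  have diff: "R (v - v') (u - u')" if "R v u" "R v' u'" for v v' u u'
    using Radd[OF that(1) Rscale[OF that(2), of "-1"]] by simp
  have "V = L ` U"
  proof
    show "V \<subseteq> L ` U"
    proof
      fix v assume "v \<in> V"
      then obtain u where u: "u \<in> U" "R v u" using ex1 by blast
      have "R (v - L u) (u - u)" using diff[OF u(2) RL] u(1) B(3) by blast
      then have "v = L u" using inj2[of "v - L u"] by simp
      then show "v \<in> L ` U" using u by blast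
    qed
    show "L ` U \<subseteq> V" using RL B(3) sub by blast
  qed
  moreover have "dim (L ` U) = dim U"
  proof (rule dim_image_inj[OF L(1) U])
    fix u assume "u \<in> U" "L u = 0"
    then have "R 0 u" using RL[of u] B(3) by auto
    then show "u = 0" by (rule inj1)
  qed
  ultimately show ?thesis by simp
qed

text \<open>The direct sum of the spaces \<open>A t\<close>. Families are extended by zero off
  \<open>I\<close>, so they are elements of the vector space of all functions and are equal when
  their components are.\<close>

definition pfuns :: "'i set \<Rightarrow> ('i \<Rightarrow> 'b::real_vector set) \<Rightarrow> ('i \<Rightarrow> 'b) set" where
  "pfuns I A = {u. \<forall>t. if t \<in> I then u t \<in> A t else u t = 0}"

lemma pfuns_mem: "u \<in> pfuns I A \<Longrightarrow> t \<in> I \<Longrightarrow> u t \<in> A t"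
  and pfuns_outside: "u \<in> pfuns I A \<Longrightarrow> t \<notin> I \<Longrightarrow> u t = 0"
  unfolding pfuns_def mem_Collect_eq by (metis (full_types))+

lemma pfunsI: "(\<And>t. t \<in> I \<Longrightarrow> u t \<in> A t) \<Longrightarrow> (\<And>t. t \<notin> I \<Longrightarrow> u t = 0) \<Longrightarrow> u \<in> pfuns I A"
  by (auto simp: pfuns_def)

lemma subspace_pfuns:
  assumes "\<And>t. t \<in> I \<Longrightarrow> subspace (A t)"
  shows "subspace (pfuns I A)"
  using assms by (auto simp: subspace_def pfuns_def split: if_splits)

lemma pfuns_finite_span:
  fixes A :: "'i \<Rightarrow> 'b::real_vector set"
  assumes "finite I" and "\<And>t. t \<in> I \<Longrightarrow> \<exists>S. finite S \<and> A t \<subseteq> span S"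
  shows "\<exists>S. finite S \<and> pfuns I A \<subseteq> span S"
proof -
  define sg :: "'i \<Rightarrow> 'b \<Rightarrow> 'i \<Rightarrow> 'b" where "sg t b t' = (if t' = t then b else 0)" for t b t'
  have lin: "linear (sg t)" for t
    by (rule linearI) (auto simp: sg_def fun_eq_iff)
  from assms(2) obtain S where S: "\<And>t. t \<in> I \<Longrightarrow> finite (S t) \<and> A t \<subseteq> span (S t)"
    by metis
  let ?S = "\<Union>t\<in>I. sg t ` S t"
  have "u \<in> span ?S" if u: "u \<in> pfuns I A" for u
  proof -
    have "u = (\<Sum>t\<in>I. sg t (u t))"
    proof
      fix t
      have "(\<Sum>t\<in>I. sg t (u t)) t = (\<Sum>t'\<in>I. if t = t' then u t' else 0)"
        by (induction I rule: infinite_finite_induct) (auto simp: sg_def)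
      also have "\<dots> = u t" using assms(1) pfuns_outside[OF u] by simp
      finally show "u t = (\<Sum>t\<in>I. sg t (u t)) t" by simp
    qed
    moreover have "sg t (u t) \<in> span ?S" if "t \<in> I" for t
    proof -
      have "sg t (u t) \<in> sg t ` span (S t)" using S[OF that] pfuns_mem[OF u that] by blast
      also have "\<dots> = span (sg t ` S t)" using linear_span_image[OF lin] by metis
      also have "\<dots> \<subseteq> span ?S" by (rule span_mono) (use that in blast)
      finally show ?thesis .
    qed
    ultimately show ?thesis using span_sum[of I "\<lambda>t. sg t (u t)"] by simp
  qed
  moreover have "finite ?S" using assms(1) S by blast
  ultimately show ?thesis by blast
qed

text \<open>Evaluation at one index maps onto its component, with the sum over the remaining indices
  as kernel.\<close>

lemma dim_pfuns:
  fixes A :: "'i \<Rightarrow> 'b::real_vector set"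
  assumes "finite I" and "\<And>t. t \<in> I \<Longrightarrow> subspace (A t)"
    and "\<And>t. t \<in> I \<Longrightarrow> \<exists>S. finite S \<and> A t \<subseteq> span S"
  shows "dim (pfuns I A) = (\<Sum>t\<in>I. dim (A t))"
  using assms
proof (induction I rule: finite_induct)
  case empty
  have "pfuns {} A = {0}" by (auto simp: pfuns_def fun_eq_iff)
  then show ?case by (simp add: dim_zero_space)
next
  case (insert i I)
  let ?V = "pfuns (insert i I) A"
  obtain S where S: "finite S" "?V \<subseteq> span S"
    using pfuns_finite_span[of "insert i I" A] insert by auto
  have lin: "linear (\<lambda>u. u i :: 'b)" by (rule linearI) auto
  have K: "{u \<in> ?V. u i = 0} = pfuns I A"
    using insert(2) subspace_0[OF insert(4)[of i]] by (auto simp: pfuns_def split: if_splits)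
  have I: "(\<lambda>u. u i) ` ?V = A i"
  proof
    show "(\<lambda>u. u i) ` ?V \<subseteq> A i" using pfuns_mem by fastforce
    show "A i \<subseteq> (\<lambda>u. u i) ` ?V"
    proof
      fix b assume "b \<in> A i"
      then have "(\<lambda>t. if t = i then b else 0) \<in> ?V"
        using insert(4) by (auto simp: pfuns_def intro: subspace_0)
      then show "b \<in> (\<lambda>u. u i) ` ?V" by (rule rev_image_eqI) simp
    qed
  qed
  have "dim ?V = dim (pfuns I A) + dim (A i)"
    using dim_kernel_image[OF lin subspace_pfuns S(2,1)] insert(4) K I by metis
  then show ?case using insert by simp
qed

section \<open>Bivariate polynomial functions\<close>

lemma eval2_mult: "eval2 (P * Q) z = eval2 P z * eval2 Q z"
  by (simp add: eval2_def)

lemma eval2_power: "eval2 (P ^ k) z = eval2 P z ^ k"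
  by (simp add: eval2_def)

lemma eval2_diff: "eval2 (P - Q) z = eval2 P z - eval2 Q z"
  by (simp add: eval2_def)

lemma eval2_X_minus [simp]: "eval2 (X_minus a) z = fst z - a"
  and eval2_Y_minus [simp]: "eval2 (Y_minus b) z = snd z - b"
  by (simp_all add: eval2_def)

text \<open>For each fixed y the polynomial in x has infinitely many roots, so the constants
  \<open>[:y:]\<close> are infinitely many roots of \<open>P\<close> itself over the domain of
  polynomials in x.\<close>

lemma eval2_eq_0_on_rectangle:
  assumes "a < b" "c < d" and z: "\<And>x y. a < x \<Longrightarrow> x < b \<Longrightarrow> c < y \<Longrightarrow> y < d \<Longrightarrow> eval2 P (x, y) = 0"
  shows "P = 0"
proof (rule ccontr)
  assume "P \<noteq> 0"
  then have "finite {t. poly P t = 0}" by (rule poly_roots_finite)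
  moreover have "(\<lambda>y. [:y:]) ` {c<..<d} \<subseteq> {t. poly P t = 0}"
  proof clarify
    fix y assume y: "y \<in> {c<..<d}"
    have "{a<..<b} \<subseteq> {x. poly (poly P [:y:]) x = 0}"
      using z y by (auto simp: eval2_def)
    then have "infinite {x. poly (poly P [:y:]) x = 0}"
      using infinite_Ioo[OF assms(1)] finite_subset by blast
    then show "poly P [:y:] = 0" using poly_roots_finite by blast
  qed
  ultimately have "finite ((\<lambda>y. [:y:]) ` {c<..<d})" using finite_subset by blast
  then have "finite {c<..<d}" by (rule finite_imageD) (simp add: inj_on_def)
  then show False using infinite_Ioo[OF assms(2)] by blast
qed

lemma eval2_inj: "eval2 P = eval2 Q \<Longrightarrow> P = Q"
  using eval2_eq_0_on_rectangle[of 0 1 0 1 "P - Q"] by (simp add: eval2_diff)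

lemma eval2_eq_0: "eval2 0 = 0"
  by (simp add: fun_eq_iff)

text \<open>Functions instead of polynomials: pieces, jumps and splines then lie in one real vector
  space, and \<open>eval2_inj\<close> guarantees that nothing is lost.\<close>

definition Pol :: "nat \<Rightarrow> nat \<Rightarrow> (point \<Rightarrow> real) set" where
  "Pol m n = {eval2 P | P. bidegree_le m n P}"

lemma PolE:
  assumes "f \<in> Pol m n" obtains P where "bidegree_le m n P" "f = eval2 P"
  using assms by (auto simp: Pol_def)

lemma PolI: "bidegree_le m n P \<Longrightarrow> eval2 P \<in> Pol m n"
  by (auto simp: Pol_def)

lemma subspace_Pol: "subspace (Pol m n)"
proof (rule subspaceI)
  show "0 \<in> Pol m n" using PolI[OF bidegree_le_0, of m n] eval2_eq_0 by simp
next
  fix f g assume "f \<in> Pol m n" "g \<in> Pol m n"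
  then obtain P Q where "bidegree_le m n P" "f = eval2 P" "bidegree_le m n Q" "g = eval2 Q"
    by (auto elim!: PolE)
  then show "f + g \<in> Pol m n"
    using PolI[OF bidegree_le_add, of m n P Q] by (simp add: plus_fun_def eval2_add[abs_def])
next
  fix c f assume "f \<in> Pol m n"
  then obtain P where "bidegree_le m n P" "f = eval2 P"
    by (auto elim!: PolE)
  then show "c *\<^sub>R f \<in> Pol m n"
    using PolI[OF bidegree_le_smult, of m n P c] by (simp add: scaleR_fun_def eval2_smult[abs_def])
qed

lemma Pol_eq_0_on_rectangle:
  assumes "f \<in> Pol m n" "a < b" "c < d"
    and "\<And>x y. a < x \<Longrightarrow> x < b \<Longrightarrow> c < y \<Longrightarrow> y < d \<Longrightarrow> f (x, y) = 0"
  shows "f = 0"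
proof -
  obtain P where P: "f = eval2 P" using assms(1) by (rule PolE)
  have "P = 0" by (rule eval2_eq_0_on_rectangle[OF assms(2,3)]) (use assms(4) P in simp)
  then show ?thesis using P eval2_eq_0 by simp
qed

lemma Pol_mult:
  assumes "f \<in> Pol m n" "g \<in> Pol m' n'"
  shows "(\<lambda>z. f z * g z) \<in> Pol (m + m') (n + n')"
proof -
  obtain P Q where P: "bidegree_le m n P" "f = eval2 P" and Q: "bidegree_le m' n' Q" "g = eval2 Q"
    using assms by (auto elim!: PolE)
  have "degree (coeff P i * coeff Q j) \<le> m + m'" for i j
    using P(1) Q(1) degree_mult_le[of "coeff P i" "coeff Q j"] add_mono
    unfolding bidegree_le_def by (meson order_trans)
  then have "degree (\<Sum>i\<le>k. coeff P i * coeff Q (k - i)) \<le> m + m'" for k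
    by (intro degree_sum_le) auto
  moreover have "degree (P * Q) \<le> n + n'"
    using P(1) Q(1) degree_mult_le[of P Q] unfolding bidegree_le_def by linarith
  ultimately have "bidegree_le (m + m') (n + n') (P * Q)"
    unfolding bidegree_le_def by (simp add: coeff_mult)
  from PolI[OF this] show ?thesis using P Q by (simp add: eval2_mult[abs_def])
qed

lemma Pol_fst: "degree p \<le> m \<Longrightarrow> (\<lambda>z. poly p (fst z)) \<in> Pol m n"
proof -
  assume "degree p \<le> m"
  then have "bidegree_le m n [:p:]" by (auto simp: bidegree_le_def coeff_pCons split: nat.splits)
  from PolI[OF this] show ?thesis by (simp add: eval2_def[abs_def])
qed

lemma Pol_snd: "degree p \<le> n \<Longrightarrow> (\<lambda>z. poly p (snd z)) \<in> Pol m n"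
proof -
  assume "degree p \<le> n"
  moreover have "degree (map_poly (\<lambda>c. [:c:]) p) = degree p"
    by (rule degree_map_poly) simp
  ultimately have "bidegree_le m n (map_poly (\<lambda>c. [:c:]) p)"
    by (simp add: bidegree_le_def coeff_map_poly)
  moreover have "eval2 (map_poly (\<lambda>c. [:c:]) p) z = poly p (snd z)" for z
    by (induction p) (simp_all add: eval2_def map_poly_pCons)
  ultimately show ?thesis using PolI[of m n "map_poly (\<lambda>c. [:c:]) p"]
    by (metis (no_types, lifting) ext)
qed

lemma poly_eq_sum_le: "degree p \<le> n \<Longrightarrow> poly p x = (\<Sum>i\<le>n. coeff p i * x ^ i)"
  for x :: "'a::{comm_semiring_0,semiring_1}"
  unfolding poly_altdef by (rule sum.mono_neutral_left) (auto simp: coeff_eq_0)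

lemma sum_fun_apply: "(\<Sum>i\<in>I. f i) x = (\<Sum>i\<in>I. f i x :: 'b::comm_monoid_add)"
  by (induction I rule: infinite_finite_induct) auto

text \<open>The nested encoding treats the two variables differently; sums of monomials restore the
  symmetry and supply coordinates for \<open>dim_Pol\<close>.\<close>

lemma Pol_monomials:
  "f \<in> Pol m n \<longleftrightarrow> (\<exists>c. f = (\<lambda>z. \<Sum>i\<le>m. \<Sum>j\<le>n. c (i, j) * fst z ^ i * snd z ^ j))"
proof
  assume "f \<in> Pol m n"
  then obtain P where P: "bidegree_le m n P" "f = eval2 P" by (rule PolE)
  have "eval2 P z = (\<Sum>i\<le>m. \<Sum>j\<le>n. coeff (coeff P j) i * fst z ^ i * snd z ^ j)" for z
  proof -
    have "poly P [:snd z:] = (\<Sum>j\<le>n. coeff P j * [:snd z:] ^ j)"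
      using P(1) by (intro poly_eq_sum_le) (simp add: bidegree_le_def)
    then have "eval2 P z = (\<Sum>j\<le>n. poly (coeff P j) (fst z) * snd z ^ j)"
      by (simp add: eval2_def poly_sum)
    also have "\<dots> = (\<Sum>j\<le>n. \<Sum>i\<le>m. coeff (coeff P j) i * fst z ^ i * snd z ^ j)"
      using P(1) by (simp add: bidegree_le_def poly_eq_sum_le[of _ m] sum_distrib_right)
    also have "\<dots> = (\<Sum>i\<le>m. \<Sum>j\<le>n. coeff (coeff P j) i * fst z ^ i * snd z ^ j)"
      by (rule sum.swap)
    finally show ?thesis .
  qed
  then show "\<exists>c. f = (\<lambda>z. \<Sum>i\<le>m. \<Sum>j\<le>n. c (i, j) * fst z ^ i * snd z ^ j)"
    using P(2) by (intro exI[of _ "\<lambda>(i, j). coeff (coeff P j) i"]) auto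
next
  assume "\<exists>c. f = (\<lambda>z. \<Sum>i\<le>m. \<Sum>j\<le>n. c (i, j) * fst z ^ i * snd z ^ j)"
  then obtain c where c: "f = (\<lambda>z. \<Sum>i\<le>m. \<Sum>j\<le>n. c (i, j) * fst z ^ i * snd z ^ j)" ..
  have "(\<lambda>z. c (i, j) * fst z ^ i * snd z ^ j) \<in> Pol m n" if "i \<le> m" "j \<le> n" for i j
    using Pol_mult[OF Pol_fst[of "monom (c (i,j)) i" m 0] Pol_snd[of "monom 1 j" n 0]] that
      order_trans[OF degree_monom_le[of "c (i,j)" i], of m] order_trans[OF degree_monom_le[of "1::real" j], of n]
    by (simp add: poly_monom)
  then have "(\<Sum>i\<le>m. \<Sum>j\<le>n. (\<lambda>z. c (i, j) * fst z ^ i * snd z ^ j)) \<in> Pol m n"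
    by (intro subspace_sum[OF subspace_Pol]) auto
  moreover have "(\<Sum>i\<le>m. \<Sum>j\<le>n. (\<lambda>z. c (i, j) * fst z ^ i * snd z ^ j)) = f"
    by (simp add: c fun_eq_iff sum_fun_apply)
  ultimately show "f \<in> Pol m n" by simp
qed

lemma Pol_finite_span: "\<exists>S. finite S \<and> Pol m n \<subseteq> span S"
proof -
  let ?S = "(\<lambda>(i, j) z. fst z ^ i * snd z ^ j :: real) ` ({..m} \<times> {..n})"
  have "Pol m n \<subseteq> span ?S"
  proof
    fix f assume "f \<in> Pol m n"
    then obtain c where c: "f = (\<lambda>z. \<Sum>i\<le>m. \<Sum>j\<le>n. c (i, j) * fst z ^ i * snd z ^ j)"
      by (auto simp: Pol_monomials)
    have "f = (\<Sum>i\<le>m. \<Sum>j\<le>n. c (i, j) *\<^sub>R (\<lambda>z. fst z ^ i * snd z ^ j))"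
      by (simp add: c fun_eq_iff sum_fun_apply mult.assoc)
    also have "\<dots> \<in> span ?S"
      by (intro span_sum span_scale span_base) auto
    finally show "f \<in> span ?S" .
  qed
  then show ?thesis by (meson finite_SigmaI finite_atMost finite_imageI)
qed

lemma dim_Pol: "dim (Pol m n) = (m + 1) * (n + 1)"
proof -
  let ?I = "{..m} \<times> {..n}"
  let ?V = "pfuns ?I (\<lambda>_. UNIV) :: (nat \<times> nat \<Rightarrow> real) set"
  define L :: "(nat \<times> nat \<Rightarrow> real) \<Rightarrow> point \<Rightarrow> real"
    where "L c = (\<lambda>z. \<Sum>i\<le>m. \<Sum>j\<le>n. c (i, j) * fst z ^ i * snd z ^ j)" for c
  have fin: "\<exists>S. finite S \<and> (UNIV :: real set) \<subseteq> span S"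
  proof (intro exI conjI subsetI)
    fix x :: real
    have "x *\<^sub>R 1 \<in> span {1 :: real}" by (intro span_scale span_base) simp
    then show "x \<in> span {1}" by simp
  qed simp
  have sub: "subspace ?V" by (rule subspace_pfuns) simp
  obtain S where S: "finite S" "?V \<subseteq> span S"
    using pfuns_finite_span[of ?I "\<lambda>_. UNIV :: real set"] fin by auto
  have lin: "linear L"
    by (rule linearI)
      (simp_all add: L_def fun_eq_iff sum.distrib algebra_simps sum_distrib_left)
  have inj: "c = 0" if c: "c \<in> ?V" "L c = 0" for c
  proof -
    define P where "P = (\<Sum>j\<le>n. monom (\<Sum>i\<le>m. monom (c (i, j)) i) j)"
    have "eval2 P z = L c z" for z
    proof -
      have "eval2 P z = (\<Sum>j\<le>n. \<Sum>i\<le>m. c (i, j) * fst z ^ i * snd z ^ j)"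
        by (simp add: eval2_def P_def poly_sum poly_monom sum_distrib_right)
      also have "\<dots> = L c z" unfolding L_def by (rule sum.swap)
      finally show ?thesis .
    qed
    then have "P = 0" using eval2_inj[of P 0] c(2) eval2_eq_0 by (auto simp: fun_eq_iff)
    have cf: "coeff (coeff P j) i = (if i \<le> m \<and> j \<le> n then c (i, j) else 0)" for i j
      by (simp add: P_def coeff_sum coeff_monom if_distrib cong: if_cong)
    show ?thesis
    proof (rule ext, clarify)
      fix i j show "c (i, j) = 0 (i, j)"
        using cf[of j i] \<open>P = 0\<close> pfuns_outside[OF c(1), of "(i, j)"]
        by (auto split: if_splits)
    qed
  qed
  have im: "L ` ?V = Pol m n"
  proof
    show "L ` ?V \<subseteq> Pol m n"
    proof clarify
      fix c show "L c \<in> Pol m n" unfolding L_def Pol_monomials by (rule exI, rule refl)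
    qed
    show "Pol m n \<subseteq> L ` ?V"
    proof
      fix f assume "f \<in> Pol m n"
      then obtain c where c: "f = L c" unfolding Pol_monomials L_def by blast
      let ?c = "\<lambda>t. if t \<in> ?I then c t else 0"
      have "?c \<in> ?V" by (rule pfunsI) auto
      moreover have "f = L ?c" unfolding c L_def by (intro ext sum.cong) auto
      ultimately show "f \<in> L ` ?V" by blast
    qed
  qed
  have "dim (Pol m n) = dim ?V"
    using dim_image_inj[OF lin sub S(2,1) inj] im by simp
  also have "\<dots> = (\<Sum>t\<in>?I. dim (UNIV :: real set))"
    by (rule dim_pfuns) (use fin in auto)
  also have "\<dots> = (m + 1) * (n + 1)" by simp
  finally show ?thesis .
qed

section \<open>Divisibility by powers of linear factors, in terms of functions\<close>

lemma X_minus_power: "X_minus a ^ k = [:[:- a, 1:] ^ k:]"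
  by (induction k) (simp_all add: one_pCons)

text \<open>\<open>X_minus a\<close> is a constant of the outer polynomial ring, so the quotient by
  its power is formed coefficient by coefficient; additivity of the degree in each coefficient gives
  the sharp bound m - k.\<close>

lemma X_minus_dvd_iff:
  assumes P: "bidegree_le m n P" and k: "k \<le> m"
  shows "X_minus a ^ k dvd P \<longleftrightarrow> (\<exists>g\<in>Pol (m - k) n. eval2 P = (\<lambda>z. (fst z - a) ^ k * g z))"
proof
  assume "X_minus a ^ k dvd P"
  then obtain R where R: "P = X_minus a ^ k * R" by (rule dvdE)
  have cf: "coeff P i = [:- a, 1:] ^ k * coeff R i" for i
    by (simp add: R X_minus_power)
  have "degree (coeff R i) \<le> m - k" for i
  proof (cases "coeff R i = 0")
    case False
    then have "degree (coeff P i) = k + degree (coeff R i)"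
      by (simp add: cf degree_mult_eq degree_linear_power)
    moreover have "degree (coeff P i) \<le> m" using P by (simp add: bidegree_le_def)
    ultimately show ?thesis by linarith
  qed simp
  moreover have "degree R \<le> n"
  proof -
    have "coeff R i = 0" if "n < i" for i
    proof -
      have "coeff P i = 0" using P that by (auto simp: bidegree_le_def intro: coeff_eq_0)
      then show ?thesis using cf[of i] by simp
    qed
    then show ?thesis by (intro degree_le) auto
  qed
  ultimately have "eval2 R \<in> Pol (m - k) n" by (intro PolI) (simp add: bidegree_le_def)
  moreover have "eval2 P = (\<lambda>z. (fst z - a) ^ k * eval2 R z)"
    by (simp add: R eval2_mult eval2_power fun_eq_iff)
  ultimately show "\<exists>g\<in>Pol (m - k) n. eval2 P = (\<lambda>z. (fst z - a) ^ k * g z)" by blast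
next
  assume "\<exists>g\<in>Pol (m - k) n. eval2 P = (\<lambda>z. (fst z - a) ^ k * g z)"
  then obtain G where "eval2 P = (\<lambda>z. (fst z - a) ^ k * eval2 G z)" by (auto elim!: PolE)
  then have "eval2 P = eval2 (X_minus a ^ k * G)"
    by (simp add: eval2_mult eval2_power fun_eq_iff)
  then show "X_minus a ^ k dvd P" using eval2_inj by (metis dvd_triv_left)
qed

text \<open>The bound on the degree in \<open>x\<close> of the cofactor is obtained by comparing, for each power
  of \<open>x\<close>, the polynomials in \<open>y\<close> which are its coefficients.\<close>

lemma Y_minus_dvd_iff:
  assumes P: "bidegree_le m n P" and k: "k \<le> n"
  shows "Y_minus b ^ k dvd P \<longleftrightarrow> (\<exists>g\<in>Pol m (n - k). eval2 P = (\<lambda>z. (snd z - b) ^ k * g z))"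
proof
  assume "Y_minus b ^ k dvd P"
  then obtain R where R: "P = Y_minus b ^ k * R" by (rule dvdE)
  define \<phi> :: "nat \<Rightarrow> real poly poly \<Rightarrow> real poly" where "\<phi> i = map_poly (\<lambda>c. coeff c i)" for i
  have \<phi>_coeff: "coeff (\<phi> i Q) j = coeff (coeff Q j) i" for i j Q
    by (simp add: \<phi>_def coeff_map_poly)
  have "\<phi> i (Y_minus b * Q) = [:- b, 1:] * \<phi> i Q" for i Q
    by (rule poly_eqI) (simp add: \<phi>_coeff coeff_pCons split: nat.split)
  then have \<phi>_mult: "\<phi> i (Y_minus b ^ l * Q) = [:- b, 1:] ^ l * \<phi> i Q" for i l Q
    by (induction l) (simp_all add: mult.assoc del: mult_pCons_left)
  have "degree (coeff R j) \<le> m" for j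
  proof -
    have "coeff (coeff R j) i = 0" if "m < i" for i
    proof -
      have "\<phi> i P = 0"
        using P that unfolding bidegree_le_def
        by (intro poly_eqI) (simp add: \<phi>_coeff, metis coeff_eq_0 le_less_trans)
      then have "\<phi> i R = 0" using \<phi>_mult[of i k R] R by simp
      then show ?thesis using \<phi>_coeff[of i R j] by simp
    qed
    then show ?thesis by (intro degree_le) auto
  qed
  moreover have "degree R \<le> n - k"
  proof (cases "R = 0")
    case False
    have "degree (Y_minus b ^ k) = k"
      by (induction k) (simp_all add: degree_mult_eq del: mult_pCons_left)
    then have "degree P = k + degree R"
      using False by (simp add: R degree_mult_eq)
    moreover have "degree P \<le> n" using P by (simp add: bidegree_le_def)
    ultimately show ?thesis by linarith
  qed simp
  ultimately have "eval2 R \<in> Pol m (n - k)" by (intro PolI) (simp add: bidegree_le_def)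
  moreover have "eval2 P = (\<lambda>z. (snd z - b) ^ k * eval2 R z)"
    by (simp add: R eval2_mult eval2_power fun_eq_iff)
  ultimately show "\<exists>g\<in>Pol m (n - k). eval2 P = (\<lambda>z. (snd z - b) ^ k * g z)" by blast
next
  assume "\<exists>g\<in>Pol m (n - k). eval2 P = (\<lambda>z. (snd z - b) ^ k * g z)"
  then obtain G where "eval2 P = (\<lambda>z. (snd z - b) ^ k * eval2 G z)" by (auto elim!: PolE)
  then have "eval2 P = eval2 (Y_minus b ^ k * G)"
    by (simp add: eval2_mult eval2_power fun_eq_iff)
  then show "Y_minus b ^ k dvd P" using eval2_inj by (metis dvd_triv_left)
qed

lemma Pol_X_times:
  assumes "g \<in> Pol m n" shows "(\<lambda>z. (fst z - a) ^ k * g z) \<in> Pol (m + k) n"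
  using Pol_mult[OF Pol_fst[of "[:- a, 1:] ^ k" k 0] assms] degree_linear_power[of "- a" k]
  by (simp add: add.commute poly_power)

lemma Pol_Y_times:
  assumes "g \<in> Pol m n" shows "(\<lambda>z. (snd z - b) ^ k * g z) \<in> Pol m (n + k)"
  using Pol_mult[OF Pol_snd[of "[:- b, 1:] ^ k" k 0] assms] degree_linear_power[of "- b" k]
  by (simp add: add.commute poly_power)

text \<open>The power of x - a is not zero on the line y = b, so the whole order of vanishing on
  that line falls to \<open>g\<close>. The order is taken in the outer ring, at the root
  \<open>[:b:]\<close>.\<close>

lemma Pol_common_factor:
  assumes g: "g \<in> Pol m n" and h: "h \<in> Pol m' n'" and l: "l \<le> n"
    and eq: "(\<lambda>z. (fst z - a) ^ k * g z) = (\<lambda>z. (snd z - b) ^ l * h z)"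
  shows "\<exists>w\<in>Pol m (n - l). g = (\<lambda>z. (snd z - b) ^ l * w z)"
proof -
  obtain G where G: "bidegree_le m n G" "g = eval2 G" using g by (rule PolE)
  obtain H where H: "h = eval2 H" using h by (rule PolE)
  let ?c = "[:b:]"
  have Y: "Y_minus b = [:- ?c, 1:]" by simp
  have "eval2 (X_minus a ^ k * G) = eval2 (Y_minus b ^ l * H)"
    using eq by (simp add: G H eval2_mult eval2_power fun_eq_iff)
  then have eq': "X_minus a ^ k * G = Y_minus b ^ l * H" by (rule eval2_inj)
  have "Y_minus b ^ l dvd G"
  proof (cases "G = 0")
    case False
    have X: "X_minus a ^ k \<noteq> 0" by simp
    have "poly (X_minus a ^ k) ?c \<noteq> 0" by (simp add: X_minus_power)
    then have "order ?c (X_minus a ^ k) = 0" by (rule order_0I)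
    then have "order ?c (X_minus a ^ k * G) = order ?c G"
      using False X by (subst order_mult) auto
    moreover have "[:- ?c, 1:] ^ l dvd X_minus a ^ k * G" unfolding eq' Y by simp
    ultimately have "l \<le> order ?c G" using False X by (simp only: order_divides) auto
    then show ?thesis unfolding Y order_divides by simp
  qed simp
  then show ?thesis using Y_minus_dvd_iff[OF G(1) l] G(2) by simp
qed

lemma Pol_cancel:
  assumes f: "f \<in> Pol m n" and eq: "\<And>z. (fst z - a) ^ k * (snd z - b) ^ l * f z = 0"
  shows "f = 0"
\<comment> \<open>On the rectangle to the upper right of (a, b) both linear factors are
  positive.\<close>
proof (rule Pol_eq_0_on_rectangle[OF f, of a "a + 1" b "b + 1"])
  fix x y assume "a < x" "b < y"
  then show "f (x, y) = 0" using eq[of "(x, y)"] by simp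
qed simp_all

section \<open>Powers of linear forms spanning the polynomials\<close>

text \<open>In characteristic zero, differentiation lowers the multiplicity of a root by exactly
  one.\<close>

lemma linear_power_dvd_pderiv:
  fixes p :: "'a::field_char_0 poly"
  assumes "poly p a = 0" "[:- a, 1:] ^ k dvd pderiv p"
  shows "[:- a, 1:] ^ Suc k dvd p"
proof (cases "pderiv p = 0")
  case True
  then obtain c where "p = [:c:]" using pderiv_iszero by blast
  then show ?thesis using assms(1) by simp
next
  case False
  then have "p \<noteq> 0" by auto
  then have "order a p \<noteq> 0" using assms(1) order_root by blast
  then have "order a p = Suc (order a (pderiv p))"
    using assms(1) \<open>p \<noteq> 0\<close> by (intro order_pderiv) auto
  moreover have "k \<le> order a (pderiv p)"
    using assms(2) False order_divides by blast
  ultimately show ?thesis using order_divides[of a "Suc k" p] by linarith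
qed

text \<open>For a functional \<open>\<lambda>\<close> killing \<open>(x - a) ^ (d - r)\<close> for \<open>r < k\<close>, the polynomial
  \<open>t \<mapsto> \<lambda> ((x - t) ^ d)\<close> of degree \<open>d\<close> vanishes to order \<open>k\<close> at each \<open>a\<close>, hence identically.\<close>

lemma monomial_in_span_shifted_powers:
  assumes A: "finite A" "d + 1 \<le> card A * k" and k: "k \<le> d" and j: "j \<le> d"
  shows "(\<lambda>x::real. x ^ j) \<in> span ((\<lambda>(a, r) x. (x - a) ^ (d - r)) ` (A \<times> {..<k}))" (is "?x \<in> span ?S")
proof (rule ccontr)
  assume no: "?x \<notin> span ?S"
  obtain B where B: "B \<subseteq> ?S" "independent B" "?S \<subseteq> span B" by (rule basis_exists)
  have "span ?S \<subseteq> span B" using B(3) by (simp add: span_minimal)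
  then have no': "?x \<notin> span B" using no B(1) span_mono by blast
  have ind: "independent (insert ?x B)" using no' B(2) by (simp add: independent_insert)
  \<comment> \<open>A functional that kills the span and is 1 at \<open>x ^ j\<close>; the
    contradiction will be that it also vanishes at \<open>x ^ j\<close>.\<close>
  obtain \<Lambda> :: "(real \<Rightarrow> real) \<Rightarrow> real"
    where \<Lambda>: "linear \<Lambda>" "\<forall>b\<in>insert ?x B. \<Lambda> b = (if b = ?x then 1 else 0)"
    using linear_independent_extend[OF ind, of "\<lambda>b. if b = ?x then 1 else 0"]
    by (elim exE conjE) (rule that)
  have "\<Lambda> b = 0" if b: "b \<in> B" for b
  proof -
    have "b \<noteq> ?x" using no' span_base[OF b] by metis
    then show ?thesis using \<Lambda>(2) b by simp
  qed
  then have *: "\<Lambda> b = 0" if "b \<in> span B" for b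
    using that linear_eq_0_on_span[OF \<Lambda>(1)] by blast
  have kill: "\<Lambda> (\<lambda>x. (x - a) ^ (d - r)) = 0" if "a \<in> A" "r < k" for a r
  proof -
    have "(\<lambda>x. (x - a) ^ (d - r)) \<in> ?S" using that by (intro image_eqI[of _ _ "(a, r)"]) auto
    then show ?thesis using * B(3) by blast
  qed
  \<comment> \<open>\<open>Q m\<close> is t \<mapsto> \<open>\<Lambda>\<close> ((x - t) ^ m), made a
    polynomial by the binomial expansion; powers killed by \<open>\<Lambda>\<close> become
    roots.\<close>
  define Q where "Q m = (\<Sum>i\<le>m. monom (of_nat (m choose i) * (- 1) ^ (m - i) * \<Lambda> (\<lambda>x. x ^ i)) (m - i))" for m
  have Q_poly: "poly (Q m) t = \<Lambda> (\<lambda>x. (x - t) ^ m)" for m t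
  proof -
    have "(\<lambda>x. (x - t) ^ m) = (\<Sum>i\<le>m. (of_nat (m choose i) * (- t) ^ (m - i)) *\<^sub>R (\<lambda>x. x ^ i))"
    proof
      fix x
      have "(x - t) ^ m = (x + (- t)) ^ m" by simp
      also have "\<dots> = (\<Sum>i\<le>m. of_nat (m choose i) * x ^ i * (- t) ^ (m - i))" by (rule binomial_ring)
      finally show "(x - t) ^ m = (\<Sum>i\<le>m. (of_nat (m choose i) * (- t) ^ (m - i)) *\<^sub>R (\<lambda>x. x ^ i)) x"
        by (simp add: sum_fun_apply mult_ac)
    qed
    then have "\<Lambda> (\<lambda>x. (x - t) ^ m) = (\<Sum>i\<le>m. (of_nat (m choose i) * (- t) ^ (m - i)) * \<Lambda> (\<lambda>x. x ^ i))"
      by (simp add: linear_sum[OF \<Lambda>(1)] linear_scale[OF \<Lambda>(1)])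
    also have "\<dots> = poly (Q m) t"
      by (simp add: Q_def poly_sum poly_monom mult_ac power_minus[of t])
    finally show ?thesis by simp
  qed
  \<comment> \<open>Differentiating (x - t) ^ (m + 1) in t relates consecutive polynomials
    \<open>Q m\<close>, so roots of the lower ones raise the multiplicity for
    \<open>Q d\<close>.\<close>
  have Q_pderiv: "pderiv (Q (Suc m)) = smult (- of_nat (Suc m)) (Q m)" for m
  proof (rule poly_eqI)
    fix l
    have cf: "coeff (Q m) l = (if l \<le> m then of_nat (m choose (m - l)) * (- 1) ^ l * \<Lambda> (\<lambda>x. x ^ (m - l)) else 0)" for m l
    proof -
      have "coeff (Q m) l = (\<Sum>i\<le>m. if m - i = l then of_nat (m choose i) * (- 1) ^ (m - i) * \<Lambda> (\<lambda>x. x ^ i) else 0)"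
        by (simp add: Q_def coeff_sum coeff_monom)
      also have "\<dots> = (\<Sum>i\<le>m. if i = m - l then (if l \<le> m then of_nat (m choose (m - l)) * (- 1) ^ l * \<Lambda> (\<lambda>x. x ^ (m - l)) else 0) else 0)"
        by (intro sum.cong refl) auto
      also have "\<dots> = (if l \<le> m then of_nat (m choose (m - l)) * (- 1) ^ l * \<Lambda> (\<lambda>x. x ^ (m - l)) else 0)"
        by simp
      finally show ?thesis .
    qed
    have "Suc l * (Suc m choose (m - l)) = Suc m * (m choose (m - l))" if "l \<le> m"
    proof -
      have "Suc m choose (m - l) = Suc m choose Suc l" "m choose (m - l) = m choose l"
        using that binomial_symmetric[of "Suc l" "Suc m"] binomial_symmetric[of l m]
        by (simp_all del: binomial_Suc_Suc)
      then show ?thesis using Suc_times_binomial_eq[of m l] by (simp only: mult.commute)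
    qed
    then have "real (Suc l) * real (Suc m choose (m - l)) = real (Suc m) * real (m choose (m - l))" if "l \<le> m"
      using that by (metis of_nat_mult)
    then show "coeff (pderiv (Q (Suc m))) l = coeff (smult (- of_nat (Suc m)) (Q m)) l"
      by (auto simp: coeff_pderiv cf simp del: of_nat_Suc)
  qed
  have dvd: "[:- a, 1:] ^ k dvd Q d" if a: "a \<in> A" for a
  proof -
    \<comment> \<open>Climb from the exponent d - k, where nothing is claimed, to d: each step uses
      one more killed power and gains one order of vanishing.\<close>
    have "[:- a, 1:] ^ i dvd Q (d - (k - i))" if "i \<le> k" for i
      using that
    proof (induction i)
      case (Suc i)
      then have eq: "d - (k - i) = d - Suc (k - Suc i)" "d - (k - Suc i) = Suc (d - Suc (k - Suc i))"
        using k by simp_all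
      have "[:- a, 1:] ^ i dvd pderiv (Q (d - (k - Suc i)))"
        using Suc unfolding eq(2) Q_pderiv by (intro dvd_smult) (simp add: eq(1))
      moreover have "poly (Q (d - (k - Suc i))) a = 0"
        using kill[OF a, of "k - Suc i"] Suc(2) by (simp add: Q_poly)
      ultimately show ?case by (intro linear_power_dvd_pderiv)
    qed simp
    from this[of k] show ?thesis by simp
  qed
  have "Q d = 0"
  proof (rule ccontr)
    assume nz: "Q d \<noteq> 0"
    have fin: "finite {x. poly (Q d) x = 0}" using nz by (rule poly_roots_finite)
    have k0: "k > 0" using A by (cases k) auto
    have ord: "k \<le> order a (Q d)" if "a \<in> A" for a
      using dvd[OF that] nz order_divides by blast
    have "A \<subseteq> {x. poly (Q d) x = 0}"
      using ord k0 order_root nz by fastforce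
    \<comment> \<open>At least d + 1 roots, counted with multiplicity, against degree at most
      d.\<close>
    then have "(\<Sum>a\<in>A. k) \<le> (\<Sum>a | poly (Q d) a = 0. order a (Q d))"
      using ord fin by (intro order_trans[OF sum_mono sum_mono2]) auto
    also have "\<dots> \<le> degree (Q d)" using sum_order_le_degree[OF nz] .
    also have "\<dots> \<le> d" unfolding Q_def
      by (intro degree_sum_le) (auto intro: order_trans[OF degree_monom_le])
    finally show False using A(2) by simp
  qed
  \<comment> \<open>The coefficient of t ^ (d - j) is a nonzero multiple of the value of
    \<open>\<Lambda>\<close> at \<open>x ^ j\<close>.\<close>
  have "coeff (Q d) (d - j) = of_nat (d choose j) * (- 1) ^ (d - j) * \<Lambda> ?x"
  proof -
    have "coeff (Q d) (d - j) = (\<Sum>i\<le>d. if i = j then of_nat (d choose j) * (- 1) ^ (d - j) * \<Lambda> ?x else 0)"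
      unfolding Q_def coeff_sum coeff_monom using j by (intro sum.cong refl) auto
    then show ?thesis using j by simp
  qed
  then have "\<Lambda> ?x = 0" using \<open>Q d = 0\<close> j by simp
  then show False using \<Lambda>(2) by simp
qed

text \<open>Each power (x - a) ^ (d - r) with r < k contains (x - a) ^ (d + 1 - k); the remaining
  exponent k - 1 - r goes into \<open>g a\<close>.\<close>

lemma monomial_as_shifted_powers:
  assumes "finite A" "d + 1 \<le> card A * k" "k \<le> d" "j \<le> d"
  shows "\<exists>g. (\<forall>a. degree (g a :: real poly) \<le> k - 1) \<and>
             (\<forall>x. x ^ j = (\<Sum>a\<in>A. (x - a) ^ (d + 1 - k) * poly (g a) x))"
proof -
  let ?f = "\<lambda>(a, r) x. (x - a) ^ (d - r) :: real"
  have fin: "finite (?f ` (A \<times> {..<k}))" using assms(1) by simp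
  let ?P = "\<lambda>h. \<exists>g. (\<forall>a. degree (g a :: real poly) \<le> k - 1) \<and>
             (\<forall>x. h x = (\<Sum>a\<in>A. (x - a) ^ (d + 1 - k) * poly (g a) x))"
  have "?P h" if "h \<in> span (?f ` (A \<times> {..<k}))" for h
    using that
  proof (induction rule: span_induct_alt)
    case base
    show ?case by (rule exI[of _ "\<lambda>_. 0"]) simp
  next
    case (step c b h)
    then obtain a0 r where b: "a0 \<in> A" "r < k" "b = (\<lambda>x. (x - a0) ^ (d - r))" by auto
    obtain g where g: "\<And>a. degree (g a) \<le> k - 1" "\<And>x. h x = (\<Sum>a\<in>A. (x - a) ^ (d + 1 - k) * poly (g a) x)"
      using step by blast
    let ?g = "\<lambda>a. g a + (if a = a0 then smult c ([:- a0, 1:] ^ (k - 1 - r)) else 0)"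
    have "degree (?g a) \<le> k - 1" for a
      using g(1) b(2) by (auto intro!: degree_add_le order_trans[OF degree_smult_le] simp: degree_linear_power)
    moreover have "(c *\<^sub>R b + h) x = (\<Sum>a\<in>A. (x - a) ^ (d + 1 - k) * poly (?g a) x)" for x
    proof -
      have e: "d - r = (d + 1 - k) + (k - 1 - r)" using b(2) assms(3) by simp
      have "(\<Sum>a\<in>A. (x - a) ^ (d + 1 - k) * poly (?g a) x) =
        h x + (\<Sum>a\<in>A. if a = a0 then c * (x - a0) ^ (d - r) else 0)"
        unfolding g(2) sum.distrib[symmetric]
        by (intro sum.cong refl) (auto simp: algebra_simps e power_add poly_power)
      then show ?thesis using b assms(1) by simp
    qed
    ultimately show ?case by (intro exI[of _ ?g]) simp
  qed
  from this[OF monomial_in_span_shifted_powers[OF assms]] show ?thesis .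
qed

text \<open>Used with m = \<open>d1\<close> and k = \<open>d1 - \<alpha>\<close>: the exponent
  becomes \<alpha> + 1, the cofactors have the degree of a vertex cofactor, and the bound on
  \<open>card N\<close> is what \<open>min_vertices\<close> provides. The degree in y is only
  carried along.\<close>

lemma Pol_as_shifted_powers_x:
  fixes N :: "point set"
  assumes N: "finite N" "inj_on fst N" "m + 1 \<le> card N * k" "k \<le> m" and f: "f \<in> Pol m n"
  shows "\<exists>g. (\<forall>v. g v \<in> Pol (k - 1) n) \<and> f = (\<lambda>z. \<Sum>v\<in>N. (fst z - fst v) ^ (m + 1 - k) * g v z)"
proof -
  obtain c where c: "f = (\<lambda>z. \<Sum>i\<le>m. \<Sum>j\<le>n. c (i, j) * fst z ^ i * snd z ^ j)"
    using f by (auto simp: Pol_monomials)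
  have "\<exists>g. (\<forall>a. degree (g a) \<le> k - 1) \<and>
      (\<forall>x. x ^ i = (\<Sum>a\<in>fst ` N. (x - a) ^ (m + 1 - k) * poly (g a) x))" if "i \<le> m" for i
    using N that by (intro monomial_as_shifted_powers) (auto simp: card_image)
  then obtain g where g: "\<And>i a. i \<le> m \<Longrightarrow> degree (g i a) \<le> k - 1"
      "\<And>i x. i \<le> m \<Longrightarrow> x ^ i = (\<Sum>a\<in>fst ` N. (x - a) ^ (m + 1 - k) * poly (g i a) x)"
    by metis
  define G where "G v = (\<Sum>i\<le>m. \<Sum>j\<le>n. (\<lambda>z. poly (g i (fst v)) (fst z) * poly (monom (c (i, j)) j) (snd z)))"
    for v :: point
  have "G v \<in> Pol (k - 1) n" for v
    unfolding G_def
  proof (intro subspace_sum[OF subspace_Pol])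
    fix i j assume "i \<in> {..m}" "j \<in> {..n}"
    then show "(\<lambda>z. poly (g i (fst v)) (fst z) * poly (monom (c (i, j)) j) (snd z)) \<in> Pol (k - 1) n"
      using Pol_mult[OF Pol_fst[of "g i (fst v)" "k - 1" 0] Pol_snd[of "monom (c (i,j)) j" n 0]] g(1)
        order_trans[OF degree_monom_le[of "c (i, j)" j], of n] by simp
  qed
  moreover have "f z = (\<Sum>v\<in>N. (fst z - fst v) ^ (m + 1 - k) * G v z)" for z
  proof -
    have "f z = (\<Sum>i\<le>m. \<Sum>j\<le>n. c (i, j) * (\<Sum>v\<in>N. (fst z - fst v) ^ (m + 1 - k) * poly (g i (fst v)) (fst z)) * snd z ^ j)"
      unfolding c using g(2) N(2) by (intro sum.cong refl) (simp add: sum.reindex)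
    also have "\<dots> = (\<Sum>i\<le>m. \<Sum>j\<le>n. \<Sum>v\<in>N. (fst z - fst v) ^ (m + 1 - k) * (poly (g i (fst v)) (fst z) * (c (i, j) * snd z ^ j)))"
      by (simp add: sum_distrib_left sum_distrib_right mult_ac)
    also have "\<dots> = (\<Sum>v\<in>N. \<Sum>i\<le>m. \<Sum>j\<le>n. (fst z - fst v) ^ (m + 1 - k) * (poly (g i (fst v)) (fst z) * (c (i, j) * snd z ^ j)))"
      by (simp only: sum.swap[of _ "{..n}" N] sum.swap[of _ "{..m}" N])
    also have "\<dots> = (\<Sum>v\<in>N. (fst z - fst v) ^ (m + 1 - k) * G v z)"
      by (simp add: G_def sum_fun_apply sum_distrib_left poly_monom)
    finally show ?thesis .
  qed
  ultimately show ?thesis by blast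
qed

lemma Pol_swap: "f \<in> Pol m n \<Longrightarrow> (\<lambda>z. f (prod.swap z)) \<in> Pol n m"
proof -
  assume "f \<in> Pol m n"
  then obtain c where c: "f = (\<lambda>z. \<Sum>i\<le>m. \<Sum>j\<le>n. c (i, j) * fst z ^ i * snd z ^ j)"
    by (auto simp: Pol_monomials)
  have "(\<lambda>z. f (prod.swap z)) = (\<lambda>z. \<Sum>j\<le>n. \<Sum>i\<le>m. (c \<circ> prod.swap) (j, i) * fst z ^ j * snd z ^ i)"
    unfolding c by (rule ext, subst sum.swap) (simp add: mult_ac)
  then show ?thesis unfolding Pol_monomials by (rule exI[of _ "c \<circ> prod.swap"])
qed

lemma Pol_as_shifted_powers_y:
  fixes N :: "point set"
  assumes N: "finite N" "inj_on snd N" "n + 1 \<le> card N * k" "k \<le> n" and f: "f \<in> Pol m n"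
  shows "\<exists>g. (\<forall>v. g v \<in> Pol m (k - 1)) \<and> f = (\<lambda>z. \<Sum>v\<in>N. (snd z - snd v) ^ (n + 1 - k) * g v z)"
proof -
  have inj: "inj_on prod.swap N" by (rule inj_onI) (metis swap_swap)
  have "inj_on fst (prod.swap ` N)" using N(2) by (auto simp: inj_on_def)
  then obtain g where g: "\<And>v. g v \<in> Pol (k - 1) m"
      "(\<lambda>z. f (prod.swap z)) = (\<lambda>z. \<Sum>v\<in>prod.swap ` N. (fst z - fst v) ^ (n + 1 - k) * g v z)"
    using Pol_as_shifted_powers_x[of "prod.swap ` N" n k "\<lambda>z. f (prod.swap z)" m] N
      Pol_swap[OF f] by (auto simp: card_image inj)
  have "f z = (\<Sum>v\<in>N. (snd z - snd v) ^ (n + 1 - k) * g (prod.swap v) (prod.swap z))" for z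
    using fun_cong[OF g(2), of "prod.swap z"] by (simp add: sum.reindex[OF inj])
  moreover have "(\<lambda>z. g (prod.swap v) (prod.swap z)) \<in> Pol m (k - 1)" for v
    using Pol_swap[OF g(1)] .
  ultimately show ?thesis by (intro exI[of _ "\<lambda>v z. g (prod.swap v) (prod.swap z)"]) auto
qed

section \<open>Grid coordinates and gaps\<close>

text \<open>The shift \<open>e\<close> is so small that \<open>x + e\<close> and \<open>x - e\<close> stand for the one-sided limits at a grid
  coordinate \<open>x\<close>.\<close>

locale sep =
  fixes Z :: "real set" and e :: real
  assumes fin: "finite Z" and e: "e > 0"
    and sep: "x \<in> Z \<Longrightarrow> x' \<in> Z \<Longrightarrow> x < x' \<Longrightarrow> x + 2 * e < x'"
begin

text \<open>At a grid coordinate both sides have to be inspected; elsewhere x is generic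
  already.\<close>

definition off :: "real \<Rightarrow> real set" where
  "off x = (if x \<in> Z then {x - e, x + e} else {x})"

text \<open>Both numbers lie in the same component of the complement of \<open>Z\<close>; thus
  \<open>gap x x\<close> says that x is generic.\<close>

definition gap :: "real \<Rightarrow> real \<Rightarrow> bool" where
  "gap x x' \<longleftrightarrow> (\<forall>t\<in>Z. t < x \<and> t < x' \<or> x < t \<and> x' < t)"

lemma shift_notin: "x \<in> Z \<Longrightarrow> x + e \<notin> Z" "x \<in> Z \<Longrightarrow> x - e \<notin> Z"
  using sep[of x "x + e"] sep[of "x - e" x] e by auto

lemma off_notin: "x' \<in> off x \<Longrightarrow> x' \<notin> Z"
  by (auto simp: off_def shift_notin split: if_splits)

lemma off_nonempty: "off x \<noteq> {}"
  by (auto simp: off_def)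

lemma off_mem: "x \<in> Z \<Longrightarrow> x + e \<in> off x" "x \<in> Z \<Longrightarrow> x - e \<in> off x" "x \<notin> Z \<Longrightarrow> x \<in> off x"
  by (auto simp: off_def)

lemma right_of: "x \<in> Z \<Longrightarrow> a \<in> Z \<Longrightarrow> a \<le> x + e \<longleftrightarrow> a \<le> x" "x \<in> Z \<Longrightarrow> a \<in> Z \<Longrightarrow> x + e \<le> a \<longleftrightarrow> x < a"
  "x \<in> Z \<Longrightarrow> a \<in> Z \<Longrightarrow> x + e < a \<longleftrightarrow> x < a" "x \<in> Z \<Longrightarrow> a \<in> Z \<Longrightarrow> a < x + e \<longleftrightarrow> a \<le> x"
  using sep[of x a] sep[of a x] e by linarith+

lemma left_of: "x \<in> Z \<Longrightarrow> a \<in> Z \<Longrightarrow> x - e \<le> a \<longleftrightarrow> x \<le> a" "x \<in> Z \<Longrightarrow> a \<in> Z \<Longrightarrow> a \<le> x - e \<longleftrightarrow> a < x"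
  "x \<in> Z \<Longrightarrow> a \<in> Z \<Longrightarrow> a < x - e \<longleftrightarrow> a < x" "x \<in> Z \<Longrightarrow> a \<in> Z \<Longrightarrow> x - e < a \<longleftrightarrow> x \<le> a"
  using sep[of x a] sep[of a x] e by linarith+

lemma off_between:
  assumes "x' \<in> off x" "a \<in> Z" "b \<in> Z" "a \<le> x'" "x' \<le> b"
  shows "a \<le> x" "x \<le> b" "a < x'" "x' < b"
  using assms off_notin[OF assms(1)]
  by (auto simp: off_def right_of left_of split: if_splits) (metis less_eq_real_def)+

text \<open>Points just right of a grid coordinate x lie in every closed grid interval that contains
  x + e, points just left of it in those that contain x - e. Cells are products of such
  intervals.\<close>

lemma near:
  "\<exists>\<delta>>0. \<forall>t. \<bar>t - x\<bar> < \<delta> \<longrightarrow> (\<exists>x'\<in>off x. \<forall>a\<in>Z. \<forall>b\<in>Z. a \<le> x' \<and> x' \<le> b \<longrightarrow> a \<le> t \<and> t \<le> b)"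
proof (cases "x \<in> Z")
  case True
  have "\<exists>x'\<in>off x. \<forall>a\<in>Z. \<forall>b\<in>Z. a \<le> x' \<and> x' \<le> b \<longrightarrow> a \<le> t \<and> t \<le> b" if t: "\<bar>t - x\<bar> < e" for t
  proof (cases "x \<le> t")
    case True': True
    show ?thesis
    proof (intro bexI[of _ "x + e"] ballI impI)
      fix a b assume "a \<in> Z" "b \<in> Z" "a \<le> x + e \<and> x + e \<le> b"
      then show "a \<le> t \<and> t \<le> b" using True' t right_of(1)[OF True, of a] by linarith
    qed (simp add: off_def True)
  next
    case False
    show ?thesis
    proof (intro bexI[of _ "x - e"] ballI impI)
      fix a b assume "a \<in> Z" "b \<in> Z" "a \<le> x - e \<and> x - e \<le> b"
      then show "a \<le> t \<and> t \<le> b" using False t left_of(1)[OF True, of b] by linarith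
    qed (simp add: off_def True)
  qed
  then show ?thesis using e by blast
next
  case False
  obtain \<delta> where \<delta>: "\<delta> > 0" "\<forall>z\<in>Z. z \<noteq> x \<longrightarrow> \<delta> \<le> dist x z"
    using finite_set_avoid[OF fin, of x] by blast
  have "a \<le> t \<and> t \<le> b" if "\<bar>t - x\<bar> < \<delta>" "a \<in> Z" "b \<in> Z" "a \<le> x" "x \<le> b" for t a b
    using that \<delta>(2) False by (auto simp: dist_real_def)
  moreover have "x \<in> off x" using False by (simp add: off_def)
  ultimately show ?thesis using \<delta>(1) by (intro exI[of _ \<delta>]) blast
qed

lemma gap_right:
  assumes "x \<in> Z" "x < t" "t \<le> x + 2 * e" shows "gap (x + e) t"
  unfolding gap_def
proof
  fix s assume "s \<in> Z"
  then show "s < x + e \<and> s < t \<or> x + e < s \<and> t < s"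
    using assms e sep[of x s] by (cases "x < s") auto
qed

lemma gap_left:
  assumes "x \<in> Z" "t < x" "x - 2 * e \<le> t" shows "gap (x - e) t"
  unfolding gap_def
proof
  fix s assume "s \<in> Z"
  then show "s < x - e \<and> s < t \<or> x - e < s \<and> t < s"
    using assms e sep[of s x] by (cases "s < x") auto
qed

lemma gap_sym: "gap x x' \<Longrightarrow> gap x' x"
  by (auto simp: gap_def)

lemma off_near:
  assumes "x' \<in> off x" "\<delta> > 0"
  shows "\<exists>t. \<bar>t - x\<bar> < \<delta> \<and> gap t x'"
proof (cases "x \<in> Z")
  case True
  let ?m = "min (\<delta> / 2) e"
  have m: "0 < ?m" "?m < \<delta>" "?m \<le> e" using assms e by auto
  have "gap (x + ?m) (x + e)" using m True e by (intro gap_sym[OF gap_right]) auto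
  moreover have "gap (x - ?m) (x - e)" using m True e by (intro gap_sym[OF gap_left]) auto
  moreover have "\<bar>x + ?m - x\<bar> < \<delta>" "\<bar>x - ?m - x\<bar> < \<delta>" using m by auto
  moreover have "x' = x + e \<or> x' = x - e" using assms(1) True by (auto simp: off_def)
  ultimately show ?thesis by blast
next
  case False
  then have "gap x x" unfolding gap_def by (metis linorder_neqE)
  then show ?thesis using assms False by (auto simp: off_def intro!: exI[of _ x])
qed

lemma gap_refl: "x \<notin> Z \<Longrightarrow> gap x x"
  unfolding gap_def by (metis linorder_neqE)

lemma gap_notin: "gap x x' \<Longrightarrow> x \<notin> Z" "gap x x' \<Longrightarrow> x' \<notin> Z"
  by (auto simp: gap_def)

lemma gap_le: "gap x x' \<Longrightarrow> a \<in> Z \<Longrightarrow> a \<le> x \<longleftrightarrow> a \<le> x'" "gap x x' \<Longrightarrow> a \<in> Z \<Longrightarrow> x \<le> a \<longleftrightarrow> x' \<le> a"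
  "gap x x' \<Longrightarrow> a \<in> Z \<Longrightarrow> a < x \<longleftrightarrow> a < x'" "gap x x' \<Longrightarrow> a \<in> Z \<Longrightarrow> x < a \<longleftrightarrow> x' < a"
  unfolding gap_def by force+

text \<open>Telescoping for step functions: nothing changes between consecutive breakpoints. The
  induction removes the last breakpoint before y.\<close>

lemma sum_jumps:
  fixes h :: "real \<Rightarrow> 'a::ab_group_add"
  assumes h: "\<And>s t. gap s t \<Longrightarrow> h s = h t"
    and "x \<notin> Z" "y \<notin> Z" "x \<le> y"
  shows "h y = h x + (\<Sum>z | z \<in> Z \<and> x < z \<and> z < y. h (z + e) - h (z - e))"
  using assms(2-)
proof (induction "card {z \<in> Z. x < z \<and> z < y}" arbitrary: y)
  case 0
  then have none: "{z \<in> Z. x < z \<and> z < y} = {}" using fin by simp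
  have "gap x y" unfolding gap_def
  proof
    fix t assume "t \<in> Z"
    then have "t \<noteq> x" "t \<noteq> y" "\<not> (x < t \<and> t < y)" using 0(2,3) none by auto
    then show "t < x \<and> t < y \<or> x < t \<and> y < t" using 0(4) by (cases "t < x"; cases "t < y") auto
  qed
  then show ?case using h[of x y] by (simp only: none sum.empty add_0_right)
next
  case (Suc n)
  let ?S = "{z \<in> Z. x < z \<and> z < y}"
  have finS: "finite ?S" using fin by simp
  have "?S \<noteq> {}" using Suc(2) by (metis card.empty nat.distinct(1))
  define z where "z = Max ?S"
  have z: "z \<in> ?S" unfolding z_def using finS \<open>?S \<noteq> {}\<close> by (rule Max_in)
  have zmax: "w \<le> z" if "w \<in> ?S" for w unfolding z_def using finS that by (rule Max_ge)
  have "gap (z + e) y" unfolding gap_def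
  proof
    fix t assume t: "t \<in> Z"
    have "t \<noteq> y" "t \<noteq> z + e" using t Suc z shift_notin by auto
    then show "t < z + e \<and> t < y \<or> z + e < t \<and> y < t"
      using t z zmax[of t] right_of[of z t] e by (cases "t \<le> z") (force, force)
  qed
  then have hy: "h y = h (z + e)" using h by metis
  have S: "?S = insert z {w \<in> Z. x < w \<and> w < z - e}"
    using z zmax left_of(3)[of z] by fastforce
  have nz: "z \<notin> {w \<in> Z. x < w \<and> w < z - e}" using e by auto
  have fin': "finite {w \<in> Z. x < w \<and> w < z - e}" using fin by simp
  have n: "n = card {w \<in> Z. x < w \<and> w < z - e}"
    using Suc(2) nz fin' by (simp add: S)
  have "h (z - e) = h x + (\<Sum>w | w \<in> Z \<and> x < w \<and> w < z - e. h (w + e) - h (w - e))"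
  proof (cases "x \<le> z - e")
    case True
    then show ?thesis using Suc(1)[OF n Suc(3)] shift_notin z by simp
  next
    case False
    \<comment> \<open>Here x lies between z - e and z, hence in the same gap as z - e, and no
      breakpoint is left.\<close>
    then have "gap (z - e) x" using z e by (intro gap_left) auto
    moreover have "{w. w \<in> Z \<and> x < w \<and> w < z - e} = {}" using False by auto
    ultimately show ?thesis using h[of "z - e" x] by (simp only: sum.empty add_0_right)
  qed
  then show ?case
    unfolding S sum.insert[OF fin' nz] hy by (simp add: algebra_simps)
qed

end

section \<open>Geometry of T-meshes\<close>

lemma closed_segment_horizontal:
  "closed_segment (a, y) (b, y) = closed_segment a b \<times> {y :: real}" for a b :: real
proof -
  have "(1 - u) * y + u * y = y" for u by (simp add: algebra_simps)
  then show ?thesis by (auto simp: closed_segment_def)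
qed

lemma closed_segment_horizontal':
  "a \<le> b \<Longrightarrow> closed_segment (a, y) (b, y) = {a..b} \<times> {y :: real}" for a b :: real
  by (simp add: closed_segment_horizontal closed_segment_eq_real_ivl)

locale mesh =
  fixes T :: "point set set" and e :: real
  assumes tmesh: "tmesh T"
    and sepX: "sep (fst ` vertices T) e" and sepY: "sep (snd ` vertices T) e"
begin

definition X where "X = fst ` vertices T"
definition Y where "Y = snd ` vertices T"

sublocale X: sep X e by (simp add: X_def sepX)
sublocale Y: sep Y e by (simp add: Y_def sepY)

lemma vertices_fst: "(x, y) \<in> vertices T \<Longrightarrow> x \<in> X"
  and vertices_snd: "(x, y) \<in> vertices T \<Longrightarrow> y \<in> Y"
  by (force simp: X_def Y_def)+

lemma finite_T: "finite T"
  using tmesh by (simp add: tmesh_def)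

lemma rectE:
  assumes "F \<in> T"
  obtains a b c d where "a < b" "c < d" "F = {a..b} \<times> {c..d}" "a \<in> X" "b \<in> X" "c \<in> Y" "d \<in> Y"
    "(a, c) \<in> vertices T" "(b, c) \<in> vertices T" "(a, d) \<in> vertices T" "(b, d) \<in> vertices T"
proof -
  obtain a b c d where F: "a < b" "c < d" "F = {a..b} \<times> {c..d}"
  proof -
    have "is_rectangle F" using assms tmesh by (simp add: tmesh_def)
    then show ?thesis unfolding is_rectangle_def by (elim exE conjE) (rule that)
  qed
  have v: "z \<in> vertices T" if "z \<in> {a, b} \<times> {c, d}" for z
  proof -
    have "z \<in> corners F" unfolding corners_def mem_Collect_eq
      by (rule exI[of _ a], rule exI[of _ b], rule exI[of _ c], rule exI[of _ d]) (simp only: F that)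
    then show ?thesis using assms unfolding vertices_def by blast
  qed
  have v': "(a, c) \<in> vertices T" "(b, c) \<in> vertices T" "(a, d) \<in> vertices T" "(b, d) \<in> vertices T"
    by (simp_all add: v)
  show ?thesis
    by (rule that[OF F _ _ _ _ v']) (use v' vertices_fst vertices_snd in blast)+
qed

lemma finite_vertices: "finite (vertices T)"
proof -
  have "vertices T \<subseteq> X \<times> Y" using vertices_fst vertices_snd by auto
  then show ?thesis using X.fin Y.fin finite_subset by blast
qed

lemma cell_closed: "F \<in> T \<Longrightarrow> closed F"
  by (elim rectE) (auto intro!: closed_Times)

lemma closed_domain: "closed (domain T)"
  unfolding domain_def using finite_T cell_closed by blast

lemma cell_subset: "F \<in> T \<Longrightarrow> F \<subseteq> domain T"
  by (auto simp: domain_def)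

lemma vertices_subset: "vertices T \<subseteq> domain T"
  unfolding vertices_def domain_def corners_def by auto

lemma interior_vertices_eq: "interior_vertices T = vertices T \<inter> interior (domain T)"
  and boundary_vertices_eq: "boundary_vertices T = vertices T - interior (domain T)"
  using vertices_subset closed_domain
  by (auto simp: interior_vertices_def boundary_vertices_def frontier_def)

section \<open>Cells near a point and the interior of the domain\<close>

lemma cell_disjoint:
  assumes "F \<in> T" "G \<in> T" "z \<in> interior F" "z \<in> G" shows "F = G"
proof (rule ccontr)
  assume "F \<noteq> G"
  moreover have "z \<in> F" using assms(3) interior_subset by blast
  ultimately have "z \<in> frontier F" using assms tmesh unfolding tmesh_def by blast
  then show False using assms(3) by (simp add: frontier_def)
qed

lemma cell_frontier: "F \<in> T \<Longrightarrow> G \<in> T \<Longrightarrow> F \<noteq> G \<Longrightarrow> F \<inter> G \<subseteq> frontier F"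
  using tmesh unfolding tmesh_def by blast

lemma generic_interior:
  assumes "F \<in> T" "(x, y) \<in> F" "x \<notin> X" "y \<notin> Y" shows "(x, y) \<in> interior F"
proof -
  obtain a b c d where F: "F = {a..b} \<times> {c..d}" "a \<in> X" "b \<in> X" "c \<in> Y" "d \<in> Y"
    using assms(1) by (rule rectE)
  then have "a < x" "x < b" "c < y" "y < d" using assms by (auto simp: less_le)
  then show ?thesis by (simp add: F interior_Times)
qed

lemma cell_unique:
  assumes "F \<in> T" "G \<in> T" "(x, y) \<in> F" "(x, y) \<in> G" "x \<notin> X" "y \<notin> Y" shows "F = G"
  using cell_disjoint generic_interior assms by blast

lemma cell_gap:
  assumes "F \<in> T" "X.gap x x'" "Y.gap y y'" shows "(x, y) \<in> F \<longleftrightarrow> (x', y') \<in> F"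
proof -
  obtain a b c d where F: "F = {a..b} \<times> {c..d}" "a \<in> X" "b \<in> X" "c \<in> Y" "d \<in> Y"
    using assms(1) by (rule rectE)
  then show ?thesis using X.gap_le[OF assms(2)] Y.gap_le[OF assms(3)] by simp
qed

lemma domain_gap:
  assumes "X.gap x x'" "Y.gap y y'" shows "(x, y) \<in> domain T \<longleftrightarrow> (x', y') \<in> domain T"
  using cell_gap[OF _ assms] by (auto simp: domain_def)

text \<open>Cells are closed, so a cell contains the grid points that are approached from inside
  it.\<close>

lemma cell_off:
  assumes "F \<in> T" "x' \<in> X.off x" "y' \<in> Y.off y" "(x', y') \<in> F" shows "(x, y) \<in> F"
proof -
  obtain a b c d where F: "F = {a..b} \<times> {c..d}" "a \<in> X" "b \<in> X" "c \<in> Y" "d \<in> Y"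
    using assms(1) by (rule rectE)
  then show ?thesis using X.off_between[OF assms(2)] Y.off_between[OF assms(3)] assms(4) by auto
qed

text \<open>Interiority depends only on the at most four grid cells around the point, each
  represented by one generic point. This turns a topological question into a finite test.\<close>

lemma interior_domain_iff:
  "(x, y) \<in> interior (domain T) \<longleftrightarrow> (\<forall>x'\<in>X.off x. \<forall>y'\<in>Y.off y. (x', y') \<in> domain T)"
proof
  assume int: "(x, y) \<in> interior (domain T)"
  show "\<forall>x'\<in>X.off x. \<forall>y'\<in>Y.off y. (x', y') \<in> domain T"
  proof (intro ballI)
    fix x' y' assume x': "x' \<in> X.off x" and y': "y' \<in> Y.off y"
    obtain A B where AB: "open A" "open B" "x \<in> A" "y \<in> B" "A \<times> B \<subseteq> domain T"
      using open_prod_elim[OF open_interior int] interior_subset[of "domain T"]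
      by (metis mem_Sigma_iff subset_trans)
    obtain \<delta> where \<delta>: "\<delta> > 0" "\<And>t. \<bar>t - x\<bar> < \<delta> \<Longrightarrow> t \<in> A"
      using AB(1,3) unfolding open_dist dist_real_def by blast
    obtain \<epsilon> where \<epsilon>: "\<epsilon> > 0" "\<And>t. \<bar>t - y\<bar> < \<epsilon> \<Longrightarrow> t \<in> B"
      using AB(2,4) unfolding open_dist dist_real_def by blast
    obtain s where s: "\<bar>s - x\<bar> < \<delta>" "X.gap s x'" using X.off_near[OF x' \<delta>(1)] by blast
    obtain t where t: "\<bar>t - y\<bar> < \<epsilon>" "Y.gap t y'" using Y.off_near[OF y' \<epsilon>(1)] by blast
    have "(s, t) \<in> domain T" using \<delta>(2)[OF s(1)] \<epsilon>(2)[OF t(1)] AB(5) by blast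
    then show "(x', y') \<in> domain T" using domain_gap[OF s(2) t(2)] by simp
  qed
next
  assume all: "\<forall>x'\<in>X.off x. \<forall>y'\<in>Y.off y. (x', y') \<in> domain T"
  obtain \<delta> where \<delta>: "\<delta> > 0"
    "\<forall>t. \<bar>t - x\<bar> < \<delta> \<longrightarrow> (\<exists>x'\<in>X.off x. \<forall>a\<in>X. \<forall>b\<in>X. a \<le> x' \<and> x' \<le> b \<longrightarrow> a \<le> t \<and> t \<le> b)"
    using X.near by blast
  obtain \<epsilon> where \<epsilon>: "\<epsilon> > 0"
    "\<forall>t. \<bar>t - y\<bar> < \<epsilon> \<longrightarrow> (\<exists>y'\<in>Y.off y. \<forall>a\<in>Y. \<forall>b\<in>Y. a \<le> y' \<and> y' \<le> b \<longrightarrow> a \<le> t \<and> t \<le> b)"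
    using Y.near by blast
  have "ball x \<delta> \<times> ball y \<epsilon> \<subseteq> domain T"
  proof clarify
    fix s t assume "s \<in> ball x \<delta>" "t \<in> ball y \<epsilon>"
    then have "\<bar>s - x\<bar> < \<delta>" "\<bar>t - y\<bar> < \<epsilon>" by (auto simp: dist_real_def)
    then obtain x' y' where x': "x' \<in> X.off x" "\<forall>a\<in>X. \<forall>b\<in>X. a \<le> x' \<and> x' \<le> b \<longrightarrow> a \<le> s \<and> s \<le> b"
      and y': "y' \<in> Y.off y" "\<forall>a\<in>Y. \<forall>b\<in>Y. a \<le> y' \<and> y' \<le> b \<longrightarrow> a \<le> t \<and> t \<le> b"
      using \<delta>(2) \<epsilon>(2) by blast
    obtain F where F: "F \<in> T" "(x', y') \<in> F" using all x'(1) y'(1) by (auto simp: domain_def)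
    obtain a b c d where "F = {a..b} \<times> {c..d}" "a \<in> X" "b \<in> X" "c \<in> Y" "d \<in> Y"
      using F(1) by (rule rectE)
    then have "(s, t) \<in> F" using F(2) x'(2) y'(2) by auto
    then show "(s, t) \<in> domain T" using F(1) by (auto simp: domain_def)
  qed
  moreover have "(x, y) \<in> ball x \<delta> \<times> ball y \<epsilon>" using \<delta>(1) \<epsilon>(1) by simp
  ultimately show "(x, y) \<in> interior (domain T)"
    by (intro interiorI[of "ball x \<delta> \<times> ball y \<epsilon>"] open_Times open_ball)
qed

text \<open>The part of the mesh skeleton inside the open domain: the points where a spline may have
  a jump.\<close>

definition act :: "point \<Rightarrow> bool" where
  "act z \<longleftrightarrow> z \<in> interior (domain T) \<and> z \<in> (\<Union>F\<in>T. frontier F)"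

lemma interior_domain_edge:
  assumes "x \<notin> X" "y \<in> Y"
  shows "(x, y) \<in> interior (domain T) \<longleftrightarrow> (x, y + e) \<in> domain T \<and> (x, y - e) \<in> domain T"
  using assms by (auto simp: interior_domain_iff X.off_def Y.off_def)

text \<open>If one cell lay on both sides, the point would be in its interior and so on the frontier
  of no cell; two different cells meet only on their frontiers.\<close>

lemma act_iff:
  assumes x: "x \<notin> X" and y: "y \<in> Y"
  shows "act (x, y) \<longleftrightarrow> (\<exists>F\<in>T. \<exists>G\<in>T. F \<noteq> G \<and> (x, y + e) \<in> F \<and> (x, y - e) \<in> G)"
proof
  assume "act (x, y)"
  then have int: "(x, y) \<in> interior (domain T)" and fr: "(x, y) \<in> (\<Union>F\<in>T. frontier F)"
    by (auto simp: act_def)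
  obtain F G where FG: "F \<in> T" "G \<in> T" "(x, y + e) \<in> F" "(x, y - e) \<in> G"
    using int interior_domain_edge[OF x y] by (auto simp: domain_def)
  have "F \<noteq> G"
  proof
    assume "F = G"
    obtain a b c d where F: "F = {a..b} \<times> {c..d}" "a \<in> X" "b \<in> X" using FG(1) by (rule rectE)
    have "(x, y) \<in> interior F"
      using FG(3,4) \<open>F = G\<close> F x Y.e by (auto simp: interior_Times less_le)
    moreover obtain F' where F': "F' \<in> T" "(x, y) \<in> frontier F'" using fr by blast
    moreover have "(x, y) \<in> F'" using F' cell_closed[OF F'(1)] by (auto simp: frontier_def)
    ultimately show False using cell_disjoint[OF FG(1) F'(1)] by (auto simp: frontier_def)
  qed
  then show "\<exists>F\<in>T. \<exists>G\<in>T. F \<noteq> G \<and> (x, y + e) \<in> F \<and> (x, y - e) \<in> G" using FG by blast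
next
  assume "\<exists>F\<in>T. \<exists>G\<in>T. F \<noteq> G \<and> (x, y + e) \<in> F \<and> (x, y - e) \<in> G"
  then obtain F G where FG: "F \<in> T" "G \<in> T" "F \<noteq> G" "(x, y + e) \<in> F" "(x, y - e) \<in> G" by blast
  have int: "(x, y) \<in> interior (domain T)"
    using interior_domain_edge[OF x y] FG cell_subset by blast
  have "(x, y) \<in> F \<inter> G"
    using cell_off[OF FG(1) X.off_mem(3)[OF x] Y.off_mem(1)[OF y] FG(4)]
      cell_off[OF FG(2) X.off_mem(3)[OF x] Y.off_mem(2)[OF y] FG(5)] by blast
  then show "act (x, y)" using int cell_frontier[OF FG(1,2,3)] FG(1) by (auto simp: act_def)
qed

lemma act_gap:
  assumes "X.gap x x'" "y \<in> Y" shows "act (x, y) \<longleftrightarrow> act (x', y)"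
proof -
  have "Y.gap (y + e) (y + e)" "Y.gap (y - e) (y - e)"
    using assms(2) Y.shift_notin Y.gap_refl by blast+
  then show ?thesis
    using X.gap_notin[OF assms(1)] cell_gap[OF _ assms(1)] assms(2)
    by (simp add: act_iff cong: bex_cong)
qed

lemma not_act_cell:
  assumes x: "x \<notin> X" and y: "y \<in> Y" and "(x, y) \<in> interior (domain T)" "\<not> act (x, y)"
  shows "\<exists>F\<in>T. (x, y + e) \<in> F \<and> (x, y - e) \<in> F"
proof -
  obtain F G where "F \<in> T" "G \<in> T" "(x, y + e) \<in> F" "(x, y - e) \<in> G"
    using assms(3) interior_domain_edge[OF x y] by (auto simp: domain_def)
  then show ?thesis using assms(4) act_iff[OF x y] by blast
qed

text \<open>A horizontal interior edge in coordinates, by \<open>hedge_interior_edge\<close>.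
  Activity is required at generic abscissas only, where \<open>act_iff\<close> can test it.\<close>

definition hedge :: "real \<Rightarrow> real \<Rightarrow> real \<Rightarrow> bool" where
  "hedge a b y \<longleftrightarrow> a < b \<and> (a, y) \<in> vertices T \<and> (b, y) \<in> vertices T \<and>
     (\<forall>t. a < t \<and> t < b \<longrightarrow> (t, y) \<notin> vertices T) \<and> (\<forall>t. a < t \<and> t < b \<and> t \<notin> X \<longrightarrow> act (t, y))"

text \<open>The lower side of the cell above and the upper side of the cell below run along the line
  y and end at vertices. The edge through t is bounded by the nearest vertices, so it lies within
  both sides.\<close>

lemma edge_at:
  assumes act: "act (t, y)" and t: "t \<notin> X" and y: "y \<in> Y"
  obtains a b F G where "hedge a b y" "a < t" "t < b" "F \<in> T" "G \<in> T" "F \<noteq> G"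
    "{a..b} \<times> {y} \<subseteq> F" "{a..b} \<times> {y} \<subseteq> G" "(t, y + e) \<in> F" "(t, y - e) \<in> G"
proof -
  obtain F G where FG: "F \<in> T" "G \<in> T" "F \<noteq> G" "(t, y + e) \<in> F" "(t, y - e) \<in> G"
    using act act_iff[OF t y] by blast
  obtain a1 b1 c1 d1 where F: "F = {a1..b1} \<times> {c1..d1}" "a1 \<in> X" "b1 \<in> X" "c1 \<in> Y" "d1 \<in> Y"
    "(a1, c1) \<in> vertices T" "(b1, c1) \<in> vertices T" using FG(1) by (rule rectE)
  obtain a2 b2 c2 d2 where G: "G = {a2..b2} \<times> {c2..d2}" "a2 \<in> X" "b2 \<in> X" "c2 \<in> Y" "d2 \<in> Y"
    "(a2, d2) \<in> vertices T" "(b2, d2) \<in> vertices T" using FG(2) by (rule rectE)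
  have F': "a1 < t" "t < b1" "c1 \<le> y" "y < d1"
    using FG(4) F t y Y.right_of by (auto simp: less_le)
  have G': "a2 < t" "t < b2" "c2 < y" "y \<le> d2"
    using FG(5) G t y Y.left_of by (auto simp: less_le)
  \<comment> \<open>Otherwise the upper cell would reach below the line and share a generic point
    with the lower cell.\<close>
  have "c1 = y"
  proof (rule ccontr)
    assume "c1 \<noteq> y"
    then have "(t, y - e) \<in> F" using F F' y Y.left_of(2)[OF y F(4)] Y.e by simp
    then show False
      using cell_unique[OF FG(1,2) _ FG(5) t] FG(3) Y.shift_notin(2)[OF y] by blast
  qed
  have "d2 = y"
  proof (rule ccontr)
    assume "d2 \<noteq> y"
    then have "(t, y + e) \<in> G" using G G' y Y.right_of(2)[OF y G(5)] Y.e by simp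
    then show False
      using cell_unique[OF FG(1,2,4) _ t] FG(3) Y.shift_notin(1)[OF y] by blast
  qed
  let ?A = "{s. (s, y) \<in> vertices T \<and> s < t}" and ?B = "{s. (s, y) \<in> vertices T \<and> t < s}"
  have fin: "finite ?A" "finite ?B"
    by (rule finite_subset[OF _ X.fin], use vertices_fst in blast)+
  have A: "a1 \<in> ?A" "a2 \<in> ?A" and B: "b1 \<in> ?B" "b2 \<in> ?B"
    using F G F' G' \<open>c1 = y\<close> \<open>d2 = y\<close> by auto
  define a b where "a = Max ?A" and "b = Min ?B"
  have amax: "s \<le> a" if "s \<in> ?A" for s unfolding a_def using fin(1) that by (rule Max_ge)
  have bmin: "b \<le> s" if "s \<in> ?B" for s unfolding b_def using fin(2) that by (rule Min_le)
  have "a \<in> ?A" unfolding a_def by (rule Max_in) (use fin A in blast)+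
  then have a: "a \<in> ?A" "a1 \<le> a" "a2 \<le> a" using amax A by blast+
  have "b \<in> ?B" unfolding b_def by (rule Min_in) (use fin B in blast)+
  then have b: "b \<in> ?B" "b \<le> b1" "b \<le> b2" using bmin B by blast+
  have "hedge a b y" unfolding hedge_def
  proof (intro conjI allI impI)
    fix s assume s: "a < s \<and> s < b"
    show "(s, y) \<notin> vertices T"
    proof
      assume "(s, y) \<in> vertices T"
      moreover from this have "s \<noteq> t" using t vertices_fst by blast
      ultimately have "s \<in> ?A \<or> s \<in> ?B" by auto
      then show False using amax bmin s by force
    qed
  next
    fix s assume s: "a < s \<and> s < b \<and> s \<notin> X"
    have "(s, y + e) \<in> F" "(s, y - e) \<in> G"
      using s a b FG(4,5) F(1) G(1) by auto
    then show "act (s, y)" using act_iff[of s y] s y FG by blast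
  qed (use a(1) b(1) in auto)
  moreover have "{a..b} \<times> {y} \<subseteq> F" "{a..b} \<times> {y} \<subseteq> G"
    using F(1) G(1) F' G' a b by auto
  ultimately show ?thesis using that[of a b F G] a(1) b(1) FG by auto
qed

section \<open>Horizontal interior edges in coordinates\<close>

lemma horizontal_subset: "horizontal s \<Longrightarrow> s' \<subseteq> s \<Longrightarrow> horizontal s'"
  unfolding horizontal_def by blast

lemma horizontal_segmentE:
  assumes "horizontal (closed_segment p q)" "p \<noteq> q"
  obtains a b y where "a < b" "{p, q} = {(a, y), (b, y)}" "closed_segment p q = {a..b} \<times> {y}"
proof -
  obtain x1 y1 x2 y2 where p: "p = (x1, y1)" and q: "q = (x2, y2)" by (metis surj_pair)
  obtain y where "\<forall>z\<in>closed_segment p q. snd z = y" using assms(1) unfolding horizontal_def by blast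
  then have "snd p = y" "snd q = y" by (blast intro: ends_in_segment)+
  then have y: "y1 = y2" by (simp add: p q)
  show ?thesis
  proof (cases "x1 < x2")
    case True
    then show ?thesis using closed_segment_horizontal'[of x1 x2 y1] y
      by (intro that[of x1 x2 y1]) (auto simp: p q)
  next
    case False
    then have "x2 < x1" using assms(2) p q y by auto
    then show ?thesis using closed_segment_horizontal'[of x2 x1 y1] y
      by (intro that[of x2 x1 y1]) (auto simp: p q closed_segment_commute)
  qed
qed

lemma horizontal_interval [simp]: "horizontal ({a..b} \<times> {y})"
  unfolding horizontal_def by auto

lemma not_vertical_interval: "a < b \<Longrightarrow> \<not> vertical ({a..b} \<times> {y})"
proof
  assume "a < b" "vertical ({a..b} \<times> {y})"
  moreover from this have "(a, y) \<in> {a..b} \<times> {y}" "(b, y) \<in> {a..b} \<times> {y}" by auto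
  ultimately show False unfolding vertical_def by (metis fst_conv less_irrefl)
qed

lemma generic_between:
  fixes s :: real assumes "a < b" "a \<le> s" "s \<le> b" "\<delta> > 0"
  obtains t where "a < t" "t < b" "t \<notin> X" "\<bar>t - s\<bar> < \<delta>"
proof -
  have "max a (s - \<delta>) < min b (s + \<delta>)" using assms by auto
  then have "infinite {max a (s - \<delta>)<..<min b (s + \<delta>)}" by (rule infinite_Ioo)
  then have "infinite ({max a (s - \<delta>)<..<min b (s + \<delta>)} - X)" using X.fin by (rule Diff_infinite_finite[rotated])
  then obtain t where "t \<in> {max a (s - \<delta>)<..<min b (s + \<delta>)} - X"
    using infinite_imp_nonempty by blast
  then show ?thesis by (intro that[of t]) auto
qed

lemma hedge_interior_edge:
  "e' \<in> interior_edges T \<and> horizontal e' \<longleftrightarrow> (\<exists>a b y. hedge a b y \<and> e' = {a..b} \<times> {y})"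
proof
  assume "e' \<in> interior_edges T \<and> horizontal e'"
  then obtain p q where e': "e' = closed_segment p q" "p \<noteq> q" "horizontal (closed_segment p q)"
      "closed_segment p q \<subseteq> (\<Union>F\<in>T. frontier F)" "closed_segment p q \<inter> vertices T = {p, q}"
      "\<not> e' \<subseteq> frontier (domain T)"
    unfolding interior_edges_def edges_def by blast
  obtain a b y where ab: "a < b" "{p, q} = {(a, y), (b, y)}" "closed_segment p q = {a..b} \<times> {y}"
    using e'(3,2) by (rule horizontal_segmentE)
  have v: "(a, y) \<in> vertices T" "(b, y) \<in> vertices T" using e'(5) ab(2) by auto
  have y: "y \<in> Y" using v vertices_snd by blast
  \<comment> \<open>A point of the edge off the frontier is interior to the domain, and so is a
    generic point of the edge close to it. The edge found there must be all of \<open>e'\<close>,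
    since neither has a vertex strictly between its ends.\<close>
  obtain s where s: "a \<le> s" "s \<le> b" "(s, y) \<notin> frontier (domain T)"
  proof -
    obtain z where z: "z \<in> {a..b} \<times> {y}" "z \<notin> frontier (domain T)" using e'(1,6) ab(3) by blast
    then show ?thesis by (intro that[of "fst z"]) (auto simp: mem_Times_iff prod_eq_iff)
  qed
  have "F \<subseteq> domain T \<and> frontier F \<subseteq> F" if "F \<in> T" for F
    using that cell_subset cell_closed frontier_subset_closed by blast
  then have "e' \<subseteq> domain T" using e'(1,4) by blast
  moreover have "(s, y) \<in> e'" using s e'(1) ab(3) by simp
  ultimately have "(s, y) \<in> interior (domain T)"
    using s(3) closed_domain by (auto simp: frontier_def)
  then obtain r where r: "r > 0" "ball (s, y) r \<subseteq> domain T" by (auto simp: mem_interior)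
  obtain t where t: "a < t" "t < b" "t \<notin> X" "\<bar>t - s\<bar> < r"
    using generic_between[OF ab(1) s(1,2) r(1)] by blast
  have "(t, y) \<in> ball (s, y) r" using t(4) by (simp add: dist_Pair_Pair dist_real_def abs_minus_commute)
  then have "(t, y) \<in> interior (domain T)" using r(2) by (meson interior_maximal open_ball subsetD)
  moreover have "(t, y) \<in> {a..b} \<times> {y}" using t by simp
  then have "(t, y) \<in> (\<Union>F\<in>T. frontier F)" using e'(4) ab(3) by blast
  ultimately have "act (t, y)" by (simp add: act_def)
  then obtain a' b' where h: "hedge a' b' y" "a' < t" "t < b'" using edge_at[OF _ t(3) y] by metis
  have nv: "(s, y) \<notin> vertices T" if "a' < s" "s < b'" for s using h(1) that by (simp add: hedge_def)
  have "a \<le> a'" using nv[of a] v(1) t(1) h(3) by (cases "a \<le> a'") auto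
  moreover have "b' \<le> b" using nv[of b] v(2) t(2) h(2) by (cases "b' \<le> b") auto
  ultimately have "(a', y) \<in> {a..b} \<times> {y} \<inter> vertices T" "(b', y) \<in> {a..b} \<times> {y} \<inter> vertices T"
    using h t by (auto simp: hedge_def)
  then have "(a', y) \<in> {p, q}" "(b', y) \<in> {p, q}"
    using e'(5) ab(3) by auto
  then have "a' = a" "b' = b" using h t unfolding ab(2) by auto
  then show "\<exists>a b y. hedge a b y \<and> e' = {a..b} \<times> {y}" using h(1) e'(1) ab(3) by blast
next
  assume "\<exists>a b y. hedge a b y \<and> e' = {a..b} \<times> {y}"
  then obtain a b y where h: "hedge a b y" "e' = {a..b} \<times> {y}" by blast
  then have ab: "a < b" and y: "y \<in> Y" using vertices_snd by (auto simp: hedge_def)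
  obtain t where t: "a < t" "t < b" "t \<notin> X" using generic_between[OF ab order_refl, of 1] ab by auto
  have act: "act (t, y)" using h(1) t by (auto simp: hedge_def)
  then obtain a' b' F G where h': "hedge a' b' y" "a' < t" "t < b'" "F \<in> T" "G \<in> T" "F \<noteq> G"
    "{a'..b'} \<times> {y} \<subseteq> F" "{a'..b'} \<times> {y} \<subseteq> G" using edge_at[OF _ t(3) y] by metis
  have nv: "(s, y) \<notin> vertices T" if "a < s" "s < b" for s using h(1) that by (simp add: hedge_def)
  have nv': "(s, y) \<notin> vertices T" if "a' < s" "s < b'" for s using h'(1) that by (simp add: hedge_def)
  have v: "(a, y) \<in> vertices T" "(b, y) \<in> vertices T" "(a', y) \<in> vertices T" "(b', y) \<in> vertices T"
    using h(1) h'(1) by (auto simp: hedge_def)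
  have "a' = a" using nv[of a'] nv'[of a] v t h'(2,3) by (cases a a' rule: linorder_cases) auto
  have "b' = b" using nv[of b'] nv'[of b] v t h'(2,3) by (cases b b' rule: linorder_cases) auto
  then have "e' \<subseteq> F \<inter> G" using h'(7,8) h(2) \<open>a' = a\<close> by simp
  then have fr: "e' \<subseteq> frontier F" using cell_frontier[OF h'(4-6)] by (rule subset_trans)
  have seg: "e' = closed_segment (a, y) (b, y)" using closed_segment_horizontal' ab h(2) by simp
  have "e' \<inter> vertices T = {(a, y), (b, y)}"
    using h ab unfolding hedge_def by (auto simp: less_le)
  then have ends: "closed_segment (a, y) (b, y) \<inter> vertices T = {(a, y), (b, y)}" by (simp add: seg)
  have "e' \<in> edges T"
  proof -
    have "horizontal (closed_segment (a, y) (b, y))"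
      using horizontal_interval[of a b y] unfolding h(2)[symmetric] seg .
    moreover have "(a, y) \<noteq> (b, y)" "closed_segment (a, y) (b, y) \<subseteq> (\<Union>F\<in>T. frontier F)"
      using ab fr h'(4) seg by auto
    ultimately show ?thesis using ends unfolding edges_def seg by blast
  qed
  moreover have "(t, y) \<in> e'" "(t, y) \<notin> frontier (domain T)"
    using t h(2) act by (auto simp: act_def frontier_def)
  ultimately have "e' \<in> interior_edges T" unfolding interior_edges_def by blast
  then show "e' \<in> interior_edges T \<and> horizontal e'" using h(2) by simp
qed

lemma hedge_at:
  assumes "act (t, y)" "t \<notin> X" "y \<in> Y"
  obtains a b where "hedge a b y" "a < t" "t < b"
  by (rule edge_at[OF assms]) (rule that, assumption+)

lemma interior_edgeE:
  assumes "e' \<in> interior_edges T" "horizontal e'"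
  obtains a b y where "hedge a b y" "e' = {a..b} \<times> {y}"
proof -
  have "\<exists>a b y. hedge a b y \<and> e' = {a..b} \<times> {y}" using hedge_interior_edge[of e'] assms by (simp only: simp_thms)
  then show ?thesis by (elim exE conjE) (rule that)
qed

section \<open>Chains of edges and maximal chains\<close>

definition hchain :: "real \<Rightarrow> real \<Rightarrow> real \<Rightarrow> bool" where
  "hchain a b y \<longleftrightarrow> a < b \<and> (a, y) \<in> vertices T \<and> (b, y) \<in> vertices T \<and>
     (\<forall>t. a < t \<and> t < b \<and> t \<notin> X \<longrightarrow> act (t, y))"

lemma hchainD:
  assumes "hchain a b y"
  shows "a < b" "(a, y) \<in> vertices T" "(b, y) \<in> vertices T" "a \<in> X" "b \<in> X" "y \<in> Y"
    "a < t \<Longrightarrow> t < b \<Longrightarrow> t \<notin> X \<Longrightarrow> act (t, y)"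
  using assms vertices_fst vertices_snd by (auto simp: hchain_def)

lemma hedgeD:
  assumes "hedge a b y"
  shows "a < b" "(a, y) \<in> vertices T" "(b, y) \<in> vertices T" "a \<in> X" "b \<in> X" "y \<in> Y"
    "a < t \<Longrightarrow> t < b \<Longrightarrow> t \<notin> X \<Longrightarrow> act (t, y)" "a < t \<Longrightarrow> t < b \<Longrightarrow> (t, y) \<notin> vertices T"
  using assms vertices_fst vertices_snd by (auto simp: hedge_def)

lemma off_inside:
  assumes "a \<in> X" "b \<in> X" "a < b" "a \<le> t" "t \<le> b"
  obtains t' where "t' \<in> X.off t" "a < t'" "t' < b"
proof (cases "t \<in> X")
  case False
  then have "t \<noteq> a" "t \<noteq> b" using assms by auto
  then show ?thesis using that[of t] assms False by (auto simp: X.off_def)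
next
  case True
  show ?thesis
  proof (cases "t < b")
    case True': True
    then show ?thesis using that[of "t + e"] X.right_of[OF True] X.off_mem(1)[OF True] assms by auto
  next
    case False
    then show ?thesis using that[of "t - e"] X.left_of[OF True] X.off_mem(2)[OF True] assms X.e by auto
  qed
qed

lemma interval_subsetD:
  fixes a b :: real
  assumes "{a..b} \<times> {y} \<subseteq> {a'..b'} \<times> {y'}" "a \<le> b"
  shows "a' \<le> a" "b \<le> b'" "y = y'"
proof -
  have "(a, y) \<in> {a..b} \<times> {y}" "(b, y) \<in> {a..b} \<times> {y}" using assms(2) by auto
  then have "(a, y) \<in> {a'..b'} \<times> {y'}" "(b, y) \<in> {a'..b'} \<times> {y'}" using assms(1) by blast+
  then show "a' \<le> a" "b \<le> b'" "y = y'" by auto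
qed

lemma interval_eq_iff:
  fixes a b :: real
  assumes "a < b" "{a..b} \<times> {y} = {a'..b'} \<times> {y'}"
  shows "a = a' \<and> b = b' \<and> y = y'"
proof -
  have "(a, y) \<in> {a'..b'} \<times> {y'}" using assms by (metis atLeastAtMost_iff less_imp_le mem_Sigma_iff order_refl singletonI)
  then have "a' \<le> b'" by auto
  then show ?thesis
    using interval_subsetD[of a b y a' b' y'] interval_subsetD[of a' b' y' a b y] assms by auto
qed

lemma edge_chain_iff:
  "edge_chain T s \<and> horizontal s \<longleftrightarrow> (\<exists>a b y. hchain a b y \<and> s = {a..b} \<times> {y})"
proof
  assume s: "edge_chain T s \<and> horizontal s"
  then obtain p q A where pq: "p \<noteq> q" "s = closed_segment p q" and A: "A \<subseteq> interior_edges T" "s = \<Union>A"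
    unfolding edge_chain_def by blast
  obtain a b y where ab: "a < b" "closed_segment p q = {a..b} \<times> {y}"
    by (rule horizontal_segmentE[of p q]) (use s pq that in auto)
  have cover: "\<exists>a' b'. hedge a' b' y \<and> a \<le> a' \<and> b' \<le> b \<and> a' \<le> t \<and> t \<le> b'" if "a \<le> t" "t \<le> b" for t
  proof -
    have "(t, y) \<in> s" using that pq ab by simp
    then obtain e' where e': "e' \<in> A" "(t, y) \<in> e'" using A by blast
    have sub: "e' \<subseteq> s" using e' A by blast
    then have "horizontal e'" using s horizontal_subset by blast
    then obtain a' b' y' where h: "hedge a' b' y'" "e' = {a'..b'} \<times> {y'}"
      using interior_edgeE[of e'] e'(1) A(1) by blast
    have "a \<le> a'" "b' \<le> b" "y' = y"
      using interval_subsetD[of a' b' y' a b y] sub h hedgeD(1)[OF h(1)] pq ab by auto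
    then show ?thesis using h e'(2) by (intro exI[of _ a'] exI[of _ b']) auto
  qed
  have "hchain a b y" unfolding hchain_def
  proof (intro conjI allI impI)
    obtain a' b' where "hedge a' b' y" "a \<le> a'" "a' \<le> a" using cover[of a] ab(1) by auto
    then have "hedge a b' y" by simp
    then show "(a, y) \<in> vertices T" using hedgeD(2) by blast
    obtain a' b' where "hedge a' b' y" "b' \<le> b" "b \<le> b'" using cover[of b] ab(1) by auto
    then have "hedge a' b y" by simp
    then show "(b, y) \<in> vertices T" using hedgeD(3) by blast
    fix t assume t: "a < t \<and> t < b \<and> t \<notin> X"
    then obtain a' b' where h: "hedge a' b' y" "a' \<le> t" "t \<le> b'" using cover[of t] by auto
    then have "t \<noteq> a'" "t \<noteq> b'" using t hedgeD(4,5)[OF h(1)] by auto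
    then show "act (t, y)" using hedgeD(7)[OF h(1)] h t by simp
  qed (use ab in auto)
  then show "\<exists>a b y. hchain a b y \<and> s = {a..b} \<times> {y}" using pq ab by blast
next
  assume "\<exists>a b y. hchain a b y \<and> s = {a..b} \<times> {y}"
  then obtain a b y where h: "hchain a b y" "s = {a..b} \<times> {y}" by blast
  note c = hchainD[OF h(1)]
  let ?A = "{e'. \<exists>a' b'. hedge a' b' y \<and> e' = {a'..b'} \<times> {y} \<and> a \<le> a' \<and> b' \<le> b}"
  have "?A \<subseteq> interior_edges T" using hedge_interior_edge by blast
  moreover have "s = \<Union>?A"
  proof
    show "\<Union>?A \<subseteq> s" unfolding h(2) by auto
    show "s \<subseteq> \<Union>?A"
    proof
      fix z assume "z \<in> s"
      then obtain t where t: "z = (t, y)" "a \<le> t" "t \<le> b" using h(2) by auto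
      \<comment> \<open>t may be a vertex or an end of the segment; a representative inside the
        segment is active, and the closed edge through it contains t.\<close>
      obtain t' where t': "t' \<in> X.off t" "a < t'" "t' < b" using off_inside[OF c(4,5,1) t(2,3)] .
      have act: "act (t', y)" using c(7) t' X.off_notin[OF t'(1)] by blast
      obtain a' b' where h': "hedge a' b' y" "a' < t'" "t' < b'"
        by (rule hedge_at[OF act X.off_notin[OF t'(1)] c(6)])
      have "a \<le> a'" using hedgeD(8)[OF h'(1), of a] c(2) t' h' by (cases "a \<le> a'") auto
      moreover have "b' \<le> b" using hedgeD(8)[OF h'(1), of b] c(3) t' h' by (cases "b' \<le> b") auto
      moreover have "a' \<le> t" "t \<le> b'" using X.off_between[OF t'(1)] hedgeD(4,5)[OF h'(1)] h' by auto
      ultimately show "z \<in> \<Union>?A" using h'(1) t(1)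
        by (intro UnionI[of "{a'..b'} \<times> {y}"]) auto
    qed
  qed
  moreover have "s = closed_segment (a, y) (b, y)" "(a, y) \<noteq> (b, y)"
    using closed_segment_horizontal'[of a b y] h(2) c(1) by auto
  moreover have "horizontal s" using h(2) by simp
  ultimately show "edge_chain T s \<and> horizontal s" unfolding edge_chain_def by blast
qed

text \<open>A horizontal l-edge in coordinates, by \<open>l_edges_iff\<close>. Maximality is tested
  just beyond the ends: they are vertices, so an active point there lies on an edge that starts at
  the end and prolongs the chain.\<close>

definition hrun :: "real \<Rightarrow> real \<Rightarrow> real \<Rightarrow> bool" where
  "hrun a b y \<longleftrightarrow> hchain a b y \<and> \<not> act (a - e, y) \<and> \<not> act (b + e, y)"

lemma hchain_extend_left:
  assumes h: "hchain a b y" and act: "act (a - e, y)"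
  obtains a' where "a' < a" "hchain a' b y"
proof -
  note c = hchainD[OF h]
  obtain a' b' where h': "hedge a' b' y" "a' < a - e" "a - e < b'"
    by (rule hedge_at[OF act X.shift_notin(2)[OF c(4)] c(6)])
  note d = hedgeD[OF h'(1)]
  have "b' = a" using d(8)[of a] c(2) h'(2,3) X.e X.left_of(4)[OF c(4) d(5)] by force
  have "hchain a' b y" unfolding hchain_def
  proof (intro conjI allI impI)
    fix t assume t: "a' < t \<and> t < b \<and> t \<notin> X"
    then have "t \<noteq> a" using c(4) by auto
    then show "act (t, y)" using t c(7)[of t] d(7)[of t] \<open>b' = a\<close> by (cases "t < a") auto
  qed (use c d h' X.e in auto)
  then show ?thesis using that[of a'] h'(2) X.e by auto
qed

lemma hchain_extend_right:
  assumes h: "hchain a b y" and act: "act (b + e, y)"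
  obtains b' where "b < b'" "hchain a b' y"
proof -
  note c = hchainD[OF h]
  obtain a' b' where h': "hedge a' b' y" "a' < b + e" "b + e < b'"
    by (rule hedge_at[OF act X.shift_notin(1)[OF c(5)] c(6)])
  note d = hedgeD[OF h'(1)]
  have "a' = b" using d(8)[of b] c(3) h'(2,3) X.e X.right_of(4)[OF c(5) d(4)] by force
  have "hchain a b' y" unfolding hchain_def
  proof (intro conjI allI impI)
    fix t assume t: "a < t \<and> t < b' \<and> t \<notin> X"
    then have "t \<noteq> b" using c(5) by auto
    then show "act (t, y)" using t c(7)[of t] d(7)[of t] \<open>a' = b\<close> by (cases "t < b") auto
  qed (use c d h' X.e in auto)
  then show ?thesis using that[of b'] h'(3) X.e by auto
qed

lemma l_edges_iff:
  "s \<in> l_edges T \<and> horizontal s \<longleftrightarrow> (\<exists>a b y. hrun a b y \<and> s = {a..b} \<times> {y})"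
proof
  assume s: "s \<in> l_edges T \<and> horizontal s"
  then have "edge_chain T s" by (simp add: l_edges_def)
  then obtain a b y where h: "hchain a b y" "s = {a..b} \<times> {y}" using edge_chain_iff s by blast
  note ab = hchainD(1)[OF h(1)]
  have max: "a' = a \<and> b' = b" if "hchain a' b' y" "a' \<le> a" "b \<le> b'" for a' b'
  proof -
    have "edge_chain T ({a'..b'} \<times> {y})" using that(1) edge_chain_iff by blast
    moreover have "s \<subseteq> {a'..b'} \<times> {y}" using h(2) that by auto
    ultimately have "{a'..b'} \<times> {y} = s" using s by (simp add: l_edges_def)
    then show ?thesis using interval_eq_iff[of a' b' y a b y] hchainD(1)[OF that(1)] h(2) by simp
  qed
  have "\<not> act (a - e, y)"
  proof
    assume "act (a - e, y)"
    then obtain a' where "a' < a" "hchain a' b y" by (rule hchain_extend_left[OF h(1)])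
    then show False using max[of a' b] by simp
  qed
  moreover have "\<not> act (b + e, y)"
  proof
    assume "act (b + e, y)"
    then obtain b' where "b < b'" "hchain a b' y" by (rule hchain_extend_right[OF h(1)])
    then show False using max[of a b'] by simp
  qed
  ultimately show "\<exists>a b y. hrun a b y \<and> s = {a..b} \<times> {y}" using h hrun_def by blast
next
  assume "\<exists>a b y. hrun a b y \<and> s = {a..b} \<times> {y}"
  then obtain a b y where h: "hchain a b y" "\<not> act (a - e, y)" "\<not> act (b + e, y)" "s = {a..b} \<times> {y}"
    unfolding hrun_def by blast
  note c = hchainD[OF h(1)]
  have ec: "edge_chain T s" "horizontal s" using edge_chain_iff h by blast+
  have "s' = s" if s': "edge_chain T s'" "s \<subseteq> s'" for s'
  proof -
    have ab: "(a, y) \<in> s'" "(b, y) \<in> s'" using s'(2) h(4) c(1) by auto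
    have "\<not> vertical s'"
      using ab c(1) unfolding vertical_def by (metis fst_conv less_irrefl)
    then have "horizontal s'" using s'(1) by (simp add: edge_chain_def)
    then obtain a' b' y' where h': "hchain a' b' y'" "s' = {a'..b'} \<times> {y'}"
      using edge_chain_iff s'(1) by blast
    note c' = hchainD[OF h'(1)]
    have i: "a' \<le> a" "b \<le> b'" "y = y'"
      using interval_subsetD[of a b y a' b' y'] s'(2) h'(2) h(4) c(1) by auto
    have "\<not> a' < a"
    proof
      assume "a' < a"
      then have "act (a - e, y)"
        using c'(7)[of "a - e"] X.left_of(3)[OF c(4) c'(4)] i c(1) X.shift_notin(2)[OF c(4)] X.e by auto
      then show False using h(2) by blast
    qed
    moreover have "\<not> b < b'"
    proof
      assume "b < b'"
      then have "act (b + e, y)"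
        using c'(7)[of "b + e"] X.right_of(3)[OF c(5) c'(5)] i c(1) X.shift_notin(1)[OF c(5)] X.e by auto
      then show False using h(3) by blast
    qed
    ultimately show ?thesis using i h(4) h'(2) by auto
  qed
  then show "s \<in> l_edges T \<and> horizontal s" using ec by (auto simp: l_edges_def)
qed

lemma hrunD:
  assumes "hrun a b y"
  shows "a < b" "(a, y) \<in> vertices T" "(b, y) \<in> vertices T" "a \<in> X" "b \<in> X" "y \<in> Y"
    "a < t \<Longrightarrow> t < b \<Longrightarrow> t \<notin> X \<Longrightarrow> act (t, y)" "\<not> act (a - e, y)" "\<not> act (b + e, y)"
proof -
  have h: "hchain a b y" using assms by (simp add: hrun_def)
  show "a < b" "(a, y) \<in> vertices T" "(b, y) \<in> vertices T" "a \<in> X" "b \<in> X" "y \<in> Y"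
    using hchainD(1-6)[OF h] by simp_all
  show "act (t, y)" if "a < t" "t < b" "t \<notin> X" using hchainD(7)[OF h that] .
  show "\<not> act (a - e, y)" "\<not> act (b + e, y)" using assms by (simp_all add: hrun_def)
qed

text \<open>There are finitely many chains through t on this line; a longest one cannot be
  prolonged.\<close>

lemma hrun_exists:
  assumes act: "act (t, y)" and t: "t \<notin> X" and y: "y \<in> Y"
  obtains a b where "hrun a b y" "a < t" "t < b"
proof -
  let ?S = "{(a, b). hchain a b y \<and> a < t \<and> t < b}"
  have "?S \<subseteq> X \<times> X" using hchainD(4,5) by blast
  then have fin: "finite ?S" using X.fin finite_subset by blast
  obtain a0 b0 where "hedge a0 b0 y" "a0 < t" "t < b0" by (rule hedge_at[OF act t y])
  then have "(a0, b0) \<in> ?S" by (auto simp: hedge_def hchain_def)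
  then have ne: "?S \<noteq> {}" by blast
  obtain w where w: "w \<in> ?S" "\<And>v. v \<in> ?S \<Longrightarrow> snd v - fst v \<le> snd w - fst w"
  proof -
    let ?M = "(\<lambda>v. snd v - fst v) ` ?S"
    have "Max ?M \<in> ?M" using fin ne by (intro Max_in) blast+
    then obtain w where "w \<in> ?S" "Max ?M = snd w - fst w" by blast
    moreover have "snd v - fst v \<le> Max ?M" if "v \<in> ?S" for v
      using fin that by (intro Max_ge finite_imageI imageI)
    ultimately show ?thesis by (intro that[of w]) simp_all
  qed
  obtain a b where ab: "w = (a, b)" by (metis surj_pair)
  have h: "hchain a b y" "a < t" "t < b" using w(1) ab by auto
  have max: "b' - a' \<le> b - a" if "hchain a' b' y" "a' < t" "t < b'" for a' b'
    using w(2)[of "(a', b')"] that ab by simp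
  have "\<not> act (a - e, y)"
  proof
    assume "act (a - e, y)"
    then obtain a' where "a' < a" "hchain a' b y" by (rule hchain_extend_left[OF h(1)])
    then show False using max[of a' b] h by simp
  qed
  moreover have "\<not> act (b + e, y)"
  proof
    assume "act (b + e, y)"
    then obtain b' where "b < b'" "hchain a b' y" by (rule hchain_extend_right[OF h(1)])
    then show False using max[of a b'] h by simp
  qed
  ultimately show ?thesis using that[of a b] h by (simp add: hrun_def)
qed

lemma hrun_unique:
  assumes r: "hrun a b y" "a < t" "t < b" and r': "hrun a' b' y" "a' < t" "t < b'"
  shows "a = a'" "b = b'"
proof -
  have left: "\<not> a < a'" if r: "hrun a b y" "a < t" "t < b" and r': "hrun a' b' y" "a' < t" "t < b'" for a b a' b'
  proof
    assume "a < a'"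
    then have "act (a' - e, y)"
      using hrunD(7)[OF r(1), of "a' - e"] X.left_of(3)[OF hrunD(4)[OF r'(1)] hrunD(4)[OF r(1)]]
        X.shift_notin(2)[OF hrunD(4)[OF r'(1)]] X.e r r' by auto
    then show False using hrunD(8)[OF r'(1)] by blast
  qed
  have right: "\<not> b < b'" if r: "hrun a b y" "a < t" "t < b" and r': "hrun a' b' y" "a' < t" "t < b'" for a b a' b'
  proof
    assume "b < b'"
    then have "act (b + e, y)"
      using hrunD(7)[OF r'(1), of "b + e"] X.right_of(3)[OF hrunD(5)[OF r(1)] hrunD(5)[OF r'(1)]]
        X.shift_notin(1)[OF hrunD(5)[OF r(1)]] X.e r r' by auto
    then show False using hrunD(9)[OF r(1)] by blast
  qed
  show "a = a'" using left[OF r r'] left[OF r' r] by simp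
  show "b = b'" using right[OF r r'] right[OF r' r] by simp
qed

text \<open>At a grid abscissa t, where chains claim nothing, the four representatives around the
  point belong to the active points on its two sides.\<close>

lemma hrun_interior:
  assumes "hrun a b y" "a < t" "t < b" shows "(t, y) \<in> interior (domain T)"
proof (cases "t \<in> X")
  case False
  then show ?thesis using hrunD(7)[OF assms(1)] assms by (auto simp: act_def)
next
  case True
  note d = hrunD[OF assms(1)]
  have "a < t - e" "t + e < b"
    using X.left_of(3)[OF True d(4)] X.right_of(3)[OF True d(5)] assms by auto
  then have "act (t - e, y)" "act (t + e, y)"
    using d(7) X.shift_notin[OF True] X.e assms by simp_all
  then show ?thesis
    using interior_domain_edge[OF X.shift_notin(1)[OF True] d(6)]
      interior_domain_edge[OF X.shift_notin(2)[OF True] d(6)] True d(6)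
    by (auto simp: act_def interior_domain_iff X.off_def Y.off_def)
qed

text \<open>The l-edge through x + e must begin at x: if it reached further left, x - e would be
  active as well.\<close>

lemma act_vertex_right:
  assumes "x \<in> X" "y \<in> Y" "act (x + e, y)" "\<not> act (x - e, y)"
  shows "\<exists>b. hrun x b y \<and> x + e < b"
proof -
  obtain a b where r: "hrun a b y" "a < x + e" "x + e < b"
    by (rule hrun_exists[OF assms(3) X.shift_notin(1)[OF assms(1)] assms(2)])
  note d = hrunD[OF r(1)]
  have "a \<le> x" using X.right_of(4)[OF assms(1) d(4)] r by simp
  moreover have "\<not> a < x"
    using d(7)[of "x - e"] assms(1,4) r(3) X.left_of(3)[OF assms(1) d(4)] X.shift_notin(2) X.e by fastforce
  ultimately show ?thesis using r by force
qed

lemma act_vertex_left: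
  assumes "x \<in> X" "y \<in> Y" "act (x - e, y)" "\<not> act (x + e, y)"
  shows "\<exists>a. hrun a x y \<and> a < x - e"
proof -
  obtain a b where r: "hrun a b y" "a < x - e" "x - e < b"
    by (rule hrun_exists[OF assms(3) X.shift_notin(2)[OF assms(1)] assms(2)])
  note d = hrunD[OF r(1)]
  have "x \<le> b" using X.left_of(4)[OF assms(1) d(5)] r by simp
  moreover have "\<not> x < b"
    using d(7)[of "x + e"] assms(1,4) r(2) X.right_of(3)[OF assms(1) d(5)] X.shift_notin(1) X.e by fastforce
  ultimately show ?thesis using r by force
qed

text \<open>From a corner of \<open>F\<close>, move horizontally along its side: on the two sides of
  the line lie \<open>F\<close> and a different cell, so this side is active. Here \<open>x'\<close>
  and \<open>y'\<close> point into \<open>F\<close> and \<open>y''\<close> points away from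
  it.\<close>

lemma interior_vertex_act:
  assumes v: "(x, y) \<in> vertices T" and int: "(x, y) \<in> interior (domain T)"
  shows "act (x - e, y) \<or> act (x + e, y)"
proof -
  have xy: "x \<in> X" "y \<in> Y" using v vertices_fst vertices_snd by blast+
  obtain F where F: "F \<in> T" "(x, y) \<in> corners F" using v by (auto simp: vertices_def)
  then obtain a b c d where ab: "a < b" "c < d" "F = {a..b} \<times> {c..d}" "x = a \<or> x = b" "y = c \<or> y = d"
    unfolding corners_def by blast
  obtain a' b' c' d' where "F = {a'..b'} \<times> {c'..d'}" "a' \<in> X" "b' \<in> X" "c' \<in> Y" "d' \<in> Y" "a' < b'" "c' < d'"
    using F(1) by (rule rectE)
  then have X: "a \<in> X" "b \<in> X" "c \<in> Y" "d \<in> Y"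
    using ab by (metis Icc_eq_Icc atLeastatMost_empty_iff2 less_imp_le not_le times_eq_iff)+
  define x' where "x' = (if x = a then x + e else x - e)"
  define y' where "y' = (if y = c then y + e else y - e)"
  define y'' where "y'' = (if y = c then y - e else y + e)"
  have mem: "x' \<in> X.off x" "y' \<in> Y.off y" "y'' \<in> Y.off y"
    using xy by (auto simp: x'_def y'_def y''_def X.off_def Y.off_def)
  have x': "x' \<notin> X" using mem X.off_notin by blast
  have "(x', y') \<in> F"
    using ab X X.right_of[of a b] X.left_of[of b a] Y.right_of[of c d] Y.left_of[of d c] X.e
    by (auto simp: x'_def y'_def)
  moreover have "(x', y'') \<notin> F"
    using ab X.e by (auto simp: y''_def)
  moreover obtain G where "G \<in> T" "(x', y'') \<in> G"
    using int mem unfolding interior_domain_iff by (auto simp: domain_def)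
  ultimately have "act (x', y)"
    unfolding act_iff[OF x' xy(2)] using F(1) by (auto simp: y'_def y''_def split: if_splits)
  then show ?thesis by (auto simp: x'_def split: if_splits)
qed

section \<open>Piecewise constant functions along l-edges\<close>

lemma interior_shift:
  assumes "x \<in> X" "y \<in> Y" "(x, y) \<in> interior (domain T)"
  shows "(x + e, y) \<in> interior (domain T)" "(x - e, y) \<in> interior (domain T)"
  using assms X.shift_notin
  by (auto simp: interior_domain_iff X.off_def Y.off_def)

lemma run_sum:
  assumes h: "\<And>s t. X.gap s t \<Longrightarrow> h s = (h t :: 'a::ab_group_add)" and r: "hrun a b y"
  shows "h (b + e) = h (a - e) + (\<Sum>x | x \<in> X \<and> a \<le> x \<and> x \<le> b. h (x + e) - h (x - e))"
proof -
  note d = hrunD(1-6)[OF r]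
  have "{z. z \<in> X \<and> a - e < z \<and> z < b + e} = {x. x \<in> X \<and> a \<le> x \<and> x \<le> b}"
    using X.left_of(4)[OF d(4)] X.right_of(4)[OF d(5)] by auto
  moreover have "a - e \<le> b + e" using d(1) X.e by simp
  ultimately show ?thesis
    using X.sum_jumps[of h "a - e" "b + e", OF h] X.shift_notin d(4,5) by simp
qed

text \<open>Without jumps the function is constant along the l-edge. Beyond an end inside the domain
  it is zero by inactivity, and this zero is carried across the end; if neither end is inside, the
  value on the first edge decides.\<close>

lemma run_function_zero:
  fixes h :: "real \<Rightarrow> 'a::ab_group_add"
  assumes h: "\<And>s t. X.gap s t \<Longrightarrow> h s = h t" and r: "hrun a b y"
    and jump: "\<And>x. x \<in> X \<Longrightarrow> (x, y) \<in> interior (domain T) \<Longrightarrow> h (x + e) = h (x - e)"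
    and inact: "\<And>x. x \<notin> X \<Longrightarrow> (x, y) \<in> interior (domain T) \<Longrightarrow> \<not> act (x, y) \<Longrightarrow> h x = 0"
    and start: "(a, y) \<notin> interior (domain T) \<Longrightarrow> (b, y) \<notin> interior (domain T) \<Longrightarrow> h (a + e) = 0"
    and t: "a < t" "t < b" "t \<notin> X"
  shows "h t = 0"
proof -
  note d = hrunD[OF r]
  have ae: "a + e \<le> b" "a \<le> b - e" using X.right_of(2)[OF d(4,5)] X.left_of(2)[OF d(5,4)] d(1) by auto
  have const: "h s' = h s" if "a < s" "s \<le> s'" "s' < b" "s \<notin> X" "s' \<notin> X" for s s'
  proof -
    have "h (z + e) - h (z - e) = 0" if "z \<in> X" "s < z" "z < s'" for z
      using jump[OF that(1)] hrun_interior[OF r, of z] that \<open>a < s\<close> \<open>s' < b\<close> by simp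
    then show ?thesis using X.sum_jumps[of h s s', OF h] that by simp
  qed
  have gl: "h t = h (a + e) \<and> h t = h (b - e)"
  proof
    show "h t = h (a + e)"
    proof (cases "a + e \<le> t")
      case True
      then show ?thesis using const[of "a + e" t] t X.shift_notin(1)[OF d(4)] X.e by simp
    next
      case False
      then have "X.gap (a + e) t" using t X.e by (intro X.gap_right[OF d(4)]) auto
      then show ?thesis using h by metis
    qed
    show "h t = h (b - e)"
    proof (cases "t \<le> b - e")
      case True
      then show ?thesis using const[of t "b - e"] t X.shift_notin(2)[OF d(5)] X.e by simp
    next
      case False
      then have "X.gap (b - e) t" using t X.e by (intro X.gap_left[OF d(5)]) auto
      then show ?thesis using h by metis
    qed
  qed
  consider "(a, y) \<in> interior (domain T)" | "(b, y) \<in> interior (domain T)"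
    | "(a, y) \<notin> interior (domain T)" "(b, y) \<notin> interior (domain T)" by blast
  then show ?thesis
  proof cases
    case 1
    then have "h (a - e) = 0"
      using inact[OF X.shift_notin(2)[OF d(4)]] interior_shift(2)[OF d(4,6)] d(8) by blast
    then show ?thesis using gl jump[OF d(4) 1] by simp
  next
    case 2
    then have "h (b + e) = 0"
      using inact[OF X.shift_notin(1)[OF d(5)]] interior_shift(1)[OF d(5,6)] d(9) by blast
    moreover have "h t = h (b - e)" using gl by blast
    ultimately show ?thesis using jump[OF d(5) 2] by simp
  next
    case 3
    then show ?thesis using gl start by simp
  qed
qed

text \<open>The jump along an l-edge is a start value plus the changes \<open>m\<close> accumulated
  so far. The sets \<open>B y\<close> are carried along to record later that all values are
  admissible jumps across the line y.\<close>

lemma run_function_exists: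
  fixes m :: "point \<Rightarrow> 'a::ab_group_add" and h0 :: "point set \<Rightarrow> 'a"
  assumes m0: "\<And>v. v \<notin> interior_vertices T \<Longrightarrow> m v = 0"
    and bal: "\<And>a b y. hrun a b y \<Longrightarrow> (a, y) \<in> interior_vertices T \<Longrightarrow> (b, y) \<in> interior_vertices T \<Longrightarrow>
      (\<Sum>x | x \<in> X \<and> a \<le> x \<and> x \<le> b. m (x, y)) = 0"
    and B: "\<And>y. 0 \<in> B y" "\<And>y f g. f \<in> B y \<Longrightarrow> g \<in> B y \<Longrightarrow> f + g \<in> B y" "\<And>y f. f \<in> B y \<Longrightarrow> - f \<in> B y"
    and mB: "\<And>x y. m (x, y) \<in> B y" and h0B: "\<And>a b y. hrun a b y \<Longrightarrow> h0 ({a..b} \<times> {y}) \<in> B y"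
  obtains H :: "real \<Rightarrow> real \<Rightarrow> 'a" where
    "\<And>x x' y. X.gap x x' \<Longrightarrow> H x y = H x' y"
    "\<And>x y. \<not> act (x, y) \<Longrightarrow> H x y = 0"
    "\<And>x y. x \<in> X \<Longrightarrow> y \<in> Y \<Longrightarrow> (x, y) \<in> interior (domain T) \<Longrightarrow> H (x + e) y - H (x - e) y = m (x, y)"
    "\<And>a b y. hrun a b y \<Longrightarrow> (a, y) \<notin> interior_vertices T \<Longrightarrow> (b, y) \<notin> interior_vertices T \<Longrightarrow>
       H (a + e) y = h0 ({a..b} \<times> {y})"
    "\<And>x y. H x y \<in> B y"
proof -
  \<comment> \<open>An interior left end forces the start value zero. On a ray whose right end is
    interior, minus the total change makes the jump vanish beyond that end. Only a cross-cut leaves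
    the start value free.\<close>
  define start where "start a b y = (if (a, y) \<in> interior_vertices T then 0
      else if (b, y) \<in> interior_vertices T then - (\<Sum>x | x \<in> X \<and> a \<le> x \<and> x \<le> b. m (x, y))
      else h0 ({a..b} \<times> {y}))" for a b y
  define val where "val a b x y = start a b y + (\<Sum>z | z \<in> X \<and> a \<le> z \<and> z < x. m (z, y))" for a b x y
  define run where "run x y = (SOME ab. hrun (fst ab) (snd ab) y \<and> fst ab < x \<and> x < snd ab)" for x y
  \<comment> \<open>The value at grid abscissas is a dummy; only generic abscissas carry
    jumps.\<close>
  define H where "H x y = (if x \<notin> X \<and> y \<in> Y \<and> act (x, y) then val (fst (run x y)) (snd (run x y)) x y else 0)"
    for x y
  have H_val: "H x y = val a b x y" if r: "hrun a b y" "a < x" "x < b" "x \<notin> X" for a b x y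
  proof -
    have act: "act (x, y)" "y \<in> Y" using hrunD(7,6)[OF r(1)] r by auto
    have "hrun (fst (run x y)) (snd (run x y)) y \<and> fst (run x y) < x \<and> x < snd (run x y)"
      unfolding run_def by (rule someI[of _ "(a, b)"]) (use r in simp)
    then have "fst (run x y) = a" "snd (run x y) = b" using hrun_unique[of _ _ y x a b] r by blast+
    then show ?thesis using act r(4) by (simp add: H_def)
  qed
  have sumB: "(\<Sum>x\<in>S. m (x, y)) \<in> B y" for S y
    by (induction S rule: infinite_finite_induct) (auto intro: B mB)
  have m_ends: "(a, y) \<notin> interior_vertices T \<Longrightarrow> m (a, y) = 0" for a y using m0 by blast
  have gap: "H x y = H x' y" if g: "X.gap x x'" for x x' y
  proof (cases "y \<in> Y \<and> act (x, y)")
    case True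
    note nx = X.gap_notin[OF g]
    obtain a b where r: "hrun a b y" "a < x" "x < b" by (rule hrun_exists) (use True nx in auto)
    have "a < x'" "x' < b" using X.gap_le[OF g] hrunD(4,5)[OF r(1)] r by auto
    then have "H x' y = val a b x' y" using H_val[OF r(1)] nx by simp
    also have "\<dots> = val a b x y" unfolding val_def
      using X.gap_le(3)[OF g] X.gap_le(4)[OF g] by (metis (no_types, lifting) X.gap_le(3) g)
    also have "\<dots> = H x y" using H_val[OF r] nx by simp
    finally show ?thesis by simp
  next
    case False
    then show ?thesis using act_gap[OF g] by (auto simp: H_def)
  qed
  have inact: "H x y = 0" if "\<not> act (x, y)" for x y using that by (simp add: H_def)
  have left: "H (a + e) y = start a b y + m (a, y)" if r: "hrun a b y" for a b y
  proof -
    note d = hrunD[OF r]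
    have "{z. z \<in> X \<and> a \<le> z \<and> z < a + e} = {a}" using X.right_of(4)[OF d(4)] d(4) X.e by force
    then show ?thesis
      using H_val[OF r, of "a + e"] X.right_of(3)[OF d(4,5)] d(1) X.e X.shift_notin(1)[OF d(4)]
      by (simp add: val_def)
  qed
  have right: "H (b - e) y + m (b, y) = start a b y + (\<Sum>x | x \<in> X \<and> a \<le> x \<and> x \<le> b. m (x, y))"
    if r: "hrun a b y" for a b y
  proof -
    note d = hrunD[OF r]
    have S: "{x. x \<in> X \<and> a \<le> x \<and> x \<le> b} = insert b {z. z \<in> X \<and> a \<le> z \<and> z < b - e}"
      using X.left_of(3)[OF d(5)] d(5) d(1) by force
    have fin: "finite {z. z \<in> X \<and> a \<le> z \<and> z < b - e}" using X.fin by simp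
    have "b \<notin> {z. z \<in> X \<and> a \<le> z \<and> z < b - e}" using X.e by simp
    then have "(\<Sum>x | x \<in> X \<and> a \<le> x \<and> x \<le> b. m (x, y)) = m (b, y) + (\<Sum>z | z \<in> X \<and> a \<le> z \<and> z < b - e. m (z, y))"
      unfolding S by (rule sum.insert[OF fin])
    then show ?thesis
      using H_val[OF r, of "b - e"] X.left_of(3)[OF d(5,4)] d(1) X.e X.shift_notin(2)[OF d(5)]
      by (simp add: val_def add_ac)
  qed
  have jump: "H (x + e) y - H (x - e) y = m (x, y)"
    if xy: "x \<in> X" "y \<in> Y" "(x, y) \<in> interior (domain T)" for x y
  proof -
    have iv: "(x, y) \<in> interior_vertices T" if "(x, y) \<in> vertices T"
      using that xy(3) by (simp add: interior_vertices_eq)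
    consider "act (x - e, y)" "act (x + e, y)" | "act (x - e, y)" "\<not> act (x + e, y)"
      | "\<not> act (x - e, y)" "act (x + e, y)" | "\<not> act (x - e, y)" "\<not> act (x + e, y)" by blast
    then show ?thesis
    proof cases
      case 1
      obtain a b where r: "hrun a b y" "a < x - e" "x - e < b"
        by (rule hrun_exists[OF 1(1) X.shift_notin(2)[OF xy(1)] xy(2)])
      note d = hrunD[OF r(1)]
      have "x \<le> b" using X.left_of(4)[OF xy(1) d(5)] r(3) by simp
      moreover have "x \<noteq> b" using 1(2) d(9) by auto
      ultimately have "x + e < b" using X.right_of(3)[OF xy(1) d(5)] by simp
      then have v: "H (x + e) y = val a b (x + e) y" "H (x - e) y = val a b (x - e) y"
        using H_val[OF r(1)] r X.shift_notin[OF xy(1)] X.e by simp_all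
      have S: "{z. z \<in> X \<and> a \<le> z \<and> z < x + e} = insert x {z. z \<in> X \<and> a \<le> z \<and> z < x - e}"
        using X.left_of(3)[OF xy(1)] X.right_of(4)[OF xy(1)] xy(1) r(2) X.e by force
      have fin: "finite {z. z \<in> X \<and> a \<le> z \<and> z < x - e}" using X.fin by simp
      have nx: "x \<notin> {z. z \<in> X \<and> a \<le> z \<and> z < x - e}" using X.e by simp
      show ?thesis unfolding v val_def S sum.insert[OF fin nx] by simp
    next
      case 2
      then obtain a where r: "hrun a x y" using act_vertex_left[OF xy(1,2)] by blast
      note d = hrunD[OF r]
      have "start a x y + (\<Sum>z | z \<in> X \<and> a \<le> z \<and> z \<le> x. m (z, y)) = 0"
        using bal[OF r] iv[OF d(3)] by (simp add: start_def)
      then have "H (x - e) y + m (x, y) = 0" using right[OF r] by simp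
      then show ?thesis using inact[OF 2(2)] by (simp add: add_eq_0_iff)
    next
      case 3
      then obtain b where r: "hrun x b y" using act_vertex_right[OF xy(1,2)] by blast
      then show ?thesis
        using left[OF r] inact[OF 3(1)] iv hrunD(2)[OF r] by (simp add: start_def)
    next
      case 4
      then have "(x, y) \<notin> vertices T" using interior_vertex_act xy(3) by blast
      then show ?thesis using m0[of "(x, y)"] inact 4 by (simp add: interior_vertices_def)
    qed
  qed
  have startB: "start a b y \<in> B y" if "hrun a b y" for a b y
    using B sumB h0B[OF that] by (simp add: start_def)
  have HB: "H x y \<in> B y" for x y
  proof (cases "x \<notin> X \<and> y \<in> Y \<and> act (x, y)")
    case True
    obtain a b where r: "hrun a b y" "a < x" "x < b" by (rule hrun_exists) (use True in auto)
    then show ?thesis using H_val[OF r] True B(2)[OF startB[OF r(1)] sumB] by (simp add: val_def)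
  next
    case False
    then show ?thesis using B(1) by (auto simp: H_def)
  qed
  show ?thesis
  proof (rule that[of H])
    show "H (a + e) y = h0 ({a..b} \<times> {y})"
      if "hrun a b y" "(a, y) \<notin> interior_vertices T" "(b, y) \<notin> interior_vertices T" for a b y
      using left[OF that(1)] that m_ends by (simp add: start_def)
  qed (fact gap inact jump HB)+
qed

end

section \<open>Completing flows outside the domain\<close>

context sep begin

text \<open>For generic x: a is an end point of the grid interval of x. There are two of them, or
  one beyond the extreme coordinates.\<close>

definition nbr :: "real \<Rightarrow> real \<Rightarrow> bool" where
  "nbr x a \<longleftrightarrow> a \<in> Z \<and> (\<forall>t\<in>Z. \<not> (a < t \<and> t < x) \<and> \<not> (x < t \<and> t < a))"

text \<open>The grid coordinate nearest to x is an end point of the grid interval of every point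
  near x, on whichever side.\<close>

lemma nbr_near:
  assumes "Z \<noteq> {}"
  shows "\<exists>a. \<exists>\<delta>>0. \<forall>t. \<bar>t - x\<bar> < \<delta> \<longrightarrow> nbr t a"
proof -
  let ?M = "(\<lambda>t. \<bar>t - x\<bar>) ` Z"
  have "Min ?M \<in> ?M" using fin assms by (intro Min_in) auto
  then obtain a where a0: "a \<in> Z" "Min ?M = \<bar>a - x\<bar>" by blast
  have a: "a \<in> Z" "\<bar>a - x\<bar> \<le> \<bar>t - x\<bar>" if "t \<in> Z" for t
    using a0 that fin unfolding a0(2)[symmetric] by (auto intro: Min_le)
  obtain \<delta> where \<delta>: "\<delta> > 0" "\<forall>z\<in>Z. z \<noteq> x \<longrightarrow> \<delta> \<le> dist x z"
    using finite_set_avoid[OF fin, of x] by blast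
  have "nbr t a" if t: "\<bar>t - x\<bar> < \<delta>" for t
    unfolding nbr_def
  proof (intro conjI ballI notI)
    fix s assume s: "s \<in> Z" "a < s \<and> s < t"
    show False using a(2)[OF s(1)] \<delta>(2) s t by (cases "s = x") (force simp: dist_real_def)+
  next
    fix s assume s: "s \<in> Z" "t < s \<and> s < a"
    show False using a(2)[OF s(1)] \<delta>(2) s t by (cases "s = x") (force simp: dist_real_def)+
  qed (fact a0(1))
  then show ?thesis using \<delta>(1) by blast
qed

lemma nbr_off: "a \<in> Z \<Longrightarrow> nbr (a + e) a" "a \<in> Z \<Longrightarrow> nbr (a - e) a"
  unfolding nbr_def using right_of(4) left_of(3) e by (smt (verit))+

lemma nbr_pair:
  assumes "x \<notin> Z" "nbr x a" "nbr x a'" "a < a'"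
  shows "a < x" "x < a'" "\<And>t. a < t \<Longrightarrow> t < a' \<Longrightarrow> gap x t"
proof -
  have "a \<noteq> x" "a' \<noteq> x" using assms by (auto simp: nbr_def)
  then show ax: "a < x" "x < a'" using assms unfolding nbr_def by force+
  show "gap x t" if t: "a < t" "t < a'" for t
    unfolding gap_def
  proof
    fix s assume s: "s \<in> Z"
    then have "s \<noteq> x" "\<not> (a < s \<and> s < x)" "\<not> (x < s \<and> s < a')" using assms by (auto simp: nbr_def)
    then show "s < x \<and> s < t \<or> x < s \<and> t < s" using t ax by (cases "s < x") auto
  qed
qed

lemma nbr_gap:
  assumes "x \<notin> Z" "nbr x a" shows "gap x (a + e) \<or> gap x (a - e)"
proof -
  have a: "a \<in> Z" "a \<noteq> x" using assms by (auto simp: nbr_def)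
  have s: "s \<noteq> x" "\<not> (a < s \<and> s < x)" "\<not> (x < s \<and> s < a)" if "s \<in> Z" for s
    using assms that by (auto simp: nbr_def)
  show ?thesis
  proof (cases "a < x")
    case True
    have "gap x (a + e)" unfolding gap_def
    proof
      fix t assume "t \<in> Z"
      then show "t < x \<and> t < a + e \<or> x < t \<and> a + e < t"
        using s[of t] True right_of(3,4)[OF a(1), of t] by (cases "t < x") auto
    qed
    then show ?thesis ..
  next
    case False
    have "gap x (a - e)" unfolding gap_def
    proof
      fix t assume "t \<in> Z"
      then show "t < x \<and> t < a - e \<or> x < t \<and> a - e < t"
        using s[of t] a(2) False left_of(3,4)[OF a(1), of t] by (cases "t < x") auto
    qed
    then show ?thesis ..
  qed
qed

end

context mesh begin

text \<open>A flow outside the open domain: \<open>H x y\<close> is the flow through the horizontal grid edge at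
  \<open>(x, y)\<close>, \<open>V x y\<close> the one through the vertical grid edge. It vanishes far to the left, but not
  necessarily far to the right.\<close>

definition ext_flow :: "(real \<Rightarrow> real \<Rightarrow> 'a::ab_group_add) \<Rightarrow> (real \<Rightarrow> real \<Rightarrow> 'a) \<Rightarrow> bool" where
  "ext_flow H V \<longleftrightarrow> (\<forall>x x' y. X.gap x x' \<longrightarrow> H x y = H x' y) \<and> (\<forall>x y y'. Y.gap y y' \<longrightarrow> V x y = V x y') \<and>
     (\<forall>x y. (\<forall>a\<in>X. x < a) \<longrightarrow> H x y = 0) \<and>
     (\<forall>x y. x \<notin> X \<longrightarrow> y \<in> Y \<longrightarrow> (x, y) \<in> interior (domain T) \<longrightarrow> H x y = 0) \<and>
     (\<forall>x y. x \<in> X \<longrightarrow> y \<notin> Y \<longrightarrow> (x, y) \<in> interior (domain T) \<longrightarrow> V x y = 0)"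

text \<open>The divergence of the flow at a grid point, with signs such that it vanishes when both
  families prescribe the same mixed difference of a potential.\<close>

definition dv :: "(real \<Rightarrow> real \<Rightarrow> 'a::ab_group_add) \<Rightarrow> (real \<Rightarrow> real \<Rightarrow> 'a) \<Rightarrow> real \<Rightarrow> real \<Rightarrow> 'a" where
  "dv H V x y = H (x + e) y - H (x - e) y - (V x (y + e) - V x (y - e))"

text \<open>The charge \<open>c\<close> at \<open>v\<close> can be carried off to infinity.\<close>

definition dump :: "'a::ab_group_add \<Rightarrow> point \<Rightarrow> bool" where
  "dump c v \<longleftrightarrow> (\<exists>H V. ext_flow H V \<and> (\<forall>x\<in>X. \<forall>y\<in>Y. dv H V x y = (if (x, y) = v then c else 0)))"

section \<open>Moving charges along grid edges outside the open domain\<close>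

lemma ext_flow_0: "ext_flow (\<lambda>x y. 0) (\<lambda>x y. 0)"
  by (simp add: ext_flow_def)

lemma ext_flowD:
  assumes "ext_flow H V"
  shows "X.gap x x' \<Longrightarrow> H x y = H x' y" "Y.gap y y' \<Longrightarrow> V x y = V x y'"
    "(\<And>a. a \<in> X \<Longrightarrow> x < a) \<Longrightarrow> H x y = 0"
    "x \<notin> X \<Longrightarrow> y \<in> Y \<Longrightarrow> (x, y) \<in> interior (domain T) \<Longrightarrow> H x y = 0"
    "x \<in> X \<Longrightarrow> y \<notin> Y \<Longrightarrow> (x, y) \<in> interior (domain T) \<Longrightarrow> V x y = 0"
  using assms unfolding ext_flow_def by blast+

lemma ext_flowI:
  assumes "\<And>x x' y. X.gap x x' \<Longrightarrow> H x y = H x' y" "\<And>x y y'. Y.gap y y' \<Longrightarrow> V x y = V x y'"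
    "\<And>x y. (\<And>a. a \<in> X \<Longrightarrow> x < a) \<Longrightarrow> H x y = 0"
    "\<And>x y. x \<notin> X \<Longrightarrow> y \<in> Y \<Longrightarrow> (x, y) \<in> interior (domain T) \<Longrightarrow> H x y = 0"
    "\<And>x y. x \<in> X \<Longrightarrow> y \<notin> Y \<Longrightarrow> (x, y) \<in> interior (domain T) \<Longrightarrow> V x y = 0"
  shows "ext_flow H V"
  unfolding ext_flow_def
  by (intro conjI allI impI) (fact assms(1), fact assms(2), (rule assms(3), blast), fact assms(4), fact assms(5))

lemma ext_flow_add:
  assumes 1: "ext_flow H V" and 2: "ext_flow H' V'"
  shows "ext_flow (\<lambda>x y. H x y + H' x y) (\<lambda>x y. V x y + V' x y)"
proof (rule ext_flowI)
  fix x x' y assume g: "X.gap x x'"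
  show "H x y + H' x y = H x' y + H' x' y"
    by (simp only: ext_flowD(1)[OF 1 g, of y] ext_flowD(1)[OF 2 g, of y])
next
  fix x y y' assume g: "Y.gap y y'"
  show "V x y + V' x y = V x y' + V' x y'"
    by (simp only: ext_flowD(2)[OF 1 g, of x] ext_flowD(2)[OF 2 g, of x])
qed (use ext_flowD(3-5)[OF 1] ext_flowD(3-5)[OF 2] in auto)

lemma ext_flow_uminus:
  assumes 1: "ext_flow H V"
  shows "ext_flow (\<lambda>x y. - H x y) (\<lambda>x y. - V x y)"
proof (rule ext_flowI)
  fix x x' y assume g: "X.gap x x'"
  show "- H x y = - H x' y" by (simp only: ext_flowD(1)[OF 1 g, of y])
next
  fix x y y' assume g: "Y.gap y y'"
  show "- V x y = - V x y'" by (simp only: ext_flowD(2)[OF 1 g, of x])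
qed (use ext_flowD(3-5)[OF 1] in auto)

lemma dv_add: "dv (\<lambda>x y. H x y + H' x y) (\<lambda>x y. V x y + V' x y) x y = dv H V x y + dv H' V' x y"
  and dv_uminus: "dv (\<lambda>x y. - H x y) (\<lambda>x y. - V x y) x y = - dv H V x y"
  by (simp_all add: dv_def algebra_simps)

lemma dump_transfer:
  assumes d: "dump c v" and f: "ext_flow H V"
    and eq: "\<And>x y. x \<in> X \<Longrightarrow> y \<in> Y \<Longrightarrow> dv H V x y = (if (x, y) = w then c else 0) - (if (x, y) = v then c else 0)"
  shows "dump c w"
proof -
  obtain H' V' where "ext_flow H' V'" "\<And>x y. x \<in> X \<Longrightarrow> y \<in> Y \<Longrightarrow> dv H' V' x y = (if (x, y) = v then c else 0)"
    using d unfolding dump_def by blast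
  then show ?thesis unfolding dump_def
    by (intro exI[of _ "\<lambda>x y. H' x y + H x y"] exI[of _ "\<lambda>x y. V' x y + V x y"])
      (simp add: ext_flow_add[OF _ f] dv_add eq)
qed

text \<open>A flow can be reversed, so moving the charge from one grid point to another works in
  both directions.\<close>

lemma dump_step:
  assumes f: "ext_flow H V"
    and eq: "\<And>x y. x \<in> X \<Longrightarrow> y \<in> Y \<Longrightarrow> dv H V x y = (if (x, y) = w then c else 0) - (if (x, y) = v then c else 0)"
  shows "dump c v \<longleftrightarrow> dump c w"
proof
  show "dump c v \<Longrightarrow> dump c w" by (rule dump_transfer[OF _ f eq])
  show "dump c w \<Longrightarrow> dump c v"
    by (rule dump_transfer[OF _ ext_flow_uminus[OF f]]) (simp_all add: dv_uminus eq)
qed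

text \<open>The sides of a grid cell outside the domain miss the open domain, so extension flows may
  use them.\<close>

lemma not_interior_near_outside:
  assumes x: "x \<notin> X" and y: "y \<notin> Y" and out: "(x, y) \<notin> domain T"
  shows "X.gap x t \<Longrightarrow> Y.nbr y b \<Longrightarrow> (t, b) \<notin> interior (domain T)"
    and "Y.gap y t \<Longrightarrow> X.nbr x a \<Longrightarrow> (a, t) \<notin> interior (domain T)"
proof -
  assume g: "X.gap x t" and b: "Y.nbr y b"
  obtain b' where b': "b' \<in> Y.off b" "Y.gap y b'"
    using Y.nbr_gap[OF y b] b Y.off_mem by (auto simp: Y.nbr_def)
  have "(t, b') \<notin> domain T" using domain_gap[OF g b'(2)] out by simp
  then show "(t, b) \<notin> interior (domain T)"
    using b'(1) X.off_mem(3)[OF X.gap_notin(2)[OF g]] unfolding interior_domain_iff by blast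
next
  assume g: "Y.gap y t" and a: "X.nbr x a"
  obtain a' where a': "a' \<in> X.off a" "X.gap x a'"
    using X.nbr_gap[OF x a] a X.off_mem by (auto simp: X.nbr_def)
  have "(a', t) \<notin> domain T" using domain_gap[OF a'(2) g] out by simp
  then show "(a, t) \<notin> interior (domain T)"
    using a'(1) Y.off_mem(3)[OF Y.gap_notin(2)[OF g]] unfolding interior_domain_iff by blast
qed

text \<open>A constant flow along one side of an outside grid cell moves the charge between the
  corners of that side.\<close>

lemma dump_horizontal:
  assumes x: "x \<notin> X" and y: "y \<notin> Y" and out: "(x, y) \<notin> domain T"
    and a: "X.nbr x a" "X.nbr x a'" and b: "Y.nbr y b"
  shows "dump c (a, b) \<longleftrightarrow> dump c (a', b)"
proof -
  have step: "dump c (a', b) \<longleftrightarrow> dump c (a, b)" if a: "X.nbr x a" "X.nbr x a'" and "a < a'" for a a'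
  proof (rule dump_step)
    note p = X.nbr_pair[OF x a \<open>a < a'\<close>]
    have aX: "a \<in> X" "a' \<in> X" using a by (auto simp: X.nbr_def)
    let ?H = "\<lambda>s t. if t = b \<and> a < s \<and> s < a' then c else 0"
    show "ext_flow ?H (\<lambda>x y. 0)"
    proof (rule ext_flowI)
      fix s s' t assume "X.gap s s'"
      then show "?H s t = ?H s' t" using X.gap_le[of s s'] aX by simp
    next
      fix s t assume "\<And>a. a \<in> X \<Longrightarrow> s < a"
      then show "?H s t = 0" using aX by force
    next
      fix s t assume "(s, t) \<in> interior (domain T)"
      then show "?H s t = 0"
        using not_interior_near_outside(1)[OF x y out p(3) b, of s] by auto
    qed auto
    show "dv ?H (\<lambda>x y. 0) s t = (if (s, t) = (a, b) then c else 0) - (if (s, t) = (a', b) then c else 0)"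
      if s: "s \<in> X" for s t
    proof -
      have "s \<le> a \<or> a' \<le> s" using p(3)[of s] X.gap_notin s by force
      moreover have "a < s + e \<longleftrightarrow> a \<le> s" "s + e < a' \<longleftrightarrow> s < a'" "a < s - e \<longleftrightarrow> a < s" "s - e < a' \<longleftrightarrow> s \<le> a'"
        using X.right_of[OF s] X.left_of[OF s] aX by auto
      ultimately show ?thesis using \<open>a < a'\<close> unfolding dv_def by auto
    qed
  qed
  show ?thesis
  proof (cases a a' rule: linorder_cases)
    case less then show ?thesis using step[OF a] by blast
  next
    case equal then show ?thesis by simp
  next
    case greater then show ?thesis using step[OF a(2,1)] by blast
  qed
qed

lemma dump_vertical:
  assumes x: "x \<notin> X" and y: "y \<notin> Y" and out: "(x, y) \<notin> domain T"
    and a: "Y.nbr y a" "Y.nbr y a'" and b: "X.nbr x b"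
  shows "dump c (b, a) \<longleftrightarrow> dump c (b, a')"
proof -
  have step: "dump c (b, a) \<longleftrightarrow> dump c (b, a')" if a: "Y.nbr y a" "Y.nbr y a'" and "a < a'" for a a'
  proof (rule dump_step)
    note p = Y.nbr_pair[OF y a \<open>a < a'\<close>]
    have aY: "a \<in> Y" "a' \<in> Y" using a by (auto simp: Y.nbr_def)
    let ?V = "\<lambda>t s. if t = b \<and> a < s \<and> s < a' then c else 0"
    show "ext_flow (\<lambda>x y. 0) ?V"
    proof (rule ext_flowI)
      fix s s' t assume "Y.gap s s'"
      then show "?V t s = ?V t s'" using Y.gap_le[of s s'] aY by simp
    next
      fix s t assume "(t, s) \<in> interior (domain T)"
      then show "?V t s = 0"
        using not_interior_near_outside(2)[OF x y out p(3) b, of s] by auto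
    qed auto
    show "dv (\<lambda>x y. 0) ?V t s = (if (t, s) = (b, a') then c else 0) - (if (t, s) = (b, a) then c else 0)"
      if s: "s \<in> Y" for s t
    proof -
      have "s \<le> a \<or> a' \<le> s" using p(3)[of s] Y.gap_notin s by force
      moreover have "a < s + e \<longleftrightarrow> a \<le> s" "s + e < a' \<longleftrightarrow> s < a'" "a < s - e \<longleftrightarrow> a < s" "s - e < a' \<longleftrightarrow> s \<le> a'"
        using Y.right_of[OF s] Y.left_of[OF s] aY by auto
      ultimately show ?thesis using \<open>a < a'\<close> unfolding dv_def by auto
    qed
  qed
  show ?thesis
  proof (cases a a' rule: linorder_cases)
    case less then show ?thesis using step[OF a] by blast
  next
    case equal then show ?thesis by simp
  next
    case greater then show ?thesis using step[OF a(2,1)] by blast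
  qed
qed

lemma dump_corners:
  assumes x: "x \<notin> X" and y: "y \<notin> Y" and out: "(x, y) \<notin> domain T"
    and "X.nbr x a" "X.nbr x a'" "Y.nbr y b" "Y.nbr y b'"
  shows "dump c (a, b) \<longleftrightarrow> dump c (a', b')"
  using dump_horizontal[OF x y out assms(4,5,6)] dump_vertical[OF x y out assms(6,7,5)] by blast

section \<open>Carrying charges to infinity and the stream function\<close>

lemma X_nonempty: "X \<noteq> {}" and Y_nonempty: "Y \<noteq> {}"
proof -
  obtain F where "F \<in> T" using tmesh by (auto simp: tmesh_def)
  then show "X \<noteq> {}" "Y \<noteq> {}" by (auto elim!: rectE)
qed

lemma domain_bounds: "(x, y) \<in> domain T \<Longrightarrow> Min X \<le> x \<and> x \<le> Max X"
proof -
  assume "(x, y) \<in> domain T"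
  then obtain F where F: "F \<in> T" "(x, y) \<in> F" by (auto simp: domain_def)
  obtain a b c d where ab: "F = {a..b} \<times> {c..d}" "a \<in> X" "b \<in> X" using F(1) by (rule rectE)
  then have "Min X \<le> a" "b \<le> Max X" using X.fin by auto
  then show ?thesis using F(2) ab(1) by auto
qed

text \<open>To the right of the last grid column a constant flow may run off along a horizontal
  half-line; this is the escape that \<open>ext_flow\<close> permits.\<close>

lemma dump_right:
  assumes "b \<in> Y" shows "dump c (Max X, b)"
proof -
  let ?m = "Max X"
  have m: "?m \<in> X" "\<And>a. a \<in> X \<Longrightarrow> a \<le> ?m" using X.fin X_nonempty by auto
  let ?H = "\<lambda>s t. if t = b \<and> ?m < s then c else 0"
  have "ext_flow ?H (\<lambda>x y. 0)"
  proof (rule ext_flowI)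
    fix s s' t assume "X.gap s s'"
    then show "?H s t = ?H s' t" using X.gap_le[of s s'] m by simp
  next
    fix s t assume "\<And>a. a \<in> X \<Longrightarrow> s < a"
    then show "?H s t = 0" using m(1) by force
  next
    fix s t assume "(s, t) \<in> interior (domain T)"
    then have "(s, t) \<in> domain T" using interior_subset by blast
    then show "?H s t = 0" using domain_bounds by force
  qed auto
  moreover have "dv ?H (\<lambda>x y. 0) s t = (if (s, t) = (?m, b) then c else 0)" if s: "s \<in> X" for s t
  proof -
    have "?m < s + e \<longleftrightarrow> ?m \<le> s" "?m < s - e \<longleftrightarrow> ?m < s"
      using X.right_of[OF s] X.left_of[OF s] m by auto
    then show ?thesis using m(2)[OF s] unfolding dv_def by auto
  qed
  ultimately show ?thesis unfolding dump_def by blast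
qed

text \<open>Every point of the plane has a grid point that is a corner of all grid cells near it. Hence the
  points of the complement whose corners can dump \<open>c\<close> and those whose corners cannot have disjoint
  closures.\<close>

lemma dump_everywhere:
  assumes con: "connected (- domain T)" and v: "a \<in> X" "b \<in> Y" "(a, b) \<notin> interior (domain T)"
  shows "dump c (a, b)"
proof -
  define S where "S P = {z. fst z \<notin> X \<and> snd z \<notin> Y \<and> z \<notin> domain T \<and>
      (\<exists>a b. X.nbr (fst z) a \<and> Y.nbr (snd z) b \<and> dump c (a, b) = P)}" for P
  have SI: "(x, y) \<in> S P" if "x \<notin> X" "y \<notin> Y" "(x, y) \<notin> domain T" "X.nbr x a" "Y.nbr y b" "dump c (a, b) = P"
    for x y a b P using that unfolding S_def by auto
  have cover: "- domain T \<subseteq> closure (S True) \<union> closure (S False)"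
  proof
    fix z assume "z \<in> - domain T"
    moreover have "open (- domain T)" using closed_domain by (simp add: open_Compl)
    ultimately obtain r where r: "r > 0" "ball z r \<subseteq> - domain T" by (meson openE)
    obtain x y where z: "z = (x, y)" by (metis surj_pair)
    have "z \<in> closure (S True \<union> S False)"
    proof (unfold closure_approachable, intro allI impI)
      fix \<epsilon> :: real assume "\<epsilon> > 0"
      define \<delta> where "\<delta> = min \<epsilon> r / 2"
      have \<delta>: "\<delta> > 0" "\<delta> + \<delta> \<le> \<epsilon>" "\<delta> + \<delta> \<le> r" using r \<open>\<epsilon> > 0\<close> by (auto simp: \<delta>_def)
      obtain x' where x': "\<bar>x' - x\<bar> < \<delta>" "x' \<notin> X"
        using X.off_near[OF _ \<delta>(1), of _ x] X.off_nonempty[of x] X.gap_notin(1) by blast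
      obtain y' where y': "\<bar>y' - y\<bar> < \<delta>" "y' \<notin> Y"
        using Y.off_near[OF _ \<delta>(1), of _ y] Y.off_nonempty[of y] Y.gap_notin(1) by blast
      have d: "dist (x', y') z < \<delta> + \<delta>"
        using x'(1) y'(1) sqrt_sum_squares_le_sum_abs[of "x' - x" "y' - y"]
        by (simp add: z dist_Pair_Pair dist_real_def)
      then have "(x', y') \<in> ball z r" using \<delta>(3) by (simp add: dist_commute)
      then have "(x', y') \<notin> domain T" using r(2) by blast
      moreover obtain a where "X.nbr x' a" using X.nbr_near[OF X_nonempty, of x'] by force
      moreover obtain b where "Y.nbr y' b" using Y.nbr_near[OF Y_nonempty, of y'] by force
      ultimately have "(x', y') \<in> S (dump c (a, b))" using SI x'(2) y'(2) by blast
      then have "(x', y') \<in> S True \<union> S False" by (cases "dump c (a, b)") auto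
      then show "\<exists>w\<in>S True \<union> S False. dist w z < \<epsilon>" using d \<delta>(2) by (intro bexI[of _ "(x', y')"]) auto
    qed
    then show "z \<in> closure (S True) \<union> closure (S False)" by simp
  qed
  have disj: "closure (S True) \<inter> closure (S False) = {}"
  proof (rule ccontr)
    assume "closure (S True) \<inter> closure (S False) \<noteq> {}"
    then obtain z where z: "z \<in> closure (S P)" for P by (metis (full_types) Int_iff ex_in_conv)
    obtain a \<delta> where a: "\<delta> > 0" "\<And>t. \<bar>t - fst z\<bar> < \<delta> \<Longrightarrow> X.nbr t a" using X.nbr_near[OF X_nonempty] by blast
    obtain b \<epsilon> where b: "\<epsilon> > 0" "\<And>t. \<bar>t - snd z\<bar> < \<epsilon> \<Longrightarrow> Y.nbr t b" using Y.nbr_near[OF Y_nonempty] by blast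
    have "dump c (a, b) = P" for P
    proof -
      obtain w where w: "w \<in> S P" "dist w z < min \<delta> \<epsilon>"
        using z[of P] a(1) b(1) unfolding closure_approachable by (metis min_less_iff_conj)
      obtain a' b' where w': "fst w \<notin> X" "snd w \<notin> Y" "w \<notin> domain T" "X.nbr (fst w) a'" "Y.nbr (snd w) b'" "dump c (a', b') = P"
        using w(1) unfolding S_def by blast
      have "\<bar>fst w - fst z\<bar> < \<delta>" "\<bar>snd w - snd z\<bar> < \<epsilon>"
        using w(2) dist_fst_le[of w z] dist_snd_le[of w z] by (auto simp: dist_real_def)
      then have "dump c (a, b) = dump c (a', b')"
        using dump_corners[of "fst w" "snd w" a a' b b' c] w' a(2) b(2) by simp
      then show ?thesis using w'(6) by simp
    qed
    from this[of True] this[of False] show False by simp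
  qed
  \<comment> \<open>This point beyond the upper right grid corner anchors the argument: its corner
    is in the last column, where charges escape to the right.\<close>
  have "(Max X + e, Max Y + e) \<in> S True"
  proof (rule SI)
    show "Max X + e \<notin> X" "Max Y + e \<notin> Y" "X.nbr (Max X + e) (Max X)" "Y.nbr (Max Y + e) (Max Y)"
      using X.shift_notin Y.shift_notin X.nbr_off Y.nbr_off X.fin X_nonempty Y.fin Y_nonempty by simp_all
    show "(Max X + e, Max Y + e) \<notin> domain T" using domain_bounds X.e by force
    show "dump c (Max X, Max Y) = True" using dump_right[of "Max Y" c] Max_in[OF Y.fin Y_nonempty] by simp
  qed
  then have "closure (S True) \<inter> - domain T \<noteq> {}"
    using closure_subset[of "S True"] unfolding S_def by blast
  then have no: "closure (S False) \<inter> - domain T = {}"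
    using con cover disj unfolding connected_closed by (metis Int_empty_left closed_closure)
  \<comment> \<open>A grid point outside the open domain is a corner of some grid cell that misses
    the domain.\<close>
  obtain x' y' where xy': "x' \<in> X.off a" "y' \<in> Y.off b" "(x', y') \<notin> domain T"
    using v(3) interior_domain_iff by blast
  have nb: "X.nbr x' a" "Y.nbr y' b"
    using xy'(1,2) X.nbr_off[OF v(1)] Y.nbr_off[OF v(2)] v by (auto simp: X.off_def Y.off_def)
  show ?thesis
  proof (rule ccontr)
    assume "\<not> dump c (a, b)"
    then have "(x', y') \<in> S False"
      using SI[OF _ _ xy'(3) nb] X.off_notin[OF xy'(1)] Y.off_notin[OF xy'(2)] by simp
    then show False using no closure_subset[of "S False"] xy'(3) by blast
  qed
qed

lemma potential_exists:
  fixes H V :: "real \<Rightarrow> real \<Rightarrow> 'a::ab_group_add"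
  assumes con: "connected (- domain T)"
    and H: "\<And>x x' y. X.gap x x' \<Longrightarrow> H x y = H x' y" and V: "\<And>x y y'. Y.gap y y' \<Longrightarrow> V x y = V x y'"
    and H0: "\<And>x y. (x, y) \<notin> interior (domain T) \<Longrightarrow> H x y = 0"
    and div: "\<And>x y. x \<in> X \<Longrightarrow> y \<in> Y \<Longrightarrow> (x, y) \<in> interior (domain T) \<Longrightarrow> dv H V x y = 0"
  obtains Q :: "real \<Rightarrow> real \<Rightarrow> 'a" where
    "\<And>x x' y y'. X.gap x x' \<Longrightarrow> Y.gap y y' \<Longrightarrow> Q x y = Q x' y'"
    "\<And>x y. x \<notin> X \<Longrightarrow> y \<in> Y \<Longrightarrow> (x, y) \<in> interior (domain T) \<Longrightarrow> Q x (y + e) - Q x (y - e) = H x y"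
    "\<And>x y. x \<in> X \<Longrightarrow> y \<notin> Y \<Longrightarrow> (x, y) \<in> interior (domain T) \<Longrightarrow> Q (x + e) y - Q (x - e) y = V x y"
proof -
  let ?B = "{(x, y). x \<in> X \<and> y \<in> Y \<and> (x, y) \<notin> interior (domain T)}"
  have "?B \<subseteq> X \<times> Y" by auto
  then have fin: "finite ?B" using X.fin Y.fin finite_subset by blast
  \<comment> \<open>The unbalanced grid points outside the open domain are cancelled one at a time;
    the corrections vanish on all grid edges inside, where the given jumps must survive.\<close>
  have "\<exists>H' V'. ext_flow H' V' \<and> (\<forall>x\<in>X. \<forall>y\<in>Y. dv H' V' x y = (if (x, y) \<in> S then - dv H V x y else 0))"
    if "S \<subseteq> ?B" for S
    using finite_subset[OF that fin] that
  proof (induction S rule: finite_induct)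
    case empty
    show ?case by (intro exI[of _ "\<lambda>x y. 0"] conjI ext_flow_0) (simp add: dv_def)
  next
    case (insert v S)
    have "S \<subseteq> ?B" using insert(4) by simp
    from insert(3)[OF this] obtain H1 V1 where H1: "ext_flow H1 V1"
      "\<forall>x\<in>X. \<forall>y\<in>Y. dv H1 V1 x y = (if (x, y) \<in> S then - dv H V x y else 0)"
      by (elim exE conjE) (rule that)
    then have 1: "ext_flow H1 V1"
      "\<And>x y. x \<in> X \<Longrightarrow> y \<in> Y \<Longrightarrow> dv H1 V1 x y = (if (x, y) \<in> S then - dv H V x y else 0)"
      by simp_all
    have "dump (- dv H V (fst v) (snd v)) (fst v, snd v)"
      using insert(4) by (intro dump_everywhere[OF con]) auto
    then obtain H2 V2 where 2: "ext_flow H2 V2"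
      "\<And>x y. x \<in> X \<Longrightarrow> y \<in> Y \<Longrightarrow> dv H2 V2 x y = (if (x, y) = v then - dv H V (fst v) (snd v) else 0)"
      unfolding dump_def prod.collapse by blast
    show ?case
    proof (intro exI conjI ballI)
      show "ext_flow (\<lambda>x y. H1 x y + H2 x y) (\<lambda>x y. V1 x y + V2 x y)" by (rule ext_flow_add[OF 1(1) 2(1)])
      fix x y assume "x \<in> X" "y \<in> Y"
      then show "dv (\<lambda>x y. H1 x y + H2 x y) (\<lambda>x y. V1 x y + V2 x y) x y = (if (x, y) \<in> insert v S then - dv H V x y else 0)"
        using insert(2) by (auto simp: dv_add 1(2) 2(2))
    qed
  qed
  from this[OF order_refl] obtain H' V' where ext: "ext_flow H' V'"
    and dv'': "\<forall>x\<in>X. \<forall>y\<in>Y. dv H' V' x y = (if (x, y) \<in> ?B then - dv H V x y else 0)"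
    by (elim exE conjE) (rule that)
  have dv': "dv H' V' x y = (if (x, y) \<in> ?B then - dv H V x y else 0)" if "x \<in> X" "y \<in> Y" for x y
    using dv'' that by simp
  define H2 where "H2 x y = H x y + H' x y" for x y
  define V2 where "V2 x y = V x y + V' x y" for x y
  have dv2: "dv H2 V2 x y = 0" if "x \<in> X" "y \<in> Y" for x y
    using dv'[OF that] div[OF that] that unfolding H2_def V2_def dv_add by auto
  have H2gap: "H2 x y = H2 x' y" if "X.gap x x'" for x x' y
    unfolding H2_def by (simp only: H[OF that, of y] ext_flowD(1)[OF ext that, of y])
  have V2gap: "V2 x y = V2 x y'" if "Y.gap y y'" for x y y'
    unfolding V2_def by (simp only: V[OF that, of x] ext_flowD(2)[OF ext that, of x])
  \<comment> \<open>Sums from the left recover the horizontal flow only if it starts from zero; this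
    is why \<open>ext_flow\<close> forbids escape to the left.\<close>
  have H2left: "H2 x y = 0" if x: "\<And>a. a \<in> X \<Longrightarrow> x < a" for x y
  proof -
    have "x < Min X" using x X.fin X_nonempty by simp
    then have "(x, y) \<notin> interior (domain T)" using domain_bounds[of x y] interior_subset by fastforce
    then show ?thesis using H0 ext_flowD(3)[OF ext x] by (simp add: H2_def)
  qed
  define Q where "Q x y = (\<Sum>z | z \<in> X \<and> z < x. V2 z y)" for x y
  have Qgap: "Q x y = Q x' y'" if "X.gap x x'" "Y.gap y y'" for x x' y y'
  proof -
    have "{z. z \<in> X \<and> z < x} = {z. z \<in> X \<and> z < x'}" using X.gap_le(3)[OF that(1)] by blast
    then show ?thesis unfolding Q_def using V2gap[OF that(2)] by (intro sum.cong) auto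
  qed
  have QV: "Q (x + e) y - Q (x - e) y = V2 x y" if x: "x \<in> X" for x y
  proof -
    have S: "{z. z \<in> X \<and> z < x + e} = insert x {z. z \<in> X \<and> z < x - e}"
      using X.right_of(4)[OF x] X.left_of(3)[OF x] x by force
    have fin: "finite {z. z \<in> X \<and> z < x - e}" and nx: "x \<notin> {z. z \<in> X \<and> z < x - e}" using X.fin X.e by simp_all
    show ?thesis unfolding Q_def S sum.insert[OF fin nx] by simp
  qed
  have QH: "Q x (y + e) - Q x (y - e) = H2 x y" if x: "x \<notin> X" and y: "y \<in> Y" for x y
  proof -
    define L where "L = min x (Min X) - 1"
    have Min: "Min X \<le> z" if "z \<in> X" for z using X.fin that by simp
    have L: "L < z" if "z \<in> X" for z using Min[OF that] by (simp add: L_def)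
    have "L \<notin> X" "L \<le> x" using L by (auto simp: L_def)
    have "Q x (y + e) - Q x (y - e) = (\<Sum>z | z \<in> X \<and> z < x. V2 z (y + e) - V2 z (y - e))"
      unfolding Q_def by (simp add: sum_subtractf)
    also have "\<dots> = (\<Sum>z | z \<in> X \<and> z < x. H2 (z + e) y - H2 (z - e) y)"
      using dv2[OF _ y] by (intro sum.cong) (auto simp: dv_def)
    also have "{z. z \<in> X \<and> z < x} = {z. z \<in> X \<and> L < z \<and> z < x}" using L by auto
    also have "(\<Sum>z | z \<in> X \<and> L < z \<and> z < x. H2 (z + e) y - H2 (z - e) y) = H2 x y - H2 L y"
      using X.sum_jumps[of "\<lambda>t. H2 t y" L x, OF H2gap \<open>L \<notin> X\<close> x \<open>L \<le> x\<close>] by simp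
    also have "H2 L y = 0" using H2left L by blast
    finally show ?thesis by simp
  qed
  show ?thesis
  proof (rule that[of Q])
    show "Q x (y + e) - Q x (y - e) = H x y" if "x \<notin> X" "y \<in> Y" "(x, y) \<in> interior (domain T)" for x y
      using QH[OF that(1,2)] ext_flowD(4)[OF ext that] by (simp add: H2_def)
    show "Q (x + e) y - Q (x - e) y = V x y" if "x \<in> X" "y \<notin> Y" "(x, y) \<in> interior (domain T)" for x y
      using QV[OF that(1)] ext_flowD(5)[OF ext that] by (simp add: V2_def)
  qed (fact Qgap)
qed

section \<open>Piecewise functions on the cells and their jumps\<close>

text \<open>Only meaningful away from the grid lines, where the cell containing \<open>(x, y)\<close> is unique.\<close>

definition cellv :: "(point set \<Rightarrow> 'a::ab_group_add) \<Rightarrow> real \<Rightarrow> real \<Rightarrow> 'a" where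
  "cellv p x y = (if \<exists>F\<in>T. (x, y) \<in> F then p (SOME F. F \<in> T \<and> (x, y) \<in> F) else 0)"

lemma cellv_eq:
  assumes "F \<in> T" "(x, y) \<in> F" "x \<notin> X" "y \<notin> Y" shows "cellv p x y = p F"
proof -
  let ?G = "SOME F. F \<in> T \<and> (x, y) \<in> F"
  have "?G \<in> T \<and> (x, y) \<in> ?G" by (rule someI[of _ F]) (use assms in simp)
  then have "?G = F" using cell_unique[of ?G F x y] assms by blast
  then show ?thesis using assms(1,2) by (auto simp: cellv_def)
qed

lemma cellv_outside: "(x, y) \<notin> domain T \<Longrightarrow> cellv p x y = 0"
  by (auto simp: cellv_def domain_def)

lemma cellv_gap:
  assumes "X.gap x x'" "Y.gap y y'" shows "cellv p x y = cellv p x' y'"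
proof (cases "(x, y) \<in> domain T")
  case True
  then obtain F where F: "F \<in> T" "(x, y) \<in> F" by (auto simp: domain_def)
  then have "(x', y') \<in> F" using cell_gap[OF F(1) assms] by simp
  then show ?thesis
    using cellv_eq[OF F X.gap_notin(1)[OF assms(1)] Y.gap_notin(1)[OF assms(2)], of p]
      cellv_eq[OF F(1) _ X.gap_notin(2)[OF assms(1)] Y.gap_notin(2)[OF assms(2)], of p] by simp
next
  case False
  then show ?thesis using cellv_outside domain_gap[OF assms] by metis
qed

lemma cellv_add: "cellv (\<lambda>F. p F + q F) x y = cellv p x y + cellv q x y"
  by (simp add: cellv_def)

definition hjump :: "(point set \<Rightarrow> 'a::ab_group_add) \<Rightarrow> real \<Rightarrow> real \<Rightarrow> 'a" where
  "hjump p x y = cellv p x (y + e) - cellv p x (y - e)"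

definition vjump :: "(point set \<Rightarrow> 'a::ab_group_add) \<Rightarrow> real \<Rightarrow> real \<Rightarrow> 'a" where
  "vjump p x y = cellv p (x + e) y - cellv p (x - e) y"

definition mjump :: "(point set \<Rightarrow> 'a::ab_group_add) \<Rightarrow> real \<Rightarrow> real \<Rightarrow> 'a" where
  "mjump p x y = hjump p (x + e) y - hjump p (x - e) y"

lemma mjump_eq: "mjump p x y = vjump p x (y + e) - vjump p x (y - e)"
  by (simp add: mjump_def hjump_def vjump_def algebra_simps)

lemma hjump_gap: "X.gap x x' \<Longrightarrow> y \<in> Y \<Longrightarrow> hjump p x y = hjump p x' y"
  unfolding hjump_def using cellv_gap Y.gap_refl Y.shift_notin by metis

lemma hjump_inactive:
  assumes "x \<notin> X" "y \<in> Y" "(x, y) \<in> interior (domain T)" "\<not> act (x, y)"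
  shows "hjump p x y = 0"
proof -
  obtain F where F: "F \<in> T" "(x, y + e) \<in> F" "(x, y - e) \<in> F" using not_act_cell[OF assms] by blast
  then show ?thesis
    using cellv_eq[OF F(1,2) assms(1), of p] cellv_eq[OF F(1,3) assms(1), of p] Y.shift_notin[OF assms(2)]
    by (simp add: hjump_def)
qed

lemma cell_shift:
  assumes "F \<in> T" "(x, y) \<in> F" "y \<in> Y" shows "(x, y + e) \<in> F \<or> (x, y - e) \<in> F"
proof -
  obtain a b c d where F: "F = {a..b} \<times> {c..d}" "c < d" "c \<in> Y" "d \<in> Y" using assms(1) by (rule rectE)
  then show ?thesis
    using assms Y.right_of[of y] Y.left_of[of y] Y.e by (cases "y < d") (auto simp: less_eq_real_def)
qed

text \<open>Distinct cells share no generic point, so one contains (x, y + e) and the other (x, y -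
  e). They lie on opposite sides of the line and meet only on it; the sign in the second conclusion
  reflects which of them is above.\<close>

lemma contact:
  assumes F: "F \<in> T" "(x, y) \<in> F" and G: "G \<in> T" "(x, y) \<in> G" and "F \<noteq> G" and x: "x \<notin> X" and y: "y \<in> Y"
  shows "(x, y) \<in> interior (domain T)" "p F - p G = hjump p x y \<or> p G - p F = hjump p x y"
    "\<And>z. z \<in> F \<Longrightarrow> z \<in> G \<Longrightarrow> snd z = y"
proof -
  have *: "(x, y) \<in> interior (domain T) \<and> p F - p G = hjump p x y \<and> (\<forall>z. z \<in> F \<longrightarrow> z \<in> G \<longrightarrow> snd z = y)"
    if up: "(x, y + e) \<in> F" and down: "(x, y - e) \<in> G" and FG: "F \<in> T" "G \<in> T" "F \<noteq> G" for F G
  proof (intro conjI allI impI)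
    show "(x, y) \<in> interior (domain T)"
      using interior_domain_edge[OF x y] up down cell_subset FG by blast
    show "p F - p G = hjump p x y"
      using cellv_eq[OF FG(1) up x Y.shift_notin(1)[OF y], of p]
        cellv_eq[OF FG(2) down x Y.shift_notin(2)[OF y], of p] by (simp add: hjump_def)
    fix z assume z: "z \<in> F" "z \<in> G"
    obtain a b c d where F: "F = {a..b} \<times> {c..d}" "c \<in> Y" using FG(1) by (rule rectE)
    obtain a' b' c' d' where G: "G = {a'..b'} \<times> {c'..d'}" "d' \<in> Y" using FG(2) by (rule rectE)
    have "(x, y - e) \<notin> F" using cell_unique[OF FG(1,2) _ down x Y.shift_notin(2)[OF y]] FG(3) by blast
    then have "y \<le> c" using F up Y.left_of(2)[OF y F(2)] Y.e by force
    moreover have "(x, y + e) \<notin> G" using cell_unique[OF FG(1,2) up _ x Y.shift_notin(1)[OF y]] FG(3) by blast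
    then have "d' \<le> y" using G down Y.right_of(2)[OF y G(2)] Y.e by force
    ultimately show "snd z = y" using z F(1) G(1) by (auto simp: mem_Times_iff)
  qed
  have un: "\<not> ((x, y') \<in> F \<and> (x, y') \<in> G)" if "y' \<notin> Y" for y'
    using cell_unique[OF F(1) G(1)] x that \<open>F \<noteq> G\<close> by blast
  have "(x, y + e) \<in> F \<and> (x, y - e) \<in> G \<or> (x, y + e) \<in> G \<and> (x, y - e) \<in> F"
    using cell_shift[OF F y] cell_shift[OF G y] un[OF Y.shift_notin(1)[OF y]] un[OF Y.shift_notin(2)[OF y]] by blast
  then show "(x, y) \<in> interior (domain T)" "p F - p G = hjump p x y \<or> p G - p F = hjump p x y"
    "\<And>z. z \<in> F \<Longrightarrow> z \<in> G \<Longrightarrow> snd z = y"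
    using *[OF _ _ F(1) G(1) \<open>F \<noteq> G\<close>] *[OF _ _ G(1) F(1)] \<open>F \<noteq> G\<close> by blast+
qed

text \<open>An interior edge has a different cell on each side, whose difference is the jump up to
  sign; generic points of a grid line that lie on no edge have jump zero. Hence \<open>B\<close>
  must contain zero and be closed under negation.\<close>

lemma horizontal_smoothness_iff:
  assumes B: "\<And>y. 0 \<in> B y" "\<And>y f. f \<in> B y \<Longrightarrow> - f \<in> B y"
  shows "(\<forall>e'\<in>interior_edges T. \<forall>F\<in>T. \<forall>G\<in>T. e' \<subseteq> F \<and> e' \<subseteq> G \<longrightarrow>
      (\<forall>y. (\<forall>z\<in>e'. snd z = y) \<longrightarrow> p F - p G \<in> B y)) \<longleftrightarrow>
    (\<forall>x y. x \<notin> X \<longrightarrow> y \<in> Y \<longrightarrow> (x, y) \<in> interior (domain T) \<longrightarrow> hjump p x y \<in> B y)"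
    (is "?L \<longleftrightarrow> ?R")
proof
  assume L: ?L
  show ?R
  proof (intro allI impI)
    fix x y assume xy: "x \<notin> X" "y \<in> Y" "(x, y) \<in> interior (domain T)"
    show "hjump p x y \<in> B y"
    proof (cases "act (x, y)")
      case False
      then show ?thesis using hjump_inactive[OF xy False, of p] B(1) by simp
    next
      case True
      obtain a b F G where h: "hedge a b y" "a < x" "x < b" "F \<in> T" "G \<in> T" "F \<noteq> G"
        "{a..b} \<times> {y} \<subseteq> F" "{a..b} \<times> {y} \<subseteq> G" "(x, y + e) \<in> F" "(x, y - e) \<in> G"
        by (rule edge_at[OF True xy(1,2)])
      have "{a..b} \<times> {y} \<in> interior_edges T" using hedge_interior_edge h(1) by blast
      then have "p F - p G \<in> B y" using L h(4-8) by auto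
      then show ?thesis
        using cellv_eq[OF h(4,9) xy(1) Y.shift_notin(1)[OF xy(2)], of p]
          cellv_eq[OF h(5,10) xy(1) Y.shift_notin(2)[OF xy(2)], of p] by (simp add: hjump_def)
    qed
  qed
next
  assume R: ?R
  show ?L
  proof (intro ballI allI impI)
    fix e' F G y assume e': "e' \<in> interior_edges T" and FG: "F \<in> T" "G \<in> T" "e' \<subseteq> F \<and> e' \<subseteq> G"
      and y: "\<forall>z\<in>e'. snd z = y"
    have "horizontal e'" using y by (auto simp: horizontal_def)
    then obtain a b y' where h: "hedge a b y'" "e' = {a..b} \<times> {y'}" by (rule interior_edgeE[OF e'])
    note d = hedgeD[OF h(1)]
    have "(a, y') \<in> e'" using h(2) d(1) by simp
    then have "y' = y" using y by force
    obtain t where t: "a < t" "t < b" "t \<notin> X" using generic_between[OF d(1) order_refl, of 1] d(1) by auto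
    have "(t, y) \<in> e'" using h(2) t \<open>y' = y\<close> by simp
    then have mem: "(t, y) \<in> F" "(t, y) \<in> G" using FG(3) by blast+
    show "p F - p G \<in> B y"
    proof (cases "F = G")
      case True then show ?thesis using B(1) by simp
    next
      case False
      have yY: "y \<in> Y" using d(6) \<open>y' = y\<close> by simp
      note c = contact[OF FG(1) mem(1) FG(2) mem(2) False t(3) yY]
      have "hjump p t y \<in> B y" using R c(1) t(3) yY by blast
      then show ?thesis using c(2)[of p] B(2) by (metis minus_diff_eq)
    qed
  qed
qed

end

section \<open>Symmetry in the two coordinates\<close>

lemma swap_image_mem [simp]: "(x, y) \<in> prod.swap ` S \<longleftrightarrow> (y, x) \<in> S"
  by force

lemma swap_swap_image [simp]: "prod.swap ` prod.swap ` S = S"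
  by force

lemma linear_swap: "linear (prod.swap :: real \<times> real \<Rightarrow> _)"
  by (rule linearI) (auto simp: prod_eq_iff)

lemma interior_swap: "interior (prod.swap ` S) = prod.swap ` interior (S :: point set)"
  using interior_injective_linear_image[OF linear_swap] by simp

lemma closure_swap: "closure (prod.swap ` S) = prod.swap ` closure (S :: point set)"
  using closure_injective_linear_image[OF linear_swap] by simp

lemma frontier_swap: "frontier (prod.swap ` S) = prod.swap ` frontier (S :: point set)"
  by (simp add: frontier_def interior_swap closure_swap image_set_diff)

lemma closed_segment_swap:
  "closed_segment (prod.swap p) (prod.swap q) = prod.swap ` closed_segment p (q :: point)"
  by (rule closed_segment_linear_image[OF linear_swap])

lemma subset_swap: "prod.swap ` A \<subseteq> B \<longleftrightarrow> A \<subseteq> prod.swap ` B"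
  by force

lemma horizontal_swap: "horizontal (prod.swap ` s) \<longleftrightarrow> vertical s"
  and vertical_swap: "vertical (prod.swap ` s) \<longleftrightarrow> horizontal s"
  by (auto simp: horizontal_def vertical_def)

definition swap_mesh :: "point set set \<Rightarrow> point set set" where
  "swap_mesh T = (\<lambda>F. prod.swap ` F) ` T"

lemma swap_mesh_swap [simp]: "swap_mesh (swap_mesh T) = T"
  by (simp add: swap_mesh_def image_image)

lemma mem_swap_mesh: "F \<in> swap_mesh T \<longleftrightarrow> prod.swap ` F \<in> T"
  unfolding swap_mesh_def by (metis (no_types, lifting) image_iff swap_swap_image)

lemma domain_swap: "domain (swap_mesh T) = prod.swap ` domain T"
  by (auto simp: domain_def swap_mesh_def)

lemma swap_Times: "prod.swap ` (A \<times> B) = B \<times> A"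
  by force

lemma corners_swap_sub: "z \<in> corners F \<Longrightarrow> prod.swap z \<in> corners (prod.swap ` F)"
proof -
  assume "z \<in> corners F"
  then obtain a b c d where "a < b" "c < d" "F = {a..b} \<times> {c..d}" "z \<in> {a, b} \<times> {c, d}"
    unfolding corners_def by blast
  then have "c < d \<and> a < b \<and> prod.swap ` F = {c..d} \<times> {a..b} \<and> prod.swap z \<in> {c, d} \<times> {a, b}"
    by (auto simp: swap_Times)
  then show ?thesis unfolding corners_def mem_Collect_eq by (intro exI)
qed

lemma vertices_swap: "vertices (swap_mesh T) = prod.swap ` vertices T"
proof -
  have *: "prod.swap ` vertices T \<subseteq> vertices (swap_mesh T)" for T
    using corners_swap_sub by (fastforce simp: vertices_def swap_mesh_def)
  have "vertices (swap_mesh T) \<subseteq> prod.swap ` vertices T"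
    using *[of "swap_mesh T"] by (simp add: subset_swap)
  then show ?thesis using * by blast
qed

lemma tmesh_swap: "tmesh T \<Longrightarrow> tmesh (swap_mesh T)"
proof -
  assume T: "tmesh T"
  have "is_rectangle (prod.swap ` F)" if "F \<in> T" for F
  proof -
    have "is_rectangle F" using T that by (simp add: tmesh_def)
    then obtain a b c d where "a < b" "c < d" "F = {a..b} \<times> {c..d}" unfolding is_rectangle_def by blast
    then show ?thesis unfolding is_rectangle_def
      by (intro exI[of _ c] exI[of _ d] exI[of _ a] exI[of _ b]) (simp add: swap_Times)
  qed
  moreover have "prod.swap ` F \<inter> prod.swap ` G \<subseteq> frontier (prod.swap ` F) \<inter> frontier (prod.swap ` G)"
    if "F \<in> T" "G \<in> T" "F \<noteq> G" for F G
  proof -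
    have "F \<inter> G \<subseteq> frontier F \<inter> frontier G" using T that by (simp add: tmesh_def)
    then show ?thesis by (auto simp: frontier_swap)
  qed
  ultimately have "\<forall>F\<in>T. is_rectangle (prod.swap ` F)"
    "\<forall>F\<in>T. \<forall>G\<in>T. F \<noteq> G \<longrightarrow> prod.swap ` F \<inter> prod.swap ` G \<subseteq> frontier (prod.swap ` F) \<inter> frontier (prod.swap ` G)"
    by blast+
  moreover have "finite T" "T \<noteq> {}" using T by (simp_all add: tmesh_def)
  ultimately show ?thesis unfolding tmesh_def swap_mesh_def ball_simps by blast
qed

lemma frontiers_swap: "(\<Union>F\<in>swap_mesh T. frontier F) = prod.swap ` (\<Union>F\<in>T. frontier F)"
  by (auto simp: swap_mesh_def frontier_swap)

lemma edges_swap_sub: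
  assumes "e' \<in> edges T" shows "prod.swap ` e' \<in> edges (swap_mesh T)"
proof -
  obtain p q where e': "e' = closed_segment p q" "p \<noteq> q" "horizontal e' \<or> vertical e'"
    "e' \<subseteq> (\<Union>F\<in>T. frontier F)" "e' \<inter> vertices T = {p, q}" using assms unfolding edges_def by blast
  have "prod.swap ` e' = closed_segment (prod.swap p) (prod.swap q)" by (simp add: e'(1) closed_segment_swap)
  moreover have "prod.swap p \<noteq> prod.swap q" using e'(2) by (metis swap_swap)
  moreover have "horizontal (prod.swap ` e') \<or> vertical (prod.swap ` e')"
    using e'(3) by (auto simp: horizontal_swap vertical_swap)
  moreover have "prod.swap ` e' \<subseteq> (\<Union>F\<in>swap_mesh T. frontier F)"
    unfolding frontiers_swap using e'(4) by (rule image_mono)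
  moreover have "prod.swap ` e' \<inter> vertices (swap_mesh T) = {prod.swap p, prod.swap q}"
    unfolding vertices_swap image_Int[OF inj_swap, symmetric] e'(5) by simp
  ultimately show ?thesis unfolding edges_def mem_Collect_eq by metis
qed

lemma interior_edges_swap_sub:
  assumes "e' \<in> interior_edges T" shows "prod.swap ` e' \<in> interior_edges (swap_mesh T)"
  using assms edges_swap_sub
  by (auto simp: interior_edges_def domain_swap frontier_swap inj_image_subset_iff[OF inj_swap])

lemma interior_edges_swap: "e' \<in> interior_edges (swap_mesh T) \<longleftrightarrow> prod.swap ` e' \<in> interior_edges T"
  using interior_edges_swap_sub[of e' "swap_mesh T"] interior_edges_swap_sub[of "prod.swap ` e'" T] by auto

lemma edge_chain_swap_sub:
  assumes "edge_chain T s" shows "edge_chain (swap_mesh T) (prod.swap ` s)"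
proof -
  obtain p q A where s: "p \<noteq> q" "s = closed_segment p q" "horizontal s \<or> vertical s"
    "A \<subseteq> interior_edges T" "s = \<Union>A" using assms unfolding edge_chain_def by blast
  have "prod.swap p \<noteq> prod.swap q \<and> prod.swap ` s = closed_segment (prod.swap p) (prod.swap q)"
    using s(1,2) by (metis closed_segment_swap swap_swap)
  moreover have "horizontal (prod.swap ` s) \<or> vertical (prod.swap ` s)"
    using s(3) by (auto simp: horizontal_swap vertical_swap)
  moreover have "(\<lambda>e. prod.swap ` e) ` A \<subseteq> interior_edges (swap_mesh T)"
    using s(4) interior_edges_swap_sub by blast
  moreover have "prod.swap ` s = \<Union>((\<lambda>e. prod.swap ` e) ` A)" unfolding s(5) by auto
  ultimately show ?thesis unfolding edge_chain_def by blast
qed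

lemma l_edges_swap_sub:
  assumes "s \<in> l_edges T" shows "prod.swap ` s \<in> l_edges (swap_mesh T)"
proof -
  have s: "edge_chain T s" "\<And>s'. edge_chain T s' \<Longrightarrow> s \<subseteq> s' \<Longrightarrow> s' = s"
    using assms unfolding l_edges_def by blast+
  have "s' = prod.swap ` s" if "edge_chain (swap_mesh T) s'" "prod.swap ` s \<subseteq> s'" for s'
  proof -
    have "edge_chain T (prod.swap ` s')" using edge_chain_swap_sub[OF that(1)] by simp
    moreover have "s \<subseteq> prod.swap ` s'" using that(2) by (simp add: subset_swap)
    ultimately have "prod.swap ` s' = s" by (rule s(2))
    then show ?thesis by (metis swap_swap_image)
  qed
  then show ?thesis using edge_chain_swap_sub[OF s(1)] unfolding l_edges_def by blast
qed

lemma l_edges_swap: "s \<in> l_edges (swap_mesh T) \<longleftrightarrow> prod.swap ` s \<in> l_edges T"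
  using l_edges_swap_sub[of s "swap_mesh T"] l_edges_swap_sub[of "prod.swap ` s" T] by auto

lemma interior_vertices_swap: "interior_vertices (swap_mesh T) = prod.swap ` interior_vertices T"
  by (simp add: interior_vertices_def vertices_swap domain_swap frontier_swap image_set_diff)

context mesh begin

lemma mesh_swap: "mesh (swap_mesh T) e"
proof
  show "tmesh (swap_mesh T)" by (rule tmesh_swap[OF tmesh])
  have "fst ` prod.swap ` S = snd ` S" "snd ` prod.swap ` S = fst ` S" for S :: "point set"
    by (simp_all add: image_image)
  then have "fst ` vertices (swap_mesh T) = Y" "snd ` vertices (swap_mesh T) = X"
    by (simp_all add: vertices_swap X_def Y_def)
  then show "finite (fst ` vertices (swap_mesh T))" "finite (snd ` vertices (swap_mesh T))" "0 < e"
    "\<And>x x'. x \<in> fst ` vertices (swap_mesh T) \<Longrightarrow> x' \<in> fst ` vertices (swap_mesh T) \<Longrightarrow> x < x' \<Longrightarrow> x + 2 * e < x'"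
    "\<And>x x'. x \<in> snd ` vertices (swap_mesh T) \<Longrightarrow> x' \<in> snd ` vertices (swap_mesh T) \<Longrightarrow> x < x' \<Longrightarrow> x + 2 * e < x'"
    using X.fin Y.fin X.e X.sep Y.sep by simp_all
qed

text \<open>Vertical statements are obtained as the horizontal ones for the mirrored mesh and
  carried back by the facts named \<open>sw_...\<close>.\<close>

interpretation sw: mesh "swap_mesh T" e by (rule mesh_swap)

lemma sw_X: "sw.X = Y" and sw_Y: "sw.Y = X"
  by (simp_all add: sw.X_def sw.Y_def vertices_swap image_image X_def Y_def)

lemma sw_interior: "(y, x) \<in> interior (domain (swap_mesh T)) \<longleftrightarrow> (x, y) \<in> interior (domain T)"
  by (simp add: domain_swap interior_swap)

lemma sw_cellv:
  assumes "x \<notin> X" "y \<notin> Y" shows "sw.cellv (\<lambda>F. p (prod.swap ` F)) y x = cellv p x y"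
proof (cases "(x, y) \<in> domain T")
  case True
  then obtain F where F: "F \<in> T" "(x, y) \<in> F" by (auto simp: domain_def)
  have "sw.cellv (\<lambda>F. p (prod.swap ` F)) y x = p (prod.swap ` prod.swap ` F)"
    by (rule sw.cellv_eq) (use F assms in \<open>simp_all add: mem_swap_mesh sw_X sw_Y del: swap_swap_image\<close>, simp)
  then show ?thesis using cellv_eq[OF F assms, of p] by simp
next
  case False
  then show ?thesis
    using cellv_outside[of x y p] sw.cellv_outside[of y x "\<lambda>F. p (prod.swap ` F)"] by (simp add: domain_swap)
qed

lemma sw_hjump:
  assumes "x \<in> X" "y \<notin> Y" shows "sw.hjump (\<lambda>F. p (prod.swap ` F)) y x = vjump p x y"
  using sw_cellv[OF X.shift_notin(1)[OF assms(1)] assms(2), of p]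
    sw_cellv[OF X.shift_notin(2)[OF assms(1)] assms(2), of p]
  by (simp add: sw.hjump_def vjump_def)

lemma vjump_gap: "Y.gap y y' \<Longrightarrow> x \<in> X \<Longrightarrow> vjump p x y = vjump p x y'"
  unfolding vjump_def using cellv_gap X.gap_refl X.shift_notin by metis

lemma vertical_contact:
  assumes F: "F \<in> T" "(x, y) \<in> F" and G: "G \<in> T" "(x, y) \<in> G" and "F \<noteq> G" and x: "x \<in> X" and y: "y \<notin> Y"
  shows "(x, y) \<in> interior (domain T)" "p F - p G = vjump p x y \<or> p G - p F = vjump p x y"
    "\<And>z. z \<in> F \<Longrightarrow> z \<in> G \<Longrightarrow> fst z = x"
proof -
  have ne: "prod.swap ` F \<noteq> prod.swap ` G" using \<open>F \<noteq> G\<close> by (metis swap_swap_image)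
  note c = sw.contact[of "prod.swap ` F" y x "prod.swap ` G", OF _ _ _ _ ne]
  show "(x, y) \<in> interior (domain T)"
    using c(1) F G x y by (simp add: mem_swap_mesh sw_X sw_Y sw_interior)
  show "p F - p G = vjump p x y \<or> p G - p F = vjump p x y"
    using c(2)[of "\<lambda>F. p (prod.swap ` F)"] F G x y sw_hjump[OF x y, of p] by (simp add: mem_swap_mesh sw_X sw_Y)
  show "fst z = x" if "z \<in> F" "z \<in> G" for z
    using c(3)[of "prod.swap z"] F G x y that by (simp add: mem_swap_mesh sw_X sw_Y)
qed

lemma vertical_smoothness_iff:
  assumes B: "\<And>x. 0 \<in> B x" "\<And>x f. f \<in> B x \<Longrightarrow> - f \<in> B x"
  shows "(\<forall>e'\<in>interior_edges T. \<forall>F\<in>T. \<forall>G\<in>T. e' \<subseteq> F \<and> e' \<subseteq> G \<longrightarrow>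
      (\<forall>x. (\<forall>z\<in>e'. fst z = x) \<longrightarrow> p F - p G \<in> B x)) \<longleftrightarrow>
    (\<forall>x y. x \<in> X \<longrightarrow> y \<notin> Y \<longrightarrow> (x, y) \<in> interior (domain T) \<longrightarrow> vjump p x y \<in> B x)"
    (is "?L \<longleftrightarrow> ?R")
proof -
  let ?p = "\<lambda>F. p (prod.swap ` F)" and ?s = "\<lambda>F. prod.swap ` F"
  have im: "interior_edges (swap_mesh T) = ?s ` interior_edges T"
    using interior_edges_swap by (metis (no_types, lifting) image_iff set_eqI swap_swap_image)
  have bs: "(\<forall>F\<in>swap_mesh T. P F) \<longleftrightarrow> (\<forall>F\<in>T. P (?s F))" for P by (simp add: swap_mesh_def)
  have "?L \<longleftrightarrow> (\<forall>e'\<in>interior_edges (swap_mesh T). \<forall>F\<in>swap_mesh T. \<forall>G\<in>swap_mesh T. e' \<subseteq> F \<and> e' \<subseteq> G \<longrightarrow>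
      (\<forall>x. (\<forall>z\<in>e'. snd z = x) \<longrightarrow> ?p F - ?p G \<in> B x))"
    by (simp add: im bs inj_image_subset_iff)
  also have "\<dots> \<longleftrightarrow> (\<forall>y x. y \<notin> Y \<longrightarrow> x \<in> X \<longrightarrow> (x, y) \<in> interior (domain T) \<longrightarrow> sw.hjump ?p y x \<in> B x)"
    using sw.horizontal_smoothness_iff[of B ?p, OF B] unfolding sw_X sw_Y sw_interior .
  also have "\<dots> \<longleftrightarrow> ?R" by (auto simp: sw_hjump[of _ _ p])
  finally show ?thesis .
qed

text \<open>Defined through the mirrored mesh so that the facts on \<open>hrun\<close> transfer;
  \<open>vertical_l_edges_iff\<close> identifies these runs with the vertical l-edges.\<close>

definition vrun :: "real \<Rightarrow> real \<Rightarrow> real \<Rightarrow> bool" where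
  "vrun a b x \<longleftrightarrow> mesh.hrun (swap_mesh T) e a b x"

lemma sw_act: "sw.act (y, x) \<longleftrightarrow> act (x, y)"
  unfolding sw.act_def act_def sw_interior frontiers_swap swap_image_mem ..

lemma sw_vertices: "(y, x) \<in> vertices (swap_mesh T) \<longleftrightarrow> (x, y) \<in> vertices T"
  and sw_interior_vertices: "(y, x) \<in> interior_vertices (swap_mesh T) \<longleftrightarrow> (x, y) \<in> interior_vertices T"
  by (simp_all add: vertices_swap interior_vertices_swap)

lemma vrunD:
  assumes "vrun a b x"
  shows "a < b" "(x, a) \<in> vertices T" "(x, b) \<in> vertices T" "a \<in> Y" "b \<in> Y" "x \<in> X"
    "a < t \<Longrightarrow> t < b \<Longrightarrow> t \<notin> Y \<Longrightarrow> act (x, t)" "\<not> act (x, a - e)" "\<not> act (x, b + e)"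
  using sw.hrunD[OF assms[unfolded vrun_def]] unfolding sw_act sw_vertices sw_X sw_Y by auto

lemma vertical_l_edges_iff:
  "s \<in> l_edges T \<and> vertical s \<longleftrightarrow> (\<exists>a b x. vrun a b x \<and> s = {x} \<times> {a..b})"
proof -
  have eq: "prod.swap ` s = {a..b} \<times> {x} \<longleftrightarrow> s = {x} \<times> {a..b}" for a b x
    by (metis swap_Times swap_swap_image)
  have "s \<in> l_edges T \<and> vertical s \<longleftrightarrow> prod.swap ` s \<in> l_edges (swap_mesh T) \<and> horizontal (prod.swap ` s)"
    by (simp add: l_edges_swap horizontal_swap)
  also have "\<dots> \<longleftrightarrow> (\<exists>a b x. vrun a b x \<and> prod.swap ` s = {a..b} \<times> {x})"
    unfolding sw.l_edges_iff vrun_def ..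
  finally show ?thesis unfolding eq .
qed

lemma vrun_exists:
  assumes "act (x, t)" "t \<notin> Y" "x \<in> X"
  obtains a b where "vrun a b x" "a < t" "t < b"
  by (rule sw.hrun_exists[of t x]) (use assms that in \<open>auto simp: sw_act sw_X sw_Y vrun_def\<close>)

lemma vrun_interior:
  assumes "vrun a b x" "a < t" "t < b" shows "(x, t) \<in> interior (domain T)"
  using sw.hrun_interior[OF assms(1)[unfolded vrun_def] assms(2,3)] sw_interior by simp

lemma vrun_sum:
  assumes "\<And>s t. Y.gap s t \<Longrightarrow> h s = (h t :: 'a::ab_group_add)" and "vrun a b x"
  shows "h (b + e) = h (a - e) + (\<Sum>y | y \<in> Y \<and> a \<le> y \<and> y \<le> b. h (y + e) - h (y - e))"
  using sw.run_sum[of h a b x] assms unfolding sw_X vrun_def by blast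

lemma vrun_function_zero:
  fixes h :: "real \<Rightarrow> 'a::ab_group_add"
  assumes "\<And>s t. Y.gap s t \<Longrightarrow> h s = h t" and "vrun a b x"
    and "\<And>y. y \<in> Y \<Longrightarrow> (x, y) \<in> interior (domain T) \<Longrightarrow> h (y + e) = h (y - e)"
    and "\<And>y. y \<notin> Y \<Longrightarrow> (x, y) \<in> interior (domain T) \<Longrightarrow> \<not> act (x, y) \<Longrightarrow> h y = 0"
    and "(x, a) \<notin> interior (domain T) \<Longrightarrow> (x, b) \<notin> interior (domain T) \<Longrightarrow> h (a + e) = 0"
    and "a < t" "t < b" "t \<notin> Y"
  shows "h t = 0"
  by (rule sw.run_function_zero[where h=h and a=a and b=b and y=x and t=t,
        unfolded sw_X sw_interior sw_act, folded vrun_def, OF assms])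

lemma vrun_function_exists:
  fixes m :: "point \<Rightarrow> 'a::ab_group_add" and h0 :: "point set \<Rightarrow> 'a"
  assumes m0: "\<And>v. v \<notin> interior_vertices T \<Longrightarrow> m v = 0"
    and bal: "\<And>a b x. vrun a b x \<Longrightarrow> (x, a) \<in> interior_vertices T \<Longrightarrow> (x, b) \<in> interior_vertices T \<Longrightarrow>
      (\<Sum>y | y \<in> Y \<and> a \<le> y \<and> y \<le> b. m (x, y)) = 0"
    and B: "\<And>x. 0 \<in> B x" "\<And>x f g. f \<in> B x \<Longrightarrow> g \<in> B x \<Longrightarrow> f + g \<in> B x" "\<And>x f. f \<in> B x \<Longrightarrow> - f \<in> B x"
    and mB: "\<And>x y. m (x, y) \<in> B x" and h0B: "\<And>a b x. vrun a b x \<Longrightarrow> h0 ({x} \<times> {a..b}) \<in> B x"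
  obtains V :: "real \<Rightarrow> real \<Rightarrow> 'a" where
    "\<And>x y y'. Y.gap y y' \<Longrightarrow> V x y = V x y'"
    "\<And>x y. \<not> act (x, y) \<Longrightarrow> V x y = 0"
    "\<And>x y. x \<in> X \<Longrightarrow> y \<in> Y \<Longrightarrow> (x, y) \<in> interior (domain T) \<Longrightarrow> V x (y + e) - V x (y - e) = m (x, y)"
    "\<And>a b x. vrun a b x \<Longrightarrow> (x, a) \<notin> interior_vertices T \<Longrightarrow> (x, b) \<notin> interior_vertices T \<Longrightarrow>
       V x (a + e) = h0 ({x} \<times> {a..b})"
    "\<And>x y. V x y \<in> B x"
proof -
  have m0': "m (prod.swap v) = 0" if "v \<notin> interior_vertices (swap_mesh T)" for v
    using m0[of "prod.swap v"] that by (cases v) (simp add: sw_interior_vertices)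
  have bal': "(\<Sum>y | y \<in> sw.X \<and> a \<le> y \<and> y \<le> b. m (prod.swap (y, x))) = 0"
    if "sw.hrun a b x" "(a, x) \<in> interior_vertices (swap_mesh T)" "(b, x) \<in> interior_vertices (swap_mesh T)" for a b x
    using bal[of a b x] that by (simp add: sw_X vrun_def sw_interior_vertices)
  have mB': "m (prod.swap (y, x)) \<in> B x" for x y using mB by simp
  have h0B': "h0 (prod.swap ` ({a..b} \<times> {x})) \<in> B x" if "sw.hrun a b x" for a b x
    using h0B that by (simp add: swap_Times vrun_def)
  show ?thesis
  proof (rule sw.run_function_exists[of "\<lambda>v. m (prod.swap v)" B "\<lambda>s. h0 (prod.swap ` s)"])
    fix H assume H: "\<And>x x' y. sw.X.gap x x' \<Longrightarrow> H x y = H x' y"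
      "\<And>x y. \<not> sw.act (x, y) \<Longrightarrow> H x y = 0"
      "\<And>x y. x \<in> sw.X \<Longrightarrow> y \<in> sw.Y \<Longrightarrow> (x, y) \<in> interior (domain (swap_mesh T)) \<Longrightarrow> H (x + e) y - H (x - e) y = m (prod.swap (x, y))"
      "\<And>a b y. sw.hrun a b y \<Longrightarrow> (a, y) \<notin> interior_vertices (swap_mesh T) \<Longrightarrow> (b, y) \<notin> interior_vertices (swap_mesh T) \<Longrightarrow>
         H (a + e) y = h0 (prod.swap ` ({a..b} \<times> {y}))"
      "\<And>x y. H x y \<in> B y"
    show ?thesis
    proof (rule that[of "\<lambda>x y. H y x"])
      show "H y x = H y' x" if "Y.gap y y'" for x y y' using H(1)[of y y'] that by (simp add: sw_X)
    qed (use H(2-5) in \<open>simp_all add: sw_X sw_Y sw_act sw_interior sw_interior_vertices vrun_def swap_Times\<close>)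
  qed (fact m0' bal' B mB' h0B')+
qed

section \<open>Connectedness across edges\<close>

text \<open>At a vertex, regularity is used after removing the grid points from the interior of the union of
  its cells: this leaves a connected set, in which cells meet only across edges.\<close>

lemma locally_constant:
  fixes K :: "point set \<Rightarrow> 'k"
  assumes reg: "regular_tmesh T"
    and h: "\<And>F G x y. F \<in> T \<Longrightarrow> G \<in> T \<Longrightarrow> z \<in> F \<Longrightarrow> z \<in> G \<Longrightarrow> F \<noteq> G \<Longrightarrow> (x, y) \<in> F \<Longrightarrow> (x, y) \<in> G \<Longrightarrow>
      x \<notin> X \<Longrightarrow> y \<in> Y \<Longrightarrow> K F = K G"
    and v: "\<And>F G x y. F \<in> T \<Longrightarrow> G \<in> T \<Longrightarrow> z \<in> F \<Longrightarrow> z \<in> G \<Longrightarrow> F \<noteq> G \<Longrightarrow> (x, y) \<in> F \<Longrightarrow> (x, y) \<in> G \<Longrightarrow>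
      x \<in> X \<Longrightarrow> y \<notin> Y \<Longrightarrow> K F = K G"
    and F: "F \<in> T" "z \<in> F" and G: "G \<in> T" "z \<in> G"
  shows "K F = K G"
proof -
  obtain x0 y0 where z: "z = (x0, y0)" by (metis surj_pair)
  have meet: "K F' = K G'"
    if asm: "F' \<in> T" "G' \<in> T" "z \<in> F'" "z \<in> G'" "(x, y) \<in> F'" "(x, y) \<in> G'" "x \<notin> X \<or> y \<notin> Y" for F' G' x y
  proof (cases "F' = G'")
    case True then show ?thesis by simp
  next
    case False
    consider "x \<notin> X" "y \<notin> Y" | "x \<notin> X" "y \<in> Y" | "x \<in> X" "y \<notin> Y" using asm(7) by blast
    then show ?thesis
    proof cases
      case 1 then show ?thesis using cell_unique[OF asm(1,2,5,6)] by simp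
    next
      case 2 then show ?thesis using h[OF asm(1-4) False asm(5,6)] by simp
    next
      case 3 then show ?thesis using v[OF asm(1-4) False asm(5,6)] by simp
    qed
  qed
  consider "x0 \<notin> X \<or> y0 \<notin> Y" | "x0 \<in> X" "y0 \<in> Y" "z \<notin> vertices T" | "z \<in> vertices T" by blast
  then show ?thesis
  proof cases
    case 1
    then show ?thesis using meet[OF F(1) G(1) F(2) G(2)] F(2) G(2) z by blast
  next
    case 2
    \<comment> \<open>z is no corner of \<open>F'\<close>, so \<open>F'\<close> contains a half
      neighbourhood of z: above, below, left or right. Halves of the same type share a point of a
      grid line off the grid points, an upper or lower half and a left or right one share a
      quadrant.\<close>
    have side: "(\<exists>\<tau>\<in>{-e, e}. (x0 - e, y0 + \<tau>) \<in> F' \<and> (x0 + e, y0 + \<tau>) \<in> F') \<and> (x0 + e, y0) \<in> F' \<or>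
        (\<exists>\<tau>\<in>{-e, e}. (x0 + \<tau>, y0 - e) \<in> F' \<and> (x0 + \<tau>, y0 + e) \<in> F') \<and> (x0, y0 + e) \<in> F'"
      if F': "F' \<in> T" "z \<in> F'" for F'
    proof -
      obtain a b c d where f: "a < b" "c < d" "F' = {a..b} \<times> {c..d}" "a \<in> X" "b \<in> X" "c \<in> Y" "d \<in> Y"
        "(a, c) \<in> vertices T" "(b, c) \<in> vertices T" "(a, d) \<in> vertices T" "(b, d) \<in> vertices T"
        using F'(1) by (rule rectE)
      have in': "a \<le> x0" "x0 \<le> b" "c \<le> y0" "y0 \<le> d" using F'(2) z f(3) by auto
      have "(a < x0 \<and> x0 < b) \<or> (c < y0 \<and> y0 < d)"
        using in' 2(3) f(8-11) z by (metis less_eq_real_def)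
      moreover have "a \<le> x0 - e \<longleftrightarrow> a < x0" "x0 + e \<le> b \<longleftrightarrow> x0 < b" "c \<le> y0 - e \<longleftrightarrow> c < y0" "y0 + e \<le> d \<longleftrightarrow> y0 < d"
        using X.left_of(2)[OF 2(1)] X.right_of(2)[OF 2(1)] Y.left_of(2)[OF 2(2)] Y.right_of(2)[OF 2(2)] f(4-7) by blast+
      moreover have "c < y0 \<or> y0 < d" "a < x0 \<or> x0 < b" using f(1,2) in' by linarith+
      ultimately show ?thesis using in' X.e unfolding f(3) by (auto simp: bex_simps)
    qed
    note nX = X.shift_notin[OF 2(1)] and nY = Y.shift_notin[OF 2(2)]
    have nX': "x0 + \<tau> \<notin> X" and nY': "y0 + \<tau> \<notin> Y" if "\<tau> \<in> {-e, e}" for \<tau>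
      using nX nY that by auto
    have cross: "K F' = K G'" if "F' \<in> T" "G' \<in> T" "z \<in> F'" "z \<in> G'" "\<tau> \<in> {-e, e}" "\<sigma> \<in> {-e, e}"
      "(x0 - e, y0 + \<tau>) \<in> F'" "(x0 + e, y0 + \<tau>) \<in> F'" "(x0 + \<sigma>, y0 - e) \<in> G'" "(x0 + \<sigma>, y0 + e) \<in> G'" for F' G' \<tau> \<sigma>
    proof -
      have "(x0 + \<sigma>, y0 + \<tau>) \<in> F'" using that(6,7,8) by auto
      moreover have "(x0 + \<sigma>, y0 + \<tau>) \<in> G'" using that(5,9,10) by auto
      ultimately show ?thesis using meet[OF that(1-4)] nX'[OF that(6)] by blast
    qed
    from side[OF F] side[OF G] show ?thesis
      using meet[OF F(1) G(1) F(2) G(2)] nX nY cross[OF F(1) G(1) F(2) G(2)] cross[OF G(1) F(1) G(2) F(2)]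
      by (elim disjE conjE bexE) (blast, metis, metis, blast)
  next
    case 3
    let ?I = "interior (\<Union>{F \<in> T. z \<in> F})"
    let ?J = "?I - X \<times> Y"
    have "connected ?I" using reg 3 by (simp add: regular_tmesh_def)
    then have con: "connected ?J"
      by (intro connected_open_delete_finite) (auto simp: X.fin Y.fin)
    \<comment> \<open>The cells at z are split by whether they carry the same value as
      \<open>F\<close>. Both unions are closed, and if both values occurred they would share a point
      of the connected set \<open>?J\<close>.\<close>
    define C where "C P = \<Union>{F' \<in> T. z \<in> F' \<and> (K F' = K F) = P}" for P
    have cl: "closed (C P)" for P
      unfolding C_def using finite_T cell_closed by (intro closed_Union) auto
    have cover: "?J \<subseteq> C True \<union> C False"
    proof
      fix w assume "w \<in> ?J"
      then have "w \<in> \<Union>{F \<in> T. z \<in> F}" using interior_subset by blast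
      then show "w \<in> C True \<union> C False" unfolding C_def by blast
    qed
    have meetJ: "C P \<inter> ?J \<noteq> {}" if F': "F' \<in> T" "z \<in> F'" "(K F' = K F) = P" for F' P
    proof -
      obtain a b c d where f: "a < b" "c < d" "F' = {a..b} \<times> {c..d}" "a \<in> X" "b \<in> X" using F'(1) by (rule rectE)
      obtain s where s: "a < s" "s < b" "s \<notin> X" by (rule generic_between[OF f(1) order_refl, of 1]) (use f in auto)
      obtain t where t: "c < t" "t < d" using f(2) dense by blast
      have "(s, t) \<in> interior F'" using s t by (simp add: f(3) interior_Times)
      moreover have "interior F' \<subseteq> ?I" using F' by (intro interior_mono) auto
      moreover have "(s, t) \<in> C P" using s t F' f(3) unfolding C_def by (intro UnionI[of F']) auto
      ultimately show ?thesis using s(3) by blast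
    qed
    show ?thesis
    proof (rule ccontr)
      assume "K F \<noteq> K G"
      then have ne: "C True \<inter> ?J \<noteq> {}" "C False \<inter> ?J \<noteq> {}"
        using meetJ[OF F, of True] meetJ[OF G, of False] by auto
      have "C True \<inter> C False \<inter> ?J \<noteq> {}"
        using con cover ne cl unfolding connected_closed by blast
      then obtain w where w: "w \<in> C True" "w \<in> C False" "w \<in> ?J" by blast
      obtain F' where F': "F' \<in> T" "z \<in> F'" "w \<in> F'" "K F' = K F" using w(1) unfolding C_def by blast
      obtain G' where G': "G' \<in> T" "z \<in> G'" "w \<in> G'" "K G' \<noteq> K F" using w(2) unfolding C_def by blast
      obtain x y where "w = (x, y)" by (metis surj_pair)
      then have "K F' = K G'" using meet[OF F'(1) G'(1) F'(2) G'(2)] F'(3) G'(3) w(3) by blast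
      then show False using F'(4) G'(4) by simp
    qed
  qed
qed

text \<open>The cells with the value of \<open>F\<close> and the remaining cells have closed unions
  that cover the connected domain. A common point of the two unions contradicts
  \<open>locally_constant\<close>.\<close>

lemma globally_constant:
  fixes K :: "point set \<Rightarrow> 'k"
  assumes reg: "regular_tmesh T" and con: "connected (domain T)"
    and h: "\<And>F G x y. F \<in> T \<Longrightarrow> G \<in> T \<Longrightarrow> F \<noteq> G \<Longrightarrow> (x, y) \<in> F \<Longrightarrow> (x, y) \<in> G \<Longrightarrow>
      x \<notin> X \<Longrightarrow> y \<in> Y \<Longrightarrow> K F = K G"
    and v: "\<And>F G x y. F \<in> T \<Longrightarrow> G \<in> T \<Longrightarrow> F \<noteq> G \<Longrightarrow> (x, y) \<in> F \<Longrightarrow> (x, y) \<in> G \<Longrightarrow>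
      x \<in> X \<Longrightarrow> y \<notin> Y \<Longrightarrow> K F = K G"
    and F: "F \<in> T" and G: "G \<in> T"
  shows "K F = K G"
proof (rule ccontr)
  assume ne: "K F \<noteq> K G"
  define C where "C P = \<Union>{F' \<in> T. (K F' = K F) = P}" for P
  have cl: "closed (C P)" for P
    unfolding C_def using finite_T cell_closed by (intro closed_Union) auto
  have cover: "domain T \<subseteq> C True \<union> C False" unfolding C_def domain_def by blast
  have nonempty: "F' \<noteq> {}" if "F' \<in> T" for F' using that by (elim rectE) auto
  have "F \<subseteq> C True" "G \<subseteq> C False" unfolding C_def using F G ne by auto
  then have "C True \<inter> domain T \<noteq> {}" "C False \<inter> domain T \<noteq> {}"
    using nonempty[OF F] nonempty[OF G] cell_subset[OF F] cell_subset[OF G] by blast+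
  then have "C True \<inter> C False \<inter> domain T \<noteq> {}"
    using con cover cl unfolding connected_closed by blast
  then obtain z F' G' where z: "F' \<in> T" "z \<in> F'" "K F' = K F" "G' \<in> T" "z \<in> G'" "K G' \<noteq> K F"
    unfolding C_def by blast
  have "K F' = K G'" by (rule locally_constant[OF reg h v z(1,2,4,5)])
  then show False using z by simp
qed

end

section \<open>Splines as families of polynomials with divisible jumps\<close>

lemma endpoints_horizontal: "a < b \<Longrightarrow> endpoints ({a..b} \<times> {y}) = {(a, y), (b, y)}"
proof -
  assume "a < b"
  then have "{a..b} \<times> {y} = closed_segment (a, y) (b, y)" using closed_segment_horizontal'[of a b y] by simp
  then show ?thesis by (auto simp: endpoints_def doubleton_eq_iff)
qed

lemma endpoints_swap: "endpoints (prod.swap ` s) = prod.swap ` endpoints s"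
proof -
  have *: "prod.swap ` endpoints s \<subseteq> endpoints (prod.swap ` s)" for s
  proof (rule image_subsetI)
    fix p assume "p \<in> endpoints s"
    then obtain q where "s = closed_segment p q" unfolding endpoints_def by blast
    then have "prod.swap ` s = closed_segment (prod.swap p) (prod.swap q)" by (simp only: closed_segment_swap)
    then show "prod.swap p \<in> endpoints (prod.swap ` s)" unfolding endpoints_def by blast
  qed
  have "endpoints (prod.swap ` s) \<subseteq> prod.swap ` endpoints s"
    using *[of "prod.swap ` s"] unfolding swap_swap_image subset_swap .
  then show ?thesis using *[of s] by (rule subset_antisym)
qed

lemma endpoints_vertical: "a < b \<Longrightarrow> endpoints ({x} \<times> {a..b}) = {(x, a), (x, b)}"
  using endpoints_swap[of "{a..b} \<times> {x}"] endpoints_horizontal[of a b x] by (simp add: swap_Times)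

context mesh begin

section \<open>Types of l-edges and their vertices\<close>

lemma l_edge_cases:
  assumes "s \<in> l_edges T"
  obtains (horizontal) a b y where "hrun a b y" "s = {a..b} \<times> {y}" "horizontal s" "\<not> vertical s"
    | (vertical) a b x where "vrun a b x" "s = {x} \<times> {a..b}" "vertical s" "\<not> horizontal s"
proof -
  have "horizontal s \<or> vertical s" using assms by (simp add: l_edges_def edge_chain_def)
  then show ?thesis
  proof
    assume h: "horizontal s"
    have "\<exists>a b y. hrun a b y \<and> s = {a..b} \<times> {y}" using l_edges_iff[of s] assms h by (simp only: simp_thms)
    then obtain a b y where r: "hrun a b y" "s = {a..b} \<times> {y}" by (elim exE conjE) (rule that)
    then show ?thesis using horizontal[OF r h] not_vertical_interval[OF hrunD(1)[OF r(1)]] by simp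
  next
    assume v: "vertical s"
    have "\<exists>a b x. vrun a b x \<and> s = {x} \<times> {a..b}" using vertical_l_edges_iff[of s] assms v by (simp only: simp_thms)
    then obtain a b x where r: "vrun a b x" "s = {x} \<times> {a..b}" by (elim exE conjE) (rule that)
    have "\<not> vertical ({a..b} \<times> {x})" by (rule not_vertical_interval[OF vrunD(1)[OF r(1)]])
    then have "\<not> horizontal s" using vertical_swap[of "prod.swap ` s"] by (simp add: r(2) swap_Times horizontal_swap[symmetric])
    then show ?thesis using vertical[OF r v] by simp
  qed
qed

lemma hrun_l_edge: "hrun a b y \<Longrightarrow> {a..b} \<times> {y} \<in> l_edges T"
  using l_edges_iff[of "{a..b} \<times> {y}"] by blast

lemma vrun_l_edge: "vrun a b x \<Longrightarrow> {x} \<times> {a..b} \<in> l_edges T"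
  using vertical_l_edges_iff[of "{x} \<times> {a..b}"] by blast

lemma hrun_interior_iff:
  assumes "hrun a b y"
  shows "{a..b} \<times> {y} \<in> interior_l_edges T \<longleftrightarrow> (a, y) \<in> interior_vertices T \<and> (b, y) \<in> interior_vertices T"
    and "{a..b} \<times> {y} \<in> cross_cuts T \<longleftrightarrow> (a, y) \<notin> interior_vertices T \<and> (b, y) \<notin> interior_vertices T"
  using hrun_l_edge[OF assms] hrunD(1-3)[OF assms]
  by (auto simp: interior_l_edges_def cross_cuts_def endpoints_horizontal boundary_vertices_eq interior_vertices_eq)

lemma vrun_interior_iff:
  assumes "vrun a b x"
  shows "{x} \<times> {a..b} \<in> interior_l_edges T \<longleftrightarrow> (x, a) \<in> interior_vertices T \<and> (x, b) \<in> interior_vertices T"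
    and "{x} \<times> {a..b} \<in> cross_cuts T \<longleftrightarrow> (x, a) \<notin> interior_vertices T \<and> (x, b) \<notin> interior_vertices T"
  using vrun_l_edge[OF assms] vrunD(1-3)[OF assms]
  by (auto simp: interior_l_edges_def cross_cuts_def endpoints_vertical boundary_vertices_eq interior_vertices_eq)

lemma finite_l_edges: "finite (l_edges T)"
proof (rule finite_subset)
  show "l_edges T \<subseteq> (\<lambda>(a, b, y). {a..b} \<times> {y}) ` (X \<times> X \<times> Y) \<union> (\<lambda>(a, b, x). {x} \<times> {a..b}) ` (Y \<times> Y \<times> X)"
  proof
    fix s assume "s \<in> l_edges T"
    then show "s \<in> (\<lambda>(a, b, y). {a..b} \<times> {y}) ` (X \<times> X \<times> Y) \<union> (\<lambda>(a, b, x). {x} \<times> {a..b}) ` (Y \<times> Y \<times> X)"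
    proof (cases rule: l_edge_cases)
      case (horizontal a b y)
      then have "s = (\<lambda>(a, b, y). {a..b} \<times> {y}) (a, b, y)" "(a, b, y) \<in> X \<times> X \<times> Y" using hrunD(4-6) by auto
      then show ?thesis by blast
    next
      case (vertical a b x)
      then have "s = (\<lambda>(a, b, x). {x} \<times> {a..b}) (a, b, x)" "(a, b, x) \<in> Y \<times> Y \<times> X" using vrunD(4-6) by auto
      then show ?thesis by blast
    qed
  qed
qed (intro finite_UnI finite_imageI finite_cartesian_product X.fin Y.fin)+

lemma interior_l_edge_vertices:
  assumes "s \<in> interior_l_edges T" "v \<in> vertices T" "v \<in> s" shows "v \<in> interior_vertices T"
proof -
  have "s \<in> l_edges T" using assms(1) by (simp add: interior_l_edges_def)
  then show ?thesis
  proof (cases rule: l_edge_cases)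
    case (horizontal a b y)
    obtain x where v: "v = (x, y)" "a \<le> x" "x \<le> b" using assms(3) horizontal(2) by auto
    show ?thesis
      using hrun_interior[OF horizontal(1), of x] hrun_interior_iff(1)[OF horizontal(1)] assms v horizontal(2)
      by (cases "x = a \<or> x = b") (auto simp: interior_vertices_eq)
  next
    case (vertical a b x)
    obtain y where v: "v = (x, y)" "a \<le> y" "y \<le> b" using assms(3) vertical(2) by auto
    show ?thesis
      using vrun_interior[OF vertical(1), of y] vrun_interior_iff(1)[OF vertical(1)] assms v vertical(2)
      by (cases "y = a \<or> y = b") (auto simp: interior_vertices_eq)
  qed
qed

lemma cell_product: "F \<in> T \<Longrightarrow> (x, y) \<in> F \<Longrightarrow> (x', y') \<in> F \<Longrightarrow> (x, y') \<in> F"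
  by (elim rectE) auto

text \<open>No edge ends here. If the line is active to the right, the cells above and below it
  extend to the left as well; otherwise it is inactive on both sides and both horizontal jumps are
  zero.\<close>

lemma mjump_nonvertex:
  assumes x: "x \<in> X" and y: "y \<in> Y" and int: "(x, y) \<in> interior (domain T)" and nv: "(x, y) \<notin> vertices T"
  shows "mjump p x y = 0"
proof (cases "act (x + e, y)")
  case True
  note nx = X.shift_notin[OF x] and ny = Y.shift_notin[OF y]
  obtain a b F G where h: "hedge a b y" "a < x + e" "x + e < b" "F \<in> T" "G \<in> T" "F \<noteq> G"
    "{a..b} \<times> {y} \<subseteq> F" "{a..b} \<times> {y} \<subseteq> G" "(x + e, y + e) \<in> F" "(x + e, y - e) \<in> G"
    by (rule edge_at[OF True nx(1) y])
  note d = hedgeD(2,4)[OF h(1)]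
  have "a \<le> x" using X.right_of(4)[OF x d(2)] h(2) by simp
  moreover have "a \<noteq> x" using d(1) nv by auto
  ultimately have "a < x - e" using X.left_of(3)[OF x d(2)] by simp
  then have "(x - e, y) \<in> F" "(x - e, y) \<in> G" using h(3,7,8) X.e by auto
  then have "(x - e, y + e) \<in> F" "(x - e, y - e) \<in> G"
    using cell_product[OF h(4) _ h(9)] cell_product[OF h(5) _ h(10)] by blast+
  then show ?thesis
    using cellv_eq[OF h(4,9) nx(1) ny(1), of p] cellv_eq[OF h(5,10) nx(1) ny(2), of p]
      cellv_eq[OF h(4) _ nx(2) ny(1), of p] cellv_eq[OF h(5) _ nx(2) ny(2), of p]
    by (simp add: mjump_def hjump_def)
next
  case False
  have "\<not> act (x - e, y)" using act_vertex_left[OF x y _ False] hrunD(3) nv by blast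
  then show ?thesis
    using False hjump_inactive[OF X.shift_notin(1)[OF x] y interior_shift(1)[OF x y int], of p]
      hjump_inactive[OF X.shift_notin(2)[OF x] y interior_shift(2)[OF x y int], of p]
    by (simp add: mjump_def)
qed

lemma vertical_interior_shift:
  assumes "x \<in> X" "y \<in> Y" "(x, y) \<in> interior (domain T)"
  shows "(x, y + e) \<in> interior (domain T)" "(x, y - e) \<in> interior (domain T)"
  using assms Y.shift_notin
  by (auto simp: interior_domain_iff X.off_def Y.off_def)

end

lemma min_vertices_le:
  assumes "a < d" "min_vertices d a \<le> int n" shows "d + 1 \<le> n * (d - a)"
proof -
  have "(real d + 1) / (real d - real a) \<le> real n"
    using assms(2) unfolding min_vertices_def by (simp add: ceiling_le_iff)
  then have "real d + 1 \<le> real n * (real d - real a)"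
    using assms(1) by (simp add: divide_le_eq)
  then have "real (d + 1) \<le> real (n * (d - a))"
    using assms(1) by (simp add: of_nat_diff)
  then show ?thesis by (simp only: of_nat_le_iff)
qed

text \<open>The coordinates of a spline: a cross-cut carries the cofactor of the jump at its first edge, an
  interior vertex the cofactor of the mixed jump.\<close>

datatype tag = Base | Cut "point set" | Vtx point

locale spline_mesh = mesh +
  fixes d1 d2 \<alpha> \<beta> :: nat
  assumes \<alpha>: "\<alpha> < d1" and \<beta>: "\<beta> < d2" and regular: "regular_tmesh T"
    and con: "connected (domain T)" and con_compl: "connected (- domain T)"
begin

text \<open>The admissible jumps across the vertical line through x. The cofactor has only the
  degree left over by the power, so jumps stay in \<open>Pol d1 d2\<close>.\<close>

definition DX :: "real \<Rightarrow> (point \<Rightarrow> real) set" where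
  "DX x = {f. \<exists>g\<in>Pol (d1 - (\<alpha> + 1)) d2. f = (\<lambda>z. (fst z - x) ^ (\<alpha> + 1) * g z)}"

definition DY :: "real \<Rightarrow> (point \<Rightarrow> real) set" where
  "DY y = {f. \<exists>g\<in>Pol d1 (d2 - (\<beta> + 1)). f = (\<lambda>z. (snd z - y) ^ (\<beta> + 1) * g z)}"

lemma linear_mult_fun: "linear (\<lambda>g z. h z * g z :: real)"
  by (rule linearI) (auto simp: algebra_simps)

lemma subspace_DX: "subspace (DX x)" and subspace_DY: "subspace (DY y)"
proof -
  have "DX x = (\<lambda>g z. (fst z - x) ^ (\<alpha> + 1) * g z) ` Pol (d1 - (\<alpha> + 1)) d2"
    "DY y = (\<lambda>g z. (snd z - y) ^ (\<beta> + 1) * g z) ` Pol d1 (d2 - (\<beta> + 1))"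
    unfolding DX_def DY_def by blast+
  then show "subspace (DX x)" "subspace (DY y)"
    by (simp_all only: linear_subspace_image[OF linear_mult_fun subspace_Pol])
qed

lemma DX_Pol: "f \<in> DX x \<Longrightarrow> f \<in> Pol d1 d2"
  unfolding DX_def using Pol_X_times[of _ "d1 - (\<alpha> + 1)" d2 x "\<alpha> + 1"] \<alpha> by auto

lemma DY_Pol: "f \<in> DY y \<Longrightarrow> f \<in> Pol d1 d2"
  unfolding DY_def using Pol_Y_times[of _ d1 "d2 - (\<beta> + 1)" y "\<beta> + 1"] \<beta> by auto

lemma DX_zero: "f \<in> DX x \<Longrightarrow> fst z = x \<Longrightarrow> f z = 0"
  and DY_zero: "f \<in> DY y \<Longrightarrow> snd z = y \<Longrightarrow> f z = 0"
  by (auto simp: DX_def DY_def)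

lemma smooth_across_iff:
  assumes "bidegree_le d1 d2 P" "bidegree_le d1 d2 Q"
  shows "smooth_across \<alpha> \<beta> e' P Q \<longleftrightarrow>
    (\<forall>x. (\<forall>z\<in>e'. fst z = x) \<longrightarrow> eval2 P - eval2 Q \<in> DX x) \<and>
    (\<forall>y. (\<forall>z\<in>e'. snd z = y) \<longrightarrow> eval2 P - eval2 Q \<in> DY y)"
proof -
  have "bidegree_le d1 d2 (P - Q)"
    using assms unfolding bidegree_le_def by (auto intro: degree_diff_le)
  moreover have "eval2 (P - Q) = eval2 P - eval2 Q" by (simp add: fun_eq_iff eval2_diff)
  ultimately show ?thesis
    using X_minus_dvd_iff[of d1 d2 "P - Q" "\<alpha> + 1"] Y_minus_dvd_iff[of d1 d2 "P - Q" "\<beta> + 1"] \<alpha> \<beta>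
    unfolding smooth_across_def DX_def DY_def by (simp add: Suc_leI)
qed

text \<open>Smoothness is tested through jumps at generic points of the grid lines inside the domain
  rather than along edges; \<open>spl_iff\<close> shows that this is the same.\<close>

definition spl :: "(point set \<Rightarrow> point \<Rightarrow> real) \<Rightarrow> bool" where
  "spl p \<longleftrightarrow> (\<forall>F\<in>T. p F \<in> Pol d1 d2) \<and>
     (\<forall>x y. x \<notin> X \<longrightarrow> y \<in> Y \<longrightarrow> (x, y) \<in> interior (domain T) \<longrightarrow> hjump p x y \<in> DY y) \<and>
     (\<forall>x y. x \<in> X \<longrightarrow> y \<notin> Y \<longrightarrow> (x, y) \<in> interior (domain T) \<longrightarrow> vjump p x y \<in> DX x)"

lemma spl_iff:
  "spl p \<longleftrightarrow> (\<forall>F\<in>T. p F \<in> Pol d1 d2) \<and>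
     (\<forall>e'\<in>interior_edges T. \<forall>F\<in>T. \<forall>G\<in>T. e' \<subseteq> F \<and> e' \<subseteq> G \<longrightarrow>
       (\<forall>x. (\<forall>z\<in>e'. fst z = x) \<longrightarrow> p F - p G \<in> DX x) \<and>
       (\<forall>y. (\<forall>z\<in>e'. snd z = y) \<longrightarrow> p F - p G \<in> DY y))"
proof -
  note H = horizontal_smoothness_iff[of DY p, OF subspace_0[OF subspace_DY] subspace_neg[OF subspace_DY]]
  note V = vertical_smoothness_iff[of DX p, OF subspace_0[OF subspace_DX] subspace_neg[OF subspace_DX]]
  show ?thesis
  proof
    assume p: "spl p"
    note D = H[THEN iffD2] V[THEN iffD2]
    show "(\<forall>F\<in>T. p F \<in> Pol d1 d2) \<and>
     (\<forall>e'\<in>interior_edges T. \<forall>F\<in>T. \<forall>G\<in>T. e' \<subseteq> F \<and> e' \<subseteq> G \<longrightarrow>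
       (\<forall>x. (\<forall>z\<in>e'. fst z = x) \<longrightarrow> p F - p G \<in> DX x) \<and>
       (\<forall>y. (\<forall>z\<in>e'. snd z = y) \<longrightarrow> p F - p G \<in> DY y))"
      using p D unfolding spl_def by (simp only:) auto
  next
    assume R: "(\<forall>F\<in>T. p F \<in> Pol d1 d2) \<and>
     (\<forall>e'\<in>interior_edges T. \<forall>F\<in>T. \<forall>G\<in>T. e' \<subseteq> F \<and> e' \<subseteq> G \<longrightarrow>
       (\<forall>x. (\<forall>z\<in>e'. fst z = x) \<longrightarrow> p F - p G \<in> DX x) \<and>
       (\<forall>y. (\<forall>z\<in>e'. snd z = y) \<longrightarrow> p F - p G \<in> DY y))"
    then show "spl p" unfolding spl_def using H[THEN iffD1] V[THEN iffD1] by (intro conjI) simp_all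
  qed
qed

lemma spline_space_iff:
  "f \<in> spline_space d1 d2 \<alpha> \<beta> T \<longleftrightarrow>
    (\<forall>z. z \<notin> domain T \<longrightarrow> f z = 0) \<and> (\<exists>p. spl p \<and> (\<forall>F\<in>T. \<forall>z\<in>F. f z = p F z))"
proof
  assume f: "f \<in> spline_space d1 d2 \<alpha> \<beta> T"
  obtain P where P: "\<And>z. z \<notin> domain T \<Longrightarrow> f z = 0" "\<And>F. F \<in> T \<Longrightarrow> bidegree_le d1 d2 (P F)"
    "\<And>F z. F \<in> T \<Longrightarrow> z \<in> F \<Longrightarrow> f z = eval2 (P F) z"
    "\<And>e F G. e \<in> interior_edges T \<Longrightarrow> F \<in> T \<Longrightarrow> G \<in> T \<Longrightarrow> e \<subseteq> F \<Longrightarrow> e \<subseteq> G \<Longrightarrow> smooth_across \<alpha> \<beta> e (P F) (P G)"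
    by (rule spline_spaceE[OF f]) (rule that, (assumption | blast)+)
  have "spl (\<lambda>F. eval2 (P F))"
    unfolding spl_iff
  proof (intro conjI ballI impI)
    show "eval2 (P F) \<in> Pol d1 d2" if "F \<in> T" for F using PolI P(2) that by blast
    fix e' F G assume "e' \<in> interior_edges T" "F \<in> T" "G \<in> T" "e' \<subseteq> F \<and> e' \<subseteq> G"
    then have "smooth_across \<alpha> \<beta> e' (P F) (P G)" using P(4) by blast
    then show "\<forall>x. (\<forall>z\<in>e'. fst z = x) \<longrightarrow> eval2 (P F) - eval2 (P G) \<in> DX x"
      "\<forall>y. (\<forall>z\<in>e'. snd z = y) \<longrightarrow> eval2 (P F) - eval2 (P G) \<in> DY y"
      unfolding smooth_across_iff[OF P(2)[OF \<open>F \<in> T\<close>] P(2)[OF \<open>G \<in> T\<close>]] by blast+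
  qed
  then show "(\<forall>z. z \<notin> domain T \<longrightarrow> f z = 0) \<and> (\<exists>p. spl p \<and> (\<forall>F\<in>T. \<forall>z\<in>F. f z = p F z))"
    using P(1,3) by blast
next
  assume "(\<forall>z. z \<notin> domain T \<longrightarrow> f z = 0) \<and> (\<exists>p. spl p \<and> (\<forall>F\<in>T. \<forall>z\<in>F. f z = p F z))"
  then obtain p where p: "\<And>z. z \<notin> domain T \<Longrightarrow> f z = 0" "spl p" "\<And>F z. F \<in> T \<Longrightarrow> z \<in> F \<Longrightarrow> f z = p F z" by blast
  have "\<forall>F\<in>T. \<exists>P. bidegree_le d1 d2 P \<and> p F = eval2 P" using p(2) by (auto simp: spl_def Pol_def)
  then obtain P where P: "\<forall>F\<in>T. bidegree_le d1 d2 (P F) \<and> p F = eval2 (P F)" by (rule bchoice[THEN exE])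
  show "f \<in> spline_space d1 d2 \<alpha> \<beta> T"
  proof (rule spline_spaceI[where p = P])
    show "smooth_across \<alpha> \<beta> e' (P F) (P G)"
      if "e' \<in> interior_edges T" "F \<in> T" "G \<in> T" "e' \<subseteq> F" "e' \<subseteq> G" for e' F G
      using p(2) that P unfolding spl_iff by (subst smooth_across_iff) auto
  qed (use p P in auto)
qed

lemma splD:
  assumes "spl p"
  shows "F \<in> T \<Longrightarrow> p F \<in> Pol d1 d2"
    "x \<notin> X \<Longrightarrow> y \<in> Y \<Longrightarrow> (x, y) \<in> interior (domain T) \<Longrightarrow> hjump p x y \<in> DY y"
    "x \<in> X \<Longrightarrow> y \<notin> Y \<Longrightarrow> (x, y) \<in> interior (domain T) \<Longrightarrow> vjump p x y \<in> DX x"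
  using assms unfolding spl_def by blast+

text \<open>Regularity links all cells at z by steps across edges. Two cells that contain z and
  share a further point on a grid line meet only on that line, so it passes through z and the factor
  in their jump vanishes at z.\<close>

lemma spl_continuous:
  assumes p: "spl p" and F: "F \<in> T" "z \<in> F" and G: "G \<in> T" "z \<in> G"
  shows "p F z = p G z"
proof (rule locally_constant[OF regular _ _ F G])
  fix F G x y assume FG: "F \<in> T" "G \<in> T" "z \<in> F" "z \<in> G" "F \<noteq> G" "(x, y) \<in> F" "(x, y) \<in> G"
  show "p F z = p G z" if xy: "x \<notin> X" "y \<in> Y"
  proof -
    note c = contact[OF FG(1,6,2,7,5) xy]
    have "hjump p x y z = 0" by (rule DY_zero[OF splD(2)[OF p xy c(1)] c(3)[OF FG(3,4)]])
    then show ?thesis using c(2)[of p] by (metis eq_iff_diff_eq_0 fun_diff_def)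
  qed
  show "p F z = p G z" if xy: "x \<in> X" "y \<notin> Y"
  proof -
    note c = vertical_contact[OF FG(1,6,2,7,5) xy]
    have "vjump p x y z = 0" by (rule DX_zero[OF splD(3)[OF p xy c(1)] c(3)[OF FG(3,4)]])
    then show ?thesis using c(2)[of p] by (metis eq_iff_diff_eq_0 fun_diff_def)
  qed
qed

text \<open>The change that the cofactor w at the vertex v makes in the jumps along both lines
  through v.\<close>

definition bump :: "point \<Rightarrow> (point \<Rightarrow> real) \<Rightarrow> point \<Rightarrow> real" where
  "bump v w = (\<lambda>z. (fst z - fst v) ^ (\<alpha> + 1) * ((snd z - snd v) ^ (\<beta> + 1) * w z))"

text \<open>The mixed jump is a difference of horizontal jumps and also of vertical jumps, so it is
  divisible by both powers and, these being coprime, by their product.\<close>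

lemma mjump_bump:
  assumes p: "spl p" and x: "x \<in> X" and y: "y \<in> Y" and int: "(x, y) \<in> interior (domain T)"
  shows "\<exists>w\<in>Pol (d1 - (\<alpha> + 1)) (d2 - (\<beta> + 1)). mjump p x y = bump (x, y) w"
proof -
  have "mjump p x y \<in> DY y"
    unfolding mjump_def using splD(2)[OF p] X.shift_notin[OF x] y interior_shift[OF x y int]
    by (intro subspace_diff[OF subspace_DY]) auto
  then obtain h where h: "h \<in> Pol d1 (d2 - (\<beta> + 1))" "mjump p x y = (\<lambda>z. (snd z - y) ^ (\<beta> + 1) * h z)"
    unfolding DY_def by blast
  have "mjump p x y \<in> DX x"
    unfolding mjump_eq using splD(3)[OF p] Y.shift_notin[OF y] x vertical_interior_shift[OF x y int]
    by (intro subspace_diff[OF subspace_DX]) auto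
  then obtain g where g: "g \<in> Pol (d1 - (\<alpha> + 1)) d2" "mjump p x y = (\<lambda>z. (fst z - x) ^ (\<alpha> + 1) * g z)"
    unfolding DX_def by blast
  have "\<exists>w\<in>Pol (d1 - (\<alpha> + 1)) (d2 - (\<beta> + 1)). g = (\<lambda>z. (snd z - y) ^ (\<beta> + 1) * w z)"
    by (rule Pol_common_factor[OF g(1) h(1), of _ x "\<alpha> + 1"]) (use \<beta> g(2) h(2) in auto)
  then show ?thesis using g(2) by (auto simp: bump_def)
qed

lemma bump_add: "bump v (f + g) = bump v f + bump v g"
  and bump_scale: "bump v (c *\<^sub>R f) = c *\<^sub>R bump v f"
  and bump_0: "bump v 0 = 0"
  by (auto simp: bump_def fun_eq_iff algebra_simps)

lemma bump_DX: "w \<in> Pol (d1 - (\<alpha> + 1)) (d2 - (\<beta> + 1)) \<Longrightarrow> bump (x, y) w \<in> DX x"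
  and bump_DY: "w \<in> Pol (d1 - (\<alpha> + 1)) (d2 - (\<beta> + 1)) \<Longrightarrow> bump (x, y) w \<in> DY y"
proof -
  assume w: "w \<in> Pol (d1 - (\<alpha> + 1)) (d2 - (\<beta> + 1))"
  have "(\<lambda>z. (snd z - y) ^ (\<beta> + 1) * w z) \<in> Pol (d1 - (\<alpha> + 1)) d2"
    using Pol_Y_times[OF w, of y "\<beta> + 1"] \<beta> by simp
  then show "bump (x, y) w \<in> DX x" unfolding DX_def bump_def by auto
  have "(\<lambda>z. (fst z - x) ^ (\<alpha> + 1) * w z) \<in> Pol d1 (d2 - (\<beta> + 1))"
    using Pol_X_times[OF w, of x "\<alpha> + 1"] \<alpha> by simp
  then show "bump (x, y) w \<in> DY y" unfolding DY_def bump_def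
    by (intro CollectI bexI[of _ "\<lambda>z. (fst z - x) ^ (\<alpha> + 1) * w z"]) (auto simp: mult_ac)
qed

lemma bump_eq_0:
  assumes "w \<in> Pol m n" "bump v w = 0" shows "w = 0"
  by (rule Pol_cancel[OF assms(1), of "fst v" "\<alpha> + 1" "snd v" "\<beta> + 1"])
    (use fun_cong[OF assms(2)] in \<open>simp only: bump_def mult.assoc zero_fun_apply\<close>)

section \<open>The conditions along interior l-edges\<close>

text \<open>\<open>tsp (Cut s)\<close> is also formed for interior l-edges s: the condition on s
  takes its values there. This puts the differences of the two counts into the dimension
  formula.\<close>

definition tsp :: "tag \<Rightarrow> (point \<Rightarrow> real) set" where
  "tsp t = (case t of Base \<Rightarrow> Pol d1 d2
     | Cut s \<Rightarrow> (if horizontal s then Pol d1 (d2 - (\<beta> + 1)) else Pol (d1 - (\<alpha> + 1)) d2)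
     | Vtx v \<Rightarrow> Pol (d1 - (\<alpha> + 1)) (d2 - (\<beta> + 1)))"

definition tags :: "tag set" where
  "tags = insert Base (Cut ` cross_cuts T \<union> Vtx ` interior_vertices T)"

definition data :: "(tag \<Rightarrow> point \<Rightarrow> real) set" where
  "data = pfuns tags tsp"

text \<open>What remains of the factor of a bump when the power shared by all vertices of s is
  divided out.\<close>

definition fac :: "point set \<Rightarrow> point \<Rightarrow> point \<Rightarrow> real" where
  "fac s v z = (if horizontal s then (fst z - fst v) ^ (\<alpha> + 1) else (snd z - snd v) ^ (\<beta> + 1))"

text \<open>The total change of the jump along s, divided by the power that belongs to the line of
  s; its vanishing is the balance condition.\<close>

definition psi :: "(tag \<Rightarrow> point \<Rightarrow> real) \<Rightarrow> point set \<Rightarrow> point \<Rightarrow> real" where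
  "psi u s = (if s \<in> interior_l_edges T then (\<lambda>z. \<Sum>v\<in>vertices T \<inter> s. fac s v z * u (Vtx v) z) else 0)"

lemma subspace_tsp: "subspace (tsp t)"
  by (cases t) (simp_all add: tsp_def subspace_Pol)

lemma tsp_finite_span: "\<exists>S. finite S \<and> tsp t \<subseteq> span S"
  by (cases t) (simp_all add: tsp_def Pol_finite_span)

lemma finite_interior_l_edges: "finite (interior_l_edges T)" and finite_cross_cuts: "finite (cross_cuts T)"
  using finite_l_edges by (simp_all add: interior_l_edges_def cross_cuts_def)

lemma finite_interior_vertices: "finite (interior_vertices T)"
  using finite_vertices by (simp add: interior_vertices_def)

lemma finite_tags: "finite tags"
  by (simp add: tags_def finite_cross_cuts finite_interior_vertices)

lemma subspace_data: "subspace data"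
  unfolding data_def by (rule subspace_pfuns) (rule subspace_tsp)

lemma data_finite_span: "\<exists>S. finite S \<and> data \<subseteq> span S"
  unfolding data_def by (rule pfuns_finite_span[OF finite_tags tsp_finite_span])

lemma data_Vtx: "u \<in> data \<Longrightarrow> u (Vtx v) \<in> Pol (d1 - (\<alpha> + 1)) (d2 - (\<beta> + 1))"
proof (cases "v \<in> interior_vertices T")
  case True
  assume "u \<in> data"
  then show ?thesis using pfuns_mem[of u tags tsp "Vtx v"] True by (simp add: data_def tags_def tsp_def)
next
  case False
  assume "u \<in> data"
  then have "u (Vtx v) = 0" using pfuns_outside[of u tags tsp "Vtx v"] False by (auto simp: data_def tags_def)
  then show ?thesis using subspace_0[OF subspace_Pol] by simp
qed

lemma linear_psi: "linear psi"
  by (rule linearI) (auto simp: psi_def fun_eq_iff sum.distrib algebra_simps sum_distrib_left)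

lemma fac_Pol:
  assumes "w \<in> Pol (d1 - (\<alpha> + 1)) (d2 - (\<beta> + 1))"
  shows "(\<lambda>z. fac s v z * w z) \<in> tsp (Cut s)"
proof (cases "horizontal s")
  case True
  then show ?thesis using Pol_X_times[OF assms, of "fst v" "\<alpha> + 1"] \<alpha> by (simp add: fac_def tsp_def)
next
  case False
  then show ?thesis using Pol_Y_times[OF assms, of "snd v" "\<beta> + 1"] \<beta> by (simp add: fac_def tsp_def)
qed

lemma psi_mem: "u \<in> data \<Longrightarrow> psi u \<in> pfuns (interior_l_edges T) (\<lambda>s. tsp (Cut s))"
proof (rule pfunsI)
  fix s assume u: "u \<in> data" and s: "s \<in> interior_l_edges T"
  have "psi u s = (\<Sum>v\<in>vertices T \<inter> s. (\<lambda>z. fac s v z * u (Vtx v) z))"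
    using s by (simp add: psi_def fun_eq_iff sum_fun_apply)
  also have "\<dots> \<in> tsp (Cut s)"
    by (intro subspace_sum[OF subspace_tsp] fac_Pol data_Vtx u)
  finally show "psi u s \<in> tsp (Cut s)" .
qed (simp add: psi_def)

text \<open>Vertices on a horizontal l-edge have distinct abscissas, on a vertical one distinct
  ordinates, so they serve as centres of the shifted powers, and the threshold makes these powers
  generate the whole space.\<close>

lemma solve_on_new_vertices:
  assumes s: "s \<in> interior_l_edges T" and N: "N \<subseteq> vertices T \<inter> s" and r: "r \<in> tsp (Cut s)"
    and h: "horizontal s \<Longrightarrow> min_vertices d1 \<alpha> \<le> int (card N)"
    and v: "vertical s \<Longrightarrow> min_vertices d2 \<beta> \<le> int (card N)"
  shows "\<exists>g. (\<forall>v. g v \<in> Pol (d1 - (\<alpha> + 1)) (d2 - (\<beta> + 1))) \<and> r = (\<lambda>z. \<Sum>v\<in>N. fac s v z * g v z)"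
proof -
  have finN: "finite N" using N finite_vertices finite_subset by blast
  have "s \<in> l_edges T" using s by (simp add: interior_l_edges_def)
  then show ?thesis
  proof (cases rule: l_edge_cases)
    case (horizontal a b y)
    have "inj_on fst N" using N horizontal(2) by (auto simp: inj_on_def)
    moreover have "d1 + 1 \<le> card N * (d1 - \<alpha>)" using min_vertices_le[OF \<alpha> h] horizontal(3) by simp
    moreover have "r \<in> Pol d1 (d2 - (\<beta> + 1))" using r horizontal(3) by (simp add: tsp_def)
    ultimately obtain g where "\<forall>v. g v \<in> Pol (d1 - \<alpha> - 1) (d2 - (\<beta> + 1))"
      "r = (\<lambda>z. \<Sum>v\<in>N. (fst z - fst v) ^ (d1 + 1 - (d1 - \<alpha>)) * g v z)"
      using Pol_as_shifted_powers_x[OF finN, of d1 "d1 - \<alpha>" r "d2 - (\<beta> + 1)"] by auto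
    moreover have "d1 + 1 - (d1 - \<alpha>) = \<alpha> + 1" "d1 - \<alpha> - 1 = d1 - (\<alpha> + 1)" using \<alpha> by simp_all
    ultimately show ?thesis using horizontal(3) unfolding fac_def by (intro exI[of _ g]) simp
  next
    case (vertical a b x)
    have "inj_on snd N" using N vertical(2) by (auto simp: inj_on_def)
    moreover have "d2 + 1 \<le> card N * (d2 - \<beta>)" using min_vertices_le[OF \<beta> v] vertical(3) by simp
    moreover have "r \<in> Pol (d1 - (\<alpha> + 1)) d2" using r vertical(4) by (simp add: tsp_def)
    ultimately obtain g where "\<forall>v. g v \<in> Pol (d1 - (\<alpha> + 1)) (d2 - \<beta> - 1)"
      "r = (\<lambda>z. \<Sum>v\<in>N. (snd z - snd v) ^ (d2 + 1 - (d2 - \<beta>)) * g v z)"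
      using Pol_as_shifted_powers_y[OF finN, of d2 "d2 - \<beta>" r "d1 - (\<alpha> + 1)"] by auto
    moreover have "d2 + 1 - (d2 - \<beta>) = \<beta> + 1" "d2 - \<beta> - 1 = d2 - (\<beta> + 1)" using \<beta> by simp_all
    ultimately show ?thesis using vertical(4) unfolding fac_def by (intro exI[of _ g]) simp
  qed
qed

text \<open>Along the ordering of a diagonalizable mesh the system is block triangular: the condition on
  an l-edge is solved with its new vertices, which do not occur in the conditions treated before.\<close>

lemma psi_surjective:
  assumes diag: "diagonalizable d1 d2 \<alpha> \<beta> T"
  shows "psi ` data = pfuns (interior_l_edges T) (\<lambda>s. tsp (Cut s))"
proof
  show "psi ` data \<subseteq> pfuns (interior_l_edges T) (\<lambda>s. tsp (Cut s))" using psi_mem by blast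
  obtain es where es: "distinct es" "set es = interior_l_edges T"
    "\<And>j. j < length es \<Longrightarrow> horizontal (es ! j) \<Longrightarrow> min_vertices d1 \<alpha> \<le> int (new_vertex_vector T es j)"
    "\<And>j. j < length es \<Longrightarrow> vertical (es ! j) \<Longrightarrow> min_vertices d2 \<beta> \<le> int (new_vertex_vector T es j)"
    using diag unfolding diagonalizable_def by blast
  show "pfuns (interior_l_edges T) (\<lambda>s. tsp (Cut s)) \<subseteq> psi ` data"
  proof
    fix w assume w: "w \<in> pfuns (interior_l_edges T) (\<lambda>s. tsp (Cut s))"
    have "\<exists>u\<in>data. \<forall>j<k. psi u (es ! j) = w (es ! j)" if "k \<le> length es" for k
      using that
    proof (induction k)
      case 0
      show ?case using subspace_0[OF subspace_data] by auto
    next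
      case (Suc k)
      then obtain u where u: "u \<in> data" "\<And>j. j < k \<Longrightarrow> psi u (es ! j) = w (es ! j)" by auto
      have k: "k < length es" using Suc(2) by simp
      define s where "s = es ! k"
      have s: "s \<in> interior_l_edges T" using es(2) k unfolding s_def by (metis nth_mem)
      define N where "N = {v \<in> vertices T. v \<in> es ! k \<and> (\<forall>i<k. v \<notin> es ! i)}"
      have N: "N \<subseteq> vertices T \<inter> s" by (auto simp: N_def s_def)
      have "w s - psi u s \<in> tsp (Cut s)"
        using pfuns_mem[OF w s] pfuns_mem[OF psi_mem[OF u(1)] s] by (intro subspace_diff[OF subspace_tsp])
      then obtain g where g: "\<And>v. g v \<in> Pol (d1 - (\<alpha> + 1)) (d2 - (\<beta> + 1))"
        "w s - psi u s = (\<lambda>z. \<Sum>v\<in>N. fac s v z * g v z)"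
        using solve_on_new_vertices[OF s N] es(3,4)[OF k] unfolding new_vertex_vector_def N_def s_def by blast
      \<comment> \<open>The correction lives on the new vertices of \<open>s\<close> alone, so the
        conditions solved before keep their values.\<close>
      define u' where "u' t = (case t of Vtx v \<Rightarrow> if v \<in> N then g v else 0 | _ \<Rightarrow> 0)" for t
      have Nint: "v \<in> interior_vertices T" if "v \<in> N" for v
        using interior_l_edge_vertices[OF s, of v] N that by blast
      have u': "u' \<in> data"
        unfolding data_def
      proof (rule pfunsI)
        show "u' t \<in> tsp t" if "t \<in> tags" for t
          using g(1) subspace_0[OF subspace_tsp, of t] by (cases t) (auto simp: u'_def tsp_def)
        show "u' t = 0" if "t \<notin> tags" for t
          using that Nint by (cases t) (auto simp: u'_def tags_def)
      qed
      have psi': "psi u' s' = (\<lambda>z. \<Sum>v\<in>N \<inter> s'. fac s' v z * g v z)" if s': "s' \<in> interior_l_edges T" for s'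
      proof
        fix z
        have "psi u' s' z = (\<Sum>v\<in>vertices T \<inter> s'. if v \<in> N then fac s' v z * g v z else 0)"
          using s' by (auto simp: psi_def u'_def intro!: sum.cong)
        also have "\<dots> = (\<Sum>v\<in>N \<inter> s'. fac s' v z * g v z)"
          using N finite_vertices by (intro sum.mono_neutral_cong_right) auto
        finally show "psi u' s' z = (\<Sum>v\<in>N \<inter> s'. fac s' v z * g v z)" .
      qed
      have "psi (u + u') (es ! j) = w (es ! j)" if j: "j < Suc k" for j
      proof (cases "j = k")
        case True
        have "N \<inter> s = N" using N by blast
        then have "psi u' s = w s - psi u s" using psi'[OF s] g(2) by simp
        then show ?thesis using True by (simp add: linear_add[OF linear_psi] s_def)
      next
        case False
        then have "j < k" using j by simp
        then have "N \<inter> es ! j = {}" by (auto simp: N_def)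
        moreover have "es ! j \<in> interior_l_edges T" using es(2) \<open>j < k\<close> k by (metis less_trans nth_mem)
        ultimately have "psi u' (es ! j) = 0" using psi'[of "es ! j"] by (simp add: fun_eq_iff)
        then show ?thesis using u(2)[OF \<open>j < k\<close>] by (simp add: linear_add[OF linear_psi])
      qed
      then show ?case using subspace_add[OF subspace_data u(1) u'] by blast
    qed
    then obtain u where u: "u \<in> data" "\<And>j. j < length es \<Longrightarrow> psi u (es ! j) = w (es ! j)" by blast
    have "psi u s = w s" for s
    proof (cases "s \<in> interior_l_edges T")
      case True
      then show ?thesis using u(2) es(2) by (metis in_set_conv_nth)
    next
      case False
      then show ?thesis using pfuns_outside[OF w] by (simp add: psi_def)
    qed
    then have "w = psi u" by (simp add: fun_eq_iff)
    then show "w \<in> psi ` data" using u(1) by blast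
  qed
qed

definition vbump :: "(tag \<Rightarrow> point \<Rightarrow> real) \<Rightarrow> point \<Rightarrow> point \<Rightarrow> real" where
  "vbump u v = (if v \<in> interior_vertices T then bump v (u (Vtx v)) else 0)"

text \<open>The vertices of the l-edge have the same ordinate, so the power in y factors out of the
  sum; grid abscissas that are not vertices contribute zero.\<close>

lemma vbump_sum_horizontal:
  assumes r: "hrun a b y" and iv: "(a, y) \<in> interior_vertices T" "(b, y) \<in> interior_vertices T"
  shows "(\<Sum>x | x \<in> X \<and> a \<le> x \<and> x \<le> b. vbump u (x, y)) =
    (\<lambda>z. (snd z - y) ^ (\<beta> + 1) * psi u ({a..b} \<times> {y}) z)"
proof
  fix z
  let ?s = "{a..b} \<times> {y}"
  let ?S = "{x. x \<in> X \<and> a \<le> x \<and> x \<le> b}" and ?I = "{x. (x, y) \<in> interior_vertices T \<and> a \<le> x \<and> x \<le> b}"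
  have s: "?s \<in> interior_l_edges T" using hrun_interior_iff(1)[OF r] iv by simp
  have V: "vertices T \<inter> ?s = (\<lambda>x. (x, y)) ` ?I"
    using interior_l_edge_vertices[OF s] by (auto simp: interior_vertices_def)
  have "(\<Sum>x\<in>?S. vbump u (x, y)) z = (\<Sum>x\<in>?S. vbump u (x, y) z)" by (rule sum_fun_apply)
  also have "\<dots> = (\<Sum>x\<in>?I. (fst z - x) ^ (\<alpha> + 1) * ((snd z - y) ^ (\<beta> + 1) * u (Vtx (x, y)) z))"
  proof (rule sum.mono_neutral_cong_right)
    show "?I \<subseteq> ?S" using vertices_fst by (auto simp: interior_vertices_def)
  qed (use X.fin in \<open>auto simp: vbump_def bump_def\<close>)
  also have "\<dots> = (snd z - y) ^ (\<beta> + 1) * (\<Sum>x\<in>?I. (fst z - x) ^ (\<alpha> + 1) * u (Vtx (x, y)) z)"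
    by (simp add: sum_distrib_left mult_ac)
  also have "(\<Sum>x\<in>?I. (fst z - x) ^ (\<alpha> + 1) * u (Vtx (x, y)) z) = psi u ?s z"
    using s by (simp add: psi_def V fac_def sum.reindex inj_on_def)
  finally show "(\<Sum>x\<in>?S. vbump u (x, y)) z = (snd z - y) ^ (\<beta> + 1) * psi u ?s z" .
qed

lemma vbump_sum_vertical:
  assumes r: "vrun a b x" and iv: "(x, a) \<in> interior_vertices T" "(x, b) \<in> interior_vertices T"
  shows "(\<Sum>y | y \<in> Y \<and> a \<le> y \<and> y \<le> b. vbump u (x, y)) =
    (\<lambda>z. (fst z - x) ^ (\<alpha> + 1) * psi u ({x} \<times> {a..b}) z)"
proof
  fix z
  let ?s = "{x} \<times> {a..b}"
  let ?S = "{y. y \<in> Y \<and> a \<le> y \<and> y \<le> b}" and ?I = "{y. (x, y) \<in> interior_vertices T \<and> a \<le> y \<and> y \<le> b}"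
  have s: "?s \<in> interior_l_edges T" using vrun_interior_iff(1)[OF r] iv by simp
  have "\<not> vertical ({a..b} \<times> {x})" by (rule not_vertical_interval[OF vrunD(1)[OF r]])
  then have nh: "\<not> horizontal ?s" by (metis vertical_swap swap_Times)
  have V: "vertices T \<inter> ?s = Pair x ` ?I"
    using interior_l_edge_vertices[OF s] by (auto simp: interior_vertices_def)
  have "(\<Sum>y\<in>?S. vbump u (x, y)) z = (\<Sum>y\<in>?S. vbump u (x, y) z)" by (rule sum_fun_apply)
  also have "\<dots> = (\<Sum>y\<in>?I. (fst z - x) ^ (\<alpha> + 1) * ((snd z - y) ^ (\<beta> + 1) * u (Vtx (x, y)) z))"
  proof (rule sum.mono_neutral_cong_right)
    show "?I \<subseteq> ?S" using vertices_snd by (auto simp: interior_vertices_def)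
  qed (use Y.fin in \<open>auto simp: vbump_def bump_def\<close>)
  also have "\<dots> = (fst z - x) ^ (\<alpha> + 1) * (\<Sum>y\<in>?I. (snd z - y) ^ (\<beta> + 1) * u (Vtx (x, y)) z)"
    by (simp add: sum_distrib_left mult_ac)
  also have "(\<Sum>y\<in>?I. (snd z - y) ^ (\<beta> + 1) * u (Vtx (x, y)) z) = psi u ?s z"
    using s nh by (simp add: psi_def V fac_def sum.reindex inj_on_def)
  finally show "(\<Sum>y\<in>?S. vbump u (x, y)) z = (fst z - x) ^ (\<alpha> + 1) * psi u ?s z" .
qed

end

section \<open>Splines and smoothing cofactors\<close>

context mesh begin

lemma cellv_scaleR: "cellv (\<lambda>F. c *\<^sub>R p F) x y = c *\<^sub>R cellv p x y" for p :: "_ \<Rightarrow> 'a::real_vector"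
  by (simp add: cellv_def)

lemma jumps_add:
  "hjump (\<lambda>F. p F + q F) x y = hjump p x y + hjump q x y"
  "vjump (\<lambda>F. p F + q F) x y = vjump p x y + vjump q x y"
  "mjump (\<lambda>F. p F + q F) x y = mjump p x y + mjump q x y"
  by (simp_all add: hjump_def vjump_def mjump_def cellv_add algebra_simps)

lemma jumps_scaleR:
  fixes p :: "_ \<Rightarrow> 'a::real_vector"
  shows "hjump (\<lambda>F. c *\<^sub>R p F) x y = c *\<^sub>R hjump p x y"
  "vjump (\<lambda>F. c *\<^sub>R p F) x y = c *\<^sub>R vjump p x y"
  "mjump (\<lambda>F. c *\<^sub>R p F) x y = c *\<^sub>R mjump p x y"
  by (simp_all add: hjump_def vjump_def mjump_def cellv_scaleR scaleR_diff_right)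

lemma not_act_interior: "F \<in> T \<Longrightarrow> z \<in> interior F \<Longrightarrow> \<not> act z"
proof
  assume F: "F \<in> T" "z \<in> interior F" and "act z"
  then obtain G where G: "G \<in> T" "z \<in> frontier G" by (auto simp: act_def)
  then have "z \<in> G" using cell_closed by (auto simp: frontier_def)
  then have "F = G" using cell_disjoint[OF F(1) G(1) F(2)] by simp
  then show False using F(2) G(2) by (simp add: frontier_def)
qed

lemma interior_domain_vertical_edge:
  assumes "x \<in> X" "y \<notin> Y" "(x, y) \<in> interior (domain T)"
  shows "(x + e, y) \<in> domain T" "(x - e, y) \<in> domain T"
  using assms by (auto simp: interior_domain_iff X.off_def Y.off_def)

text \<open>No point inside a cell is active, so the potential does not change across grid lines
  there; every generic point is joined to the one next to the lower left corner by a vertical and a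
  horizontal step.\<close>

lemma potential_constant_on_cell:
  fixes Q :: "real \<Rightarrow> real \<Rightarrow> 'a::ab_group_add"
  assumes gap: "\<And>x x' y y'. X.gap x x' \<Longrightarrow> Y.gap y y' \<Longrightarrow> Q x y = Q x' y'"
    and QH: "\<And>x y. x \<notin> X \<Longrightarrow> y \<in> Y \<Longrightarrow> (x, y) \<in> interior (domain T) \<Longrightarrow> \<not> act (x, y) \<Longrightarrow> Q x (y + e) = Q x (y - e)"
    and QV: "\<And>x y. x \<in> X \<Longrightarrow> y \<notin> Y \<Longrightarrow> (x, y) \<in> interior (domain T) \<Longrightarrow> \<not> act (x, y) \<Longrightarrow> Q (x + e) y = Q (x - e) y"
    and F: "F \<in> T"
  shows "\<exists>c. \<forall>x y. x \<notin> X \<longrightarrow> y \<notin> Y \<longrightarrow> (x, y) \<in> F \<longrightarrow> Q x y = c"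
proof -
  obtain a b c d where f: "a < b" "c < d" "F = {a..b} \<times> {c..d}" "a \<in> X" "b \<in> X" "c \<in> Y" "d \<in> Y"
    using F by (rule rectE)
  have int: "(s, t) \<in> interior (domain T)" "\<not> act (s, t)" if "a < s" "s < b" "c < t" "t < d" for s t
  proof -
    have i: "(s, t) \<in> interior F" using that by (simp add: f(3) interior_Times)
    then show "(s, t) \<in> interior (domain T)" using interior_mono[OF cell_subset[OF F]] by blast
    show "\<not> act (s, t)" using not_act_interior[OF F i] .
  qed
  have x_le: "Q x' y = Q x y" if "x \<notin> X" "x' \<notin> X" "y \<notin> Y" "x \<le> x'" "(x, y) \<in> F" "(x', y) \<in> F" for x x' y
  proof -
    have "c < y" "y < d" using that f(3,6,7) by (auto simp: less_le)
    then have "Q (z + e) y - Q (z - e) y = 0" if "z \<in> X" "x < z" "z < x'" for z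
      using QV[OF that(1) \<open>y \<notin> Y\<close>] int[of z y] that f(3) \<open>(x, y) \<in> F\<close> \<open>(x', y) \<in> F\<close> by auto
    then show ?thesis
      using X.sum_jumps[of "\<lambda>t. Q t y" x x', OF gap[OF _ Y.gap_refl[OF that(3)]] that(1,2,4)] by simp
  qed
  have y_le: "Q x y' = Q x y" if "x \<notin> X" "y \<notin> Y" "y' \<notin> Y" "y \<le> y'" "(x, y) \<in> F" "(x, y') \<in> F" for x y y'
  proof -
    have "a < x" "x < b" using that f(3,4,5) by (auto simp: less_le)
    then have "Q x (z + e) - Q x (z - e) = 0" if "z \<in> Y" "y < z" "z < y'" for z
      using QH[OF \<open>x \<notin> X\<close> that(1)] int[of x z] that f(3) \<open>(x, y) \<in> F\<close> \<open>(x, y') \<in> F\<close> by auto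
    then show ?thesis
      using Y.sum_jumps[of "\<lambda>t. Q x t" y y', OF gap[OF X.gap_refl[OF that(1)]] that(2,3,4)] by simp
  qed
  have p: "a + e \<notin> X" "c + e \<notin> Y" "(a + e, c + e) \<in> F"
    using X.shift_notin f Y.shift_notin X.right_of(3)[OF f(4,5)] Y.right_of(3)[OF f(6,7)] X.e by auto
  show ?thesis
  proof (intro exI allI impI)
    fix x y assume xy: "x \<notin> X" "y \<notin> Y" "(x, y) \<in> F"
    have "(x, c + e) \<in> F" using cell_product[OF F xy(3) p(3)] .
    then have "Q x y = Q x (c + e)"
      using y_le[OF xy(1,2) p(2)] y_le[OF xy(1) p(2) xy(2)] xy(3) by (cases "y \<le> c + e") auto
    also have "\<dots> = Q (a + e) (c + e)"
      using x_le[OF xy(1) p(1,2)] x_le[OF p(1) xy(1) p(2)] p(3) \<open>(x, c + e) \<in> F\<close> by (cases "x \<le> a + e") auto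
    finally show "Q x y = Q (a + e) (c + e)" .
  qed
qed

end

context spline_mesh begin

section \<open>Coordinates of a spline\<close>

definition F0 where "F0 = (SOME F. F \<in> T)"

lemma F0: "F0 \<in> T"
proof -
  have "T \<noteq> {}" using tmesh by (simp add: tmesh_def)
  then show ?thesis unfolding F0_def by (meson ex_in_conv someI_ex)
qed

definition coef :: "(point set \<Rightarrow> point \<Rightarrow> real) \<Rightarrow> (tag \<Rightarrow> point \<Rightarrow> real) \<Rightarrow> bool" where
  "coef p u \<longleftrightarrow> p F0 = u Base \<and>
     (\<forall>x y. (x, y) \<in> interior_vertices T \<longrightarrow> mjump p x y = bump (x, y) (u (Vtx (x, y)))) \<and>
     (\<forall>a b y. hrun a b y \<longrightarrow> {a..b} \<times> {y} \<in> cross_cuts T \<longrightarrow>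
        hjump p (a + e) y = (\<lambda>z. (snd z - y) ^ (\<beta> + 1) * u (Cut ({a..b} \<times> {y})) z)) \<and>
     (\<forall>a b x. vrun a b x \<longrightarrow> {x} \<times> {a..b} \<in> cross_cuts T \<longrightarrow>
        vjump p x (a + e) = (\<lambda>z. (fst z - x) ^ (\<alpha> + 1) * u (Cut ({x} \<times> {a..b})) z))"

lemma coefD:
  assumes "coef p u"
  shows "p F0 = u Base"
    "(x, y) \<in> interior_vertices T \<Longrightarrow> mjump p x y = bump (x, y) (u (Vtx (x, y)))"
    "hrun a b y \<Longrightarrow> {a..b} \<times> {y} \<in> cross_cuts T \<Longrightarrow>
       hjump p (a + e) y = (\<lambda>z. (snd z - y) ^ (\<beta> + 1) * u (Cut ({a..b} \<times> {y})) z)"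
    "vrun a b x \<Longrightarrow> {x} \<times> {a..b} \<in> cross_cuts T \<Longrightarrow>
       vjump p x (a + e) = (\<lambda>z. (fst z - x) ^ (\<alpha> + 1) * u (Cut ({x} \<times> {a..b})) z)"
  using assms unfolding coef_def by blast+

lemma coefI:
  assumes "p F0 = u Base"
    "\<And>x y. (x, y) \<in> interior_vertices T \<Longrightarrow> mjump p x y = bump (x, y) (u (Vtx (x, y)))"
    "\<And>a b y. hrun a b y \<Longrightarrow> {a..b} \<times> {y} \<in> cross_cuts T \<Longrightarrow>
       hjump p (a + e) y = (\<lambda>z. (snd z - y) ^ (\<beta> + 1) * u (Cut ({a..b} \<times> {y})) z)"
    "\<And>a b x. vrun a b x \<Longrightarrow> {x} \<times> {a..b} \<in> cross_cuts T \<Longrightarrow>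
       vjump p x (a + e) = (\<lambda>z. (fst z - x) ^ (\<alpha> + 1) * u (Cut ({x} \<times> {a..b})) z)"
  shows "coef p u"
  unfolding coef_def by (intro conjI allI impI) (fact assms)+

text \<open>The linear relation for \<open>dim_linear_relation\<close>, between splines and the
  kernel of \<open>psi\<close>.\<close>

definition rel :: "(point \<Rightarrow> real) \<Rightarrow> (tag \<Rightarrow> point \<Rightarrow> real) \<Rightarrow> bool" where
  "rel f u \<longleftrightarrow> u \<in> data \<and> psi u = 0 \<and> (\<forall>z. z \<notin> domain T \<longrightarrow> f z = 0) \<and>
     (\<exists>p. spl p \<and> (\<forall>F\<in>T. \<forall>z\<in>F. f z = p F z) \<and> coef p u)"

lemma spl_add: "spl p \<Longrightarrow> spl q \<Longrightarrow> spl (\<lambda>F. p F + q F)"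
  and spl_scale: "spl p \<Longrightarrow> spl (\<lambda>F. c *\<^sub>R p F)"
  unfolding spl_def jumps_add jumps_scaleR
  by (auto intro: subspace_add subspace_scale subspace_Pol subspace_DX subspace_DY)

lemma coef_add:
  assumes p: "coef p u" and q: "coef q v" shows "coef (\<lambda>F. p F + q F) (u + v)"
proof (rule coefI)
  show "p F0 + q F0 = (u + v) Base" using coefD(1)[OF p] coefD(1)[OF q] by simp
next
  fix x y assume "(x, y) \<in> interior_vertices T"
  then show "mjump (\<lambda>F. p F + q F) x y = bump (x, y) ((u + v) (Vtx (x, y)))"
    using coefD(2)[OF p] coefD(2)[OF q] by (simp add: jumps_add bump_add)
next
  fix a b y assume "hrun a b y" "{a..b} \<times> {y} \<in> cross_cuts T"
  then show "hjump (\<lambda>F. p F + q F) (a + e) y = (\<lambda>z. (snd z - y) ^ (\<beta> + 1) * (u + v) (Cut ({a..b} \<times> {y})) z)"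
    using coefD(3)[OF p] coefD(3)[OF q] by (simp add: jumps_add fun_eq_iff distrib_left)
next
  fix a b x assume "vrun a b x" "{x} \<times> {a..b} \<in> cross_cuts T"
  then show "vjump (\<lambda>F. p F + q F) x (a + e) = (\<lambda>z. (fst z - x) ^ (\<alpha> + 1) * (u + v) (Cut ({x} \<times> {a..b})) z)"
    using coefD(4)[OF p] coefD(4)[OF q] by (simp add: jumps_add fun_eq_iff distrib_left)
qed

lemma coef_scale:
  assumes p: "coef p u" shows "coef (\<lambda>F. c *\<^sub>R p F) (c *\<^sub>R u)"
proof (rule coefI)
  show "c *\<^sub>R p F0 = (c *\<^sub>R u) Base" using coefD(1)[OF p] by simp
next
  fix x y assume "(x, y) \<in> interior_vertices T"
  then show "mjump (\<lambda>F. c *\<^sub>R p F) x y = bump (x, y) ((c *\<^sub>R u) (Vtx (x, y)))"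
    using coefD(2)[OF p] by (simp add: jumps_scaleR bump_scale)
next
  fix a b y assume "hrun a b y" "{a..b} \<times> {y} \<in> cross_cuts T"
  then show "hjump (\<lambda>F. c *\<^sub>R p F) (a + e) y = (\<lambda>z. (snd z - y) ^ (\<beta> + 1) * (c *\<^sub>R u) (Cut ({a..b} \<times> {y})) z)"
    using coefD(3)[OF p] by (simp add: jumps_scaleR fun_eq_iff)
next
  fix a b x assume "vrun a b x" "{x} \<times> {a..b} \<in> cross_cuts T"
  then show "vjump (\<lambda>F. c *\<^sub>R p F) x (a + e) = (\<lambda>z. (fst z - x) ^ (\<alpha> + 1) * (c *\<^sub>R u) (Cut ({x} \<times> {a..b})) z)"
    using coefD(4)[OF p] by (simp add: jumps_scaleR fun_eq_iff)
qed

lemma rel_add: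
  assumes "rel f u" "rel g v" shows "rel (f + g) (u + v)"
proof -
  obtain p where p: "spl p" "\<forall>F\<in>T. \<forall>z\<in>F. f z = p F z" "coef p u" using assms(1) unfolding rel_def by blast
  obtain q where q: "spl q" "\<forall>F\<in>T. \<forall>z\<in>F. g z = q F z" "coef q v" using assms(2) unfolding rel_def by blast
  show ?thesis unfolding rel_def
  proof (intro conjI exI[of _ "\<lambda>F. p F + q F"])
    show "u + v \<in> data" "psi (u + v) = 0" "\<forall>z. z \<notin> domain T \<longrightarrow> (f + g) z = 0"
      using assms by (auto simp: rel_def subspace_add[OF subspace_data] linear_add[OF linear_psi])
  qed (use p q spl_add[OF p(1) q(1)] coef_add[OF p(3) q(3)] in auto)
qed

lemma rel_scale:
  assumes "rel f u" shows "rel (c *\<^sub>R f) (c *\<^sub>R u)"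
proof -
  obtain p where p: "spl p" "\<forall>F\<in>T. \<forall>z\<in>F. f z = p F z" "coef p u" using assms unfolding rel_def by blast
  show ?thesis unfolding rel_def
  proof (intro conjI exI[of _ "\<lambda>F. c *\<^sub>R p F"])
    show "c *\<^sub>R u \<in> data" "psi (c *\<^sub>R u) = 0" "\<forall>z. z \<notin> domain T \<longrightarrow> (c *\<^sub>R f) z = 0"
      using assms by (auto simp: rel_def subspace_scale[OF subspace_data] linear_scale[OF linear_psi])
  qed (use p spl_scale[OF p(1)] coef_scale[OF p(3)] in auto)
qed

lemma rel_spline: "rel f u \<Longrightarrow> f \<in> spline_space d1 d2 \<alpha> \<beta> T"
  unfolding rel_def spline_space_iff by blast

section \<open>From a spline to its coordinates\<close>

lemma mjump_vbump:
  assumes "coef p u" "x \<in> X" "y \<in> Y" "(x, y) \<in> interior (domain T)"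
  shows "mjump p x y = vbump u (x, y)"
  using coefD(2)[OF assms(1), of x y] mjump_nonvertex[OF assms(2-4), of p] assms(4)
  by (auto simp: vbump_def interior_vertices_eq)

lemma hrun_points_interior:
  assumes r: "hrun a b y" and iv: "(a, y) \<in> interior_vertices T" "(b, y) \<in> interior_vertices T"
    and "a \<le> x" "x \<le> b" shows "(x, y) \<in> interior (domain T)"
  using hrun_interior[OF r, of x] assms by (cases "x = a \<or> x = b") (auto simp: interior_vertices_eq)

lemma vrun_points_interior:
  assumes r: "vrun a b x" and iv: "(x, a) \<in> interior_vertices T" "(x, b) \<in> interior_vertices T"
    and "a \<le> y" "y \<le> b" shows "(x, y) \<in> interior (domain T)"
  using vrun_interior[OF r, of y] assms by (cases "y = a \<or> y = b") (auto simp: interior_vertices_eq)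

lemma vjump_inactive:
  assumes "x \<in> X" "y \<notin> Y" "(x, y) \<in> interior (domain T)" "\<not> act (x, y)"
  shows "vjump p x y = 0"
proof -
  obtain F G where F: "F \<in> T" "(x + e, y) \<in> F" and G: "G \<in> T" "(x - e, y) \<in> G"
    using interior_domain_vertical_edge[OF assms(1-3)] by (auto simp: domain_def)
  have m: "(x, y) \<in> F" "(x, y) \<in> G"
    using cell_off[OF F(1) X.off_mem(1)[OF assms(1)] Y.off_mem(3)[OF assms(2)] F(2)]
      cell_off[OF G(1) X.off_mem(2)[OF assms(1)] Y.off_mem(3)[OF assms(2)] G(2)] .
  have "F = G"
  proof (rule ccontr)
    assume "F \<noteq> G"
    then have "(x, y) \<in> frontier F" using cell_frontier[OF F(1) G(1)] m by blast
    then show False using assms(3,4) F(1) by (auto simp: act_def)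
  qed
  then show ?thesis
    using cellv_eq[OF F X.shift_notin(1)[OF assms(1)] assms(2), of p]
      cellv_eq[OF G X.shift_notin(2)[OF assms(1)] assms(2), of p] by (simp add: vjump_def)
qed

text \<open>Just beyond both ends of an interior l-edge the point is interior and inactive, so the
  jump is zero there and the mixed jumps in between add up to zero; the power of the line can be
  cancelled.\<close>

lemma coef_psi:
  assumes p: "spl p" and c: "coef p u" and u: "u \<in> data" shows "psi u = 0"
proof (rule ext)
  fix s
  show "psi u s = 0 s"
  proof (cases "s \<in> interior_l_edges T")
    case False then show ?thesis by (simp add: psi_def)
  next
    case s: True
    then have "s \<in> l_edges T" by (simp add: interior_l_edges_def)
    then show ?thesis
    proof (cases rule: l_edge_cases)
      case (horizontal a b y)
      note d = hrunD[OF horizontal(1)]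
      have iv: "(a, y) \<in> interior_vertices T" "(b, y) \<in> interior_vertices T"
        using hrun_interior_iff(1)[OF horizontal(1)] s horizontal(2) by auto
      have ends: "(a, y) \<in> interior (domain T)" "(b, y) \<in> interior (domain T)"
        using iv by (auto simp: interior_vertices_eq)
      have "hjump p (b + e) y = hjump p (a - e) y + (\<Sum>x | x \<in> X \<and> a \<le> x \<and> x \<le> b. mjump p x y)"
        unfolding mjump_def by (rule run_sum[OF _ horizontal(1), of "\<lambda>x. hjump p x y"]) (rule hjump_gap[OF _ d(6)])
      moreover have "hjump p (b + e) y = 0"
        by (rule hjump_inactive[OF X.shift_notin(1)[OF d(5)] d(6) interior_shift(1)[OF d(5,6) ends(2)] d(9)])
      moreover have "hjump p (a - e) y = 0"
        by (rule hjump_inactive[OF X.shift_notin(2)[OF d(4)] d(6) interior_shift(2)[OF d(4,6) ends(1)] d(8)])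
      moreover have "(\<Sum>x | x \<in> X \<and> a \<le> x \<and> x \<le> b. mjump p x y) = (\<Sum>x | x \<in> X \<and> a \<le> x \<and> x \<le> b. vbump u (x, y))"
        using mjump_vbump[OF c _ d(6)] hrun_points_interior[OF horizontal(1) iv] by (intro sum.cong) auto
      ultimately have "(\<lambda>z. (snd z - y) ^ (\<beta> + 1) * psi u s z) = 0"
        using vbump_sum_horizontal[OF horizontal(1) iv, of u] horizontal(2) by simp
      then have "(snd z - y) ^ (\<beta> + 1) * psi u s z = 0" for z by (metis zero_fun_apply)
      moreover have "psi u s \<in> Pol d1 (d2 - (\<beta> + 1))"
        using pfuns_mem[OF psi_mem[OF u] s] horizontal(3) by (simp add: tsp_def)
      ultimately have "psi u s = 0" by (intro Pol_cancel[of _ _ _ 0 0 y "\<beta> + 1"]) simp_all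
      then show ?thesis by simp
    next
      case (vertical a b x)
      note d = vrunD[OF vertical(1)]
      have iv: "(x, a) \<in> interior_vertices T" "(x, b) \<in> interior_vertices T"
        using vrun_interior_iff(1)[OF vertical(1)] s vertical(2) by auto
      have ends: "(x, a) \<in> interior (domain T)" "(x, b) \<in> interior (domain T)"
        using iv by (auto simp: interior_vertices_eq)
      have "vjump p x (b + e) = vjump p x (a - e) + (\<Sum>y | y \<in> Y \<and> a \<le> y \<and> y \<le> b. mjump p x y)"
        unfolding mjump_eq by (rule vrun_sum[OF _ vertical(1), of "\<lambda>y. vjump p x y"]) (rule vjump_gap[OF _ d(6)])
      moreover have "vjump p x (b + e) = 0"
        by (rule vjump_inactive[OF d(6) Y.shift_notin(1)[OF d(5)] vertical_interior_shift(1)[OF d(6,5) ends(2)] d(9)])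
      moreover have "vjump p x (a - e) = 0"
        by (rule vjump_inactive[OF d(6) Y.shift_notin(2)[OF d(4)] vertical_interior_shift(2)[OF d(6,4) ends(1)] d(8)])
      moreover have "(\<Sum>y | y \<in> Y \<and> a \<le> y \<and> y \<le> b. mjump p x y) = (\<Sum>y | y \<in> Y \<and> a \<le> y \<and> y \<le> b. vbump u (x, y))"
        using mjump_vbump[OF c d(6)] vrun_points_interior[OF vertical(1) iv] by (intro sum.cong) auto
      ultimately have "(\<lambda>z. (fst z - x) ^ (\<alpha> + 1) * psi u s z) = 0"
        using vbump_sum_vertical[OF vertical(1) iv, of u] vertical(2) by simp
      then have "(fst z - x) ^ (\<alpha> + 1) * psi u s z = 0" for z by (metis zero_fun_apply)
      moreover have "psi u s \<in> Pol (d1 - (\<alpha> + 1)) d2"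
        using pfuns_mem[OF psi_mem[OF u] s] vertical(4) by (simp add: tsp_def)
      ultimately have "psi u s = 0" by (intro Pol_cancel[of _ _ _ x "\<alpha> + 1" 0 0]) simp_all
      then show ?thesis by simp
    qed
  qed
qed

text \<open>Stated for all coordinates of s, so that one cofactor can be chosen for each cross-cut
  as a set; the coordinates are determined by the set.\<close>

lemma cut_coefficient:
  assumes p: "spl p" and s: "s \<in> cross_cuts T"
  shows "\<exists>g\<in>tsp (Cut s).
    (\<forall>a b y. hrun a b y \<longrightarrow> s = {a..b} \<times> {y} \<longrightarrow> hjump p (a + e) y = (\<lambda>z. (snd z - y) ^ (\<beta> + 1) * g z)) \<and>
    (\<forall>a b x. vrun a b x \<longrightarrow> s = {x} \<times> {a..b} \<longrightarrow> vjump p x (a + e) = (\<lambda>z. (fst z - x) ^ (\<alpha> + 1) * g z))"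
proof -
  have "s \<in> l_edges T" using s by (simp add: cross_cuts_def)
  then show ?thesis
  proof (cases rule: l_edge_cases)
    case (horizontal a b y)
    note d = hrunD[OF horizontal(1)]
    have "(a + e, y) \<in> interior (domain T)"
      using hrun_interior[OF horizontal(1), of "a + e"] X.right_of(3)[OF d(4,5)] d(1) X.e by simp
    then have "hjump p (a + e) y \<in> DY y" using splD(2)[OF p X.shift_notin(1)[OF d(4)] d(6)] by simp
    then obtain g where g: "g \<in> Pol d1 (d2 - (\<beta> + 1))" "hjump p (a + e) y = (\<lambda>z. (snd z - y) ^ (\<beta> + 1) * g z)"
      unfolding DY_def by blast
    have "a' = a \<and> y' = y" if "s = {a'..b'} \<times> {y'}" for a' b' y'
      using interval_eq_iff[OF d(1), of y a' b' y'] that horizontal(2) by simp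
    moreover have "vertical s" if "s = {x} \<times> {a'..b'}" for x a' b' unfolding vertical_def that by auto
    ultimately show ?thesis using g horizontal(3,4) by (intro bexI[of _ g]) (auto simp: tsp_def)
  next
    case (vertical a b x)
    note d = vrunD[OF vertical(1)]
    have "(x, a + e) \<in> interior (domain T)"
      using vrun_interior[OF vertical(1), of "a + e"] Y.right_of(3)[OF d(4,5)] d(1) X.e by simp
    then have "vjump p x (a + e) \<in> DX x" using splD(3)[OF p d(6) Y.shift_notin(1)[OF d(4)]] by simp
    then obtain g where g: "g \<in> Pol (d1 - (\<alpha> + 1)) d2" "vjump p x (a + e) = (\<lambda>z. (fst z - x) ^ (\<alpha> + 1) * g z)"
      unfolding DX_def by blast
    have "a' = a \<and> x' = x" if "s = {x'} \<times> {a'..b'}" for a' b' x'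
    proof -
      have "{a..b} \<times> {x} = {a'..b'} \<times> {x'}" using that vertical(2) by (metis swap_Times)
      then show ?thesis using interval_eq_iff[OF d(1), of x a' b' x'] by simp
    qed
    moreover have "horizontal s" if "s = {a'..b'} \<times> {y}" for y a' b' unfolding horizontal_def that by auto
    ultimately show ?thesis using g vertical(3,4) by (intro bexI[of _ g]) (auto simp: tsp_def)
  qed
qed

lemma rel_exists_data:
  assumes f: "f \<in> spline_space d1 d2 \<alpha> \<beta> T"
  shows "\<exists>u. rel f u"
proof -
  obtain p where p: "\<forall>z. z \<notin> domain T \<longrightarrow> f z = 0" "spl p" "\<forall>F\<in>T. \<forall>z\<in>F. f z = p F z"
    using f unfolding spline_space_iff by blast
  have "\<forall>v\<in>interior_vertices T. \<exists>w. w \<in> Pol (d1 - (\<alpha> + 1)) (d2 - (\<beta> + 1)) \<and> mjump p (fst v) (snd v) = bump v w"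
  proof
    fix v assume v: "v \<in> interior_vertices T"
    obtain x y where xy: "v = (x, y)" by (metis surj_pair)
    then have "x \<in> X" "y \<in> Y" "(x, y) \<in> interior (domain T)"
      using v vertices_fst vertices_snd by (auto simp: interior_vertices_eq)
    then show "\<exists>w. w \<in> Pol (d1 - (\<alpha> + 1)) (d2 - (\<beta> + 1)) \<and> mjump p (fst v) (snd v) = bump v w"
      using mjump_bump[OF p(2)] xy by auto
  qed
  then obtain w where w: "\<forall>v\<in>interior_vertices T. w v \<in> Pol (d1 - (\<alpha> + 1)) (d2 - (\<beta> + 1)) \<and> mjump p (fst v) (snd v) = bump v (w v)"
    by (rule bchoice[THEN exE])
  have "\<forall>s\<in>cross_cuts T. \<exists>g. g \<in> tsp (Cut s) \<and>
    (\<forall>a b y. hrun a b y \<longrightarrow> s = {a..b} \<times> {y} \<longrightarrow> hjump p (a + e) y = (\<lambda>z. (snd z - y) ^ (\<beta> + 1) * g z)) \<and>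
    (\<forall>a b x. vrun a b x \<longrightarrow> s = {x} \<times> {a..b} \<longrightarrow> vjump p x (a + e) = (\<lambda>z. (fst z - x) ^ (\<alpha> + 1) * g z))"
    using cut_coefficient[OF p(2)] by (simp only: Bex_def) blast
  then obtain g where g: "\<forall>s\<in>cross_cuts T. g s \<in> tsp (Cut s) \<and>
    (\<forall>a b y. hrun a b y \<longrightarrow> s = {a..b} \<times> {y} \<longrightarrow> hjump p (a + e) y = (\<lambda>z. (snd z - y) ^ (\<beta> + 1) * g s z)) \<and>
    (\<forall>a b x. vrun a b x \<longrightarrow> s = {x} \<times> {a..b} \<longrightarrow> vjump p x (a + e) = (\<lambda>z. (fst z - x) ^ (\<alpha> + 1) * g s z))"
    by (rule bchoice[THEN exE])
  define u where "u t = (case t of Base \<Rightarrow> p F0 | Cut s \<Rightarrow> if s \<in> cross_cuts T then g s else 0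
    | Vtx v \<Rightarrow> if v \<in> interior_vertices T then w v else 0)" for t
  have u: "u \<in> data" unfolding data_def
  proof (rule pfunsI)
    show "u t \<in> tsp t" if "t \<in> tags" for t
      using that w g splD(1)[OF p(2) F0] by (cases t) (auto simp: u_def tags_def tsp_def)
    show "u t = 0" if "t \<notin> tags" for t using that by (cases t) (auto simp: u_def tags_def)
  qed
  have c: "coef p u"
  proof (rule coefI)
    show "mjump p x y = bump (x, y) (u (Vtx (x, y)))" if "(x, y) \<in> interior_vertices T" for x y
      using w that by (auto simp: u_def)
    show "hjump p (a + e) y = (\<lambda>z. (snd z - y) ^ (\<beta> + 1) * u (Cut ({a..b} \<times> {y})) z)"
      if "hrun a b y" "{a..b} \<times> {y} \<in> cross_cuts T" for a b y
      using bspec[OF g that(2)] that by (simp only: u_def tag.case if_True)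
    show "vjump p x (a + e) = (\<lambda>z. (fst z - x) ^ (\<alpha> + 1) * u (Cut ({x} \<times> {a..b})) z)"
      if "vrun a b x" "{x} \<times> {a..b} \<in> cross_cuts T" for a b x
      using bspec[OF g that(2)] that by (simp only: u_def tag.case if_True)
  qed (simp add: u_def)
  then show ?thesis unfolding rel_def using u coef_psi[OF p(2) c u] p by blast
qed

section \<open>From coordinates to a spline\<close>

lemma glued_function:
  assumes p: "spl p"
  shows "\<exists>f. (\<forall>z. z \<notin> domain T \<longrightarrow> f z = 0) \<and> (\<forall>F\<in>T. \<forall>z\<in>F. f z = p F z)"
proof -
  define f where "f z = (if z \<in> domain T then p (SOME F. F \<in> T \<and> z \<in> F) z else 0)" for z
  have "f z = p F z" if F: "F \<in> T" "z \<in> F" for F z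
  proof -
    have "(SOME F. F \<in> T \<and> z \<in> F) \<in> T \<and> z \<in> (SOME F. F \<in> T \<and> z \<in> F)"
      by (rule someI[of _ F]) (use F in simp)
    then have "p (SOME F. F \<in> T \<and> z \<in> F) z = p F z" using spl_continuous[OF p _ _ F] by blast
    then show ?thesis using F cell_subset by (auto simp: f_def)
  qed
  then show ?thesis by (intro exI[of _ f]) (auto simp: f_def)
qed

text \<open>Start values of jumps are indexed by l-edges as sets; any point of the set gives back
  the ordinate of its line.\<close>

lemma some_snd: "a < b \<Longrightarrow> snd (SOME z. z \<in> {a..b} \<times> {y :: real}) = y" for a b :: real
proof -
  assume "a < b"
  then have "(a, y) \<in> {a..b} \<times> {y}" by simp
  then have "(SOME z. z \<in> {a..b} \<times> {y}) \<in> {a..b} \<times> {y}" by (rule someI)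
  then show ?thesis by (simp only: mem_Times_iff singleton_iff)
qed

lemma some_fst: "a < b \<Longrightarrow> fst (SOME z. z \<in> {x :: real} \<times> {a..b}) = x" for a b :: real
proof -
  assume "a < b"
  then have "(x, a) \<in> {x} \<times> {a..b}" by simp
  then have "(SOME z. z \<in> {x} \<times> {a..b}) \<in> {x} \<times> {a..b}" by (rule someI)
  then show ?thesis by (simp only: mem_Times_iff singleton_iff)
qed

lemma data_Cut:
  assumes u: "u \<in> data"
  shows "horizontal s \<Longrightarrow> u (Cut s) \<in> Pol d1 (d2 - (\<beta> + 1))" "\<not> horizontal s \<Longrightarrow> u (Cut s) \<in> Pol (d1 - (\<alpha> + 1)) d2"
proof -
  have "u (Cut s) \<in> tsp (Cut s)"
    using u pfuns_mem[of u tags tsp "Cut s"] pfuns_outside[of u tags tsp "Cut s"]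
      subspace_0[OF subspace_tsp, of "Cut s"] unfolding data_def by (cases "Cut s \<in> tags") simp_all
  then show "horizontal s \<Longrightarrow> u (Cut s) \<in> Pol d1 (d2 - (\<beta> + 1))" "\<not> horizontal s \<Longrightarrow> u (Cut s) \<in> Pol (d1 - (\<alpha> + 1)) d2"
    by (simp_all add: tsp_def)
qed

lemma vrun_not_horizontal: "vrun a b x \<Longrightarrow> \<not> horizontal ({x} \<times> {a..b})"
  using not_vertical_interval[OF vrunD(1)] vertical_swap swap_Times by metis

lemma vbump_DX: "u \<in> data \<Longrightarrow> vbump u (x, y) \<in> DX x"
  and vbump_DY: "u \<in> data \<Longrightarrow> vbump u (x, y) \<in> DY y"
  using bump_DX[OF data_Vtx] bump_DY[OF data_Vtx] subspace_0[OF subspace_DX] subspace_0[OF subspace_DY]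
  by (simp_all add: vbump_def)

text \<open>Both families are built from the same mixed jumps, which makes them compatible at
  interior grid points; \<open>psi u = 0\<close> is the balance needed on interior l-edges.\<close>

lemma jump_functions:
  assumes u: "u \<in> data" "psi u = 0"
  obtains H V where
    "\<And>x x' y. X.gap x x' \<Longrightarrow> H x y = H x' y" "\<And>x y y'. Y.gap y y' \<Longrightarrow> V x y = V x y'"
    "\<And>x y. \<not> act (x, y) \<Longrightarrow> H x y = 0" "\<And>x y. \<not> act (x, y) \<Longrightarrow> V x y = 0"
    "\<And>x y. x \<in> X \<Longrightarrow> y \<in> Y \<Longrightarrow> (x, y) \<in> interior (domain T) \<Longrightarrow> H (x + e) y - H (x - e) y = vbump u (x, y)"
    "\<And>x y. x \<in> X \<Longrightarrow> y \<in> Y \<Longrightarrow> (x, y) \<in> interior (domain T) \<Longrightarrow> V x (y + e) - V x (y - e) = vbump u (x, y)"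
    "\<And>a b y. hrun a b y \<Longrightarrow> {a..b} \<times> {y} \<in> cross_cuts T \<Longrightarrow>
       H (a + e) y = (\<lambda>z. (snd z - y) ^ (\<beta> + 1) * u (Cut ({a..b} \<times> {y})) z)"
    "\<And>a b x. vrun a b x \<Longrightarrow> {x} \<times> {a..b} \<in> cross_cuts T \<Longrightarrow>
       V x (a + e) = (\<lambda>z. (fst z - x) ^ (\<alpha> + 1) * u (Cut ({x} \<times> {a..b})) z)"
    "\<And>x y. H x y \<in> DY y" "\<And>x y. V x y \<in> DX x"
proof -
  define h0 where "h0 s = (\<lambda>z. (snd z - snd (SOME z. z \<in> s)) ^ (\<beta> + 1) * u (Cut s) z)" for s
  define v0 where "v0 s = (\<lambda>z. (fst z - fst (SOME z. z \<in> s)) ^ (\<alpha> + 1) * u (Cut s) z)" for s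
  have h0: "h0 ({a..b} \<times> {y}) = (\<lambda>z. (snd z - y) ^ (\<beta> + 1) * u (Cut ({a..b} \<times> {y})) z)" if "hrun a b y" for a b y
    unfolding h0_def some_snd[OF hrunD(1)[OF that]] ..
  have v0: "v0 ({x} \<times> {a..b}) = (\<lambda>z. (fst z - x) ^ (\<alpha> + 1) * u (Cut ({x} \<times> {a..b})) z)" if "vrun a b x" for a b x
    unfolding v0_def some_fst[OF vrunD(1)[OF that]] ..
  have out: "vbump u v = 0" if "v \<notin> interior_vertices T" for v using that by (simp add: vbump_def)
  have balh: "(\<Sum>x | x \<in> X \<and> a \<le> x \<and> x \<le> b. vbump u (x, y)) = 0"
    if "hrun a b y" "(a, y) \<in> interior_vertices T" "(b, y) \<in> interior_vertices T" for a b y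
    using vbump_sum_horizontal[OF that, of u] u(2) by (simp add: fun_eq_iff)
  have balv: "(\<Sum>y | y \<in> Y \<and> a \<le> y \<and> y \<le> b. vbump u (x, y)) = 0"
    if "vrun a b x" "(x, a) \<in> interior_vertices T" "(x, b) \<in> interior_vertices T" for a b x
    using vbump_sum_vertical[OF that, of u] u(2) by (simp add: fun_eq_iff)
  have h0B: "h0 ({a..b} \<times> {y}) \<in> DY y" if "hrun a b y" for a b y
    unfolding h0[OF that] DY_def using data_Cut(1)[OF u(1), of "{a..b} \<times> {y}"] by auto
  have v0B: "v0 ({x} \<times> {a..b}) \<in> DX x" if "vrun a b x" for a b x
    unfolding v0[OF that] DX_def using data_Cut(2)[OF u(1) vrun_not_horizontal[OF that]] by auto
  show ?thesis
  proof (rule run_function_exists[of "vbump u" DY h0])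
    fix H assume H: "\<And>x x' y. X.gap x x' \<Longrightarrow> H x y = H x' y" "\<And>x y. \<not> act (x, y) \<Longrightarrow> H x y = 0"
      "\<And>x y. x \<in> X \<Longrightarrow> y \<in> Y \<Longrightarrow> (x, y) \<in> interior (domain T) \<Longrightarrow> H (x + e) y - H (x - e) y = vbump u (x, y)"
      "\<And>a b y. hrun a b y \<Longrightarrow> (a, y) \<notin> interior_vertices T \<Longrightarrow> (b, y) \<notin> interior_vertices T \<Longrightarrow>
         H (a + e) y = h0 ({a..b} \<times> {y})" "\<And>x y. H x y \<in> DY y"
    show ?thesis
    proof (rule vrun_function_exists[of "vbump u" DX v0])
      fix V assume V: "\<And>x y y'. Y.gap y y' \<Longrightarrow> V x y = V x y'" "\<And>x y. \<not> act (x, y) \<Longrightarrow> V x y = 0"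
        "\<And>x y. x \<in> X \<Longrightarrow> y \<in> Y \<Longrightarrow> (x, y) \<in> interior (domain T) \<Longrightarrow> V x (y + e) - V x (y - e) = vbump u (x, y)"
        "\<And>a b x. vrun a b x \<Longrightarrow> (x, a) \<notin> interior_vertices T \<Longrightarrow> (x, b) \<notin> interior_vertices T \<Longrightarrow>
           V x (a + e) = v0 ({x} \<times> {a..b})" "\<And>x y. V x y \<in> DX x"
      show ?thesis
      proof (rule that[of H V])
        show "H (a + e) y = (\<lambda>z. (snd z - y) ^ (\<beta> + 1) * u (Cut ({a..b} \<times> {y})) z)"
          if "hrun a b y" "{a..b} \<times> {y} \<in> cross_cuts T" for a b y
          using H(4)[OF that(1)] hrun_interior_iff(2)[OF that(1)] that(2) h0[OF that(1)] by simp
        show "V x (a + e) = (\<lambda>z. (fst z - x) ^ (\<alpha> + 1) * u (Cut ({x} \<times> {a..b})) z)"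
          if "vrun a b x" "{x} \<times> {a..b} \<in> cross_cuts T" for a b x
          using V(4)[OF that(1)] vrun_interior_iff(2)[OF that(1)] that(2) v0[OF that(1)] by simp
      qed (fact H(1) V(1) H(2) V(2) H(3) V(3) H(5) V(5))+
    qed (fact out balv v0B subspace_0[OF subspace_DX] subspace_add[OF subspace_DX] subspace_neg[OF subspace_DX] vbump_DX[OF u(1)])+
  qed (fact out balh h0B subspace_0[OF subspace_DY] subspace_add[OF subspace_DY] subspace_neg[OF subspace_DY] vbump_DY[OF u(1)])+
qed

lemma rel_exists_spline:
  assumes u: "u \<in> data" "psi u = 0"
  shows "\<exists>f. rel f u"
proof -
  obtain H V where HV:
    "\<And>x x' y. X.gap x x' \<Longrightarrow> H x y = H x' y" "\<And>x y y'. Y.gap y y' \<Longrightarrow> V x y = V x y'"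
    "\<And>x y. \<not> act (x, y) \<Longrightarrow> H x y = 0" "\<And>x y. \<not> act (x, y) \<Longrightarrow> V x y = 0"
    "\<And>x y. x \<in> X \<Longrightarrow> y \<in> Y \<Longrightarrow> (x, y) \<in> interior (domain T) \<Longrightarrow> H (x + e) y - H (x - e) y = vbump u (x, y)"
    "\<And>x y. x \<in> X \<Longrightarrow> y \<in> Y \<Longrightarrow> (x, y) \<in> interior (domain T) \<Longrightarrow> V x (y + e) - V x (y - e) = vbump u (x, y)"
    "\<And>a b y. hrun a b y \<Longrightarrow> {a..b} \<times> {y} \<in> cross_cuts T \<Longrightarrow>
       H (a + e) y = (\<lambda>z. (snd z - y) ^ (\<beta> + 1) * u (Cut ({a..b} \<times> {y})) z)"
    "\<And>a b x. vrun a b x \<Longrightarrow> {x} \<times> {a..b} \<in> cross_cuts T \<Longrightarrow>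
       V x (a + e) = (\<lambda>z. (fst z - x) ^ (\<alpha> + 1) * u (Cut ({x} \<times> {a..b})) z)"
    "\<And>x y. H x y \<in> DY y" "\<And>x y. V x y \<in> DX x"
    by (rule jump_functions[OF u]) (rule that, assumption+)
  have "dv H V x y = 0" if "x \<in> X" "y \<in> Y" "(x, y) \<in> interior (domain T)" for x y
    using HV(5,6)[OF that] by (simp add: dv_def)
  moreover have "H x y = 0" if "(x, y) \<notin> interior (domain T)" for x y
    using HV(3)[of x y] that by (simp add: act_def)
  ultimately obtain Q where Q: "\<And>x x' y y'. X.gap x x' \<Longrightarrow> Y.gap y y' \<Longrightarrow> Q x y = Q x' y'"
    "\<And>x y. x \<notin> X \<Longrightarrow> y \<in> Y \<Longrightarrow> (x, y) \<in> interior (domain T) \<Longrightarrow> Q x (y + e) - Q x (y - e) = H x y"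
    "\<And>x y. x \<in> X \<Longrightarrow> y \<notin> Y \<Longrightarrow> (x, y) \<in> interior (domain T) \<Longrightarrow> Q (x + e) y - Q (x - e) y = V x y"
    using potential_exists[of H V, OF con_compl HV(1,2)] by blast
  have "\<forall>F\<in>T. \<exists>c. \<forall>x y. x \<notin> X \<longrightarrow> y \<notin> Y \<longrightarrow> (x, y) \<in> F \<longrightarrow> Q x y = c"
  proof
    fix F assume F: "F \<in> T"
    show "\<exists>c. \<forall>x y. x \<notin> X \<longrightarrow> y \<notin> Y \<longrightarrow> (x, y) \<in> F \<longrightarrow> Q x y = c"
    proof (rule potential_constant_on_cell[OF Q(1) _ _ F])
      show "Q x (y + e) = Q x (y - e)" if "x \<notin> X" "y \<in> Y" "(x, y) \<in> interior (domain T)" "\<not> act (x, y)" for x y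
        using Q(2)[OF that(1-3)] HV(3)[OF that(4)] by simp
      show "Q (x + e) y = Q (x - e) y" if "x \<in> X" "y \<notin> Y" "(x, y) \<in> interior (domain T)" "\<not> act (x, y)" for x y
        using Q(3)[OF that(1-3)] HV(4)[OF that(4)] by simp
    qed
  qed
  then obtain q where q: "\<forall>F\<in>T. \<forall>x y. x \<notin> X \<longrightarrow> y \<notin> Y \<longrightarrow> (x, y) \<in> F \<longrightarrow> Q x y = q F"
    by (rule bchoice[THEN exE])
  \<comment> \<open>A potential is determined by its jumps only up to a constant; this constant
    gives the piece on \<open>F0\<close> the prescribed value.\<close>
  define k where "k = u Base - q F0"
  define p where "p F = q F + k" for F
  have cell: "cellv p x y = Q x y + k" if xy: "(x, y) \<in> domain T" "x \<notin> X" "y \<notin> Y" for x y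
  proof -
    obtain F where F: "F \<in> T" "(x, y) \<in> F" using xy(1) by (auto simp: domain_def)
    then show ?thesis using cellv_eq[OF F xy(2,3), of p] q xy(2,3) by (simp add: p_def)
  qed
  have hj: "hjump p x y = H x y" if xy: "x \<notin> X" "y \<in> Y" "(x, y) \<in> interior (domain T)" for x y
    using interior_domain_edge[OF xy(1,2)] xy cell Q(2)[OF xy] Y.shift_notin[OF xy(2)] by (simp add: hjump_def)
  have vj: "vjump p x y = V x y" if xy: "x \<in> X" "y \<notin> Y" "(x, y) \<in> interior (domain T)" for x y
    using interior_domain_vertical_edge[OF xy] xy cell Q(3)[OF xy] X.shift_notin[OF xy(1)] by (simp add: vjump_def)
  have base: "p F0 = u Base" by (simp add: p_def k_def)
  have "u Base \<in> Pol d1 d2" using pfuns_mem[of u tags tsp Base] u(1) by (simp add: data_def tags_def tsp_def)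
  have transfer: "(f \<in> Pol d1 d2) = (g \<in> Pol d1 d2)" if "f - g = j \<or> g - f = j" "j \<in> Pol d1 d2" for f g j
    using that(1)
  proof
    assume "f - g = j"
    then have "f = j + g" "g = f - j" by auto
    then show ?thesis using subspace_add[OF subspace_Pol that(2)] subspace_diff[OF subspace_Pol _ that(2)] by metis
  next
    assume "g - f = j"
    then have "g = j + f" "f = g - j" by auto
    then show ?thesis using subspace_add[OF subspace_Pol that(2)] subspace_diff[OF subspace_Pol _ that(2)] by metis
  qed
  \<comment> \<open>The potential takes values in arbitrary functions. Its jumps across edges are
    polynomials, so membership in \<open>Pol d1 d2\<close> spreads from \<open>F0\<close> to all
    cells.\<close>
  have "(p F \<in> Pol d1 d2) = (p F0 \<in> Pol d1 d2)" if "F \<in> T" for F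
  proof (rule globally_constant[OF regular con _ _ that F0])
    fix F G x y assume FG: "F \<in> T" "G \<in> T" "F \<noteq> G" "(x, y) \<in> F" "(x, y) \<in> G"
    show "(p F \<in> Pol d1 d2) = (p G \<in> Pol d1 d2)" if xy: "x \<notin> X" "y \<in> Y"
    proof -
      note c = contact[OF FG(1,4,2,5,3) xy]
      show ?thesis using transfer[OF c(2)[of p]] hj[OF xy c(1)] DY_Pol[OF HV(9)[of x y]] by simp
    qed
    show "(p F \<in> Pol d1 d2) = (p G \<in> Pol d1 d2)" if xy: "x \<in> X" "y \<notin> Y"
    proof -
      note c = vertical_contact[OF FG(1,4,2,5,3) xy]
      show ?thesis using transfer[OF c(2)[of p]] vj[OF xy c(1)] DX_Pol[OF HV(10)[of x y]] by simp
    qed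
  qed
  then have pPol: "p F \<in> Pol d1 d2" if "F \<in> T" for F using that base \<open>u Base \<in> Pol d1 d2\<close> by simp
  have spl: "spl p" unfolding spl_def using pPol hj vj HV(9,10) by simp
  have "coef p u"
  proof (rule coefI)
    fix x y assume v: "(x, y) \<in> interior_vertices T"
    then have xy: "x \<in> X" "y \<in> Y" "(x, y) \<in> interior (domain T)"
      using vertices_fst vertices_snd by (auto simp: interior_vertices_eq)
    then show "mjump p x y = bump (x, y) (u (Vtx (x, y)))"
      using HV(5)[OF xy] hj[OF _ xy(2)] X.shift_notin[OF xy(1)] interior_shift[OF xy] v
      by (simp add: mjump_def vbump_def)
  next
    fix a b y assume r: "hrun a b y" "{a..b} \<times> {y} \<in> cross_cuts T"
    note d = hrunD[OF r(1)]
    have "(a + e, y) \<in> interior (domain T)"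
      using hrun_interior[OF r(1), of "a + e"] X.right_of(3)[OF d(4,5)] d(1) X.e by simp
    then show "hjump p (a + e) y = (\<lambda>z. (snd z - y) ^ (\<beta> + 1) * u (Cut ({a..b} \<times> {y})) z)"
      using hj[OF X.shift_notin(1)[OF d(4)] d(6)] HV(7)[OF r] by simp
  next
    fix a b x assume r: "vrun a b x" "{x} \<times> {a..b} \<in> cross_cuts T"
    note d = vrunD[OF r(1)]
    have "(x, a + e) \<in> interior (domain T)"
      using vrun_interior[OF r(1), of "a + e"] Y.right_of(3)[OF d(4,5)] d(1) X.e by simp
    then show "vjump p x (a + e) = (\<lambda>z. (fst z - x) ^ (\<alpha> + 1) * u (Cut ({x} \<times> {a..b})) z)"
      using vj[OF d(6) Y.shift_notin(1)[OF d(4)]] HV(8)[OF r] by simp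
  qed (fact base)
  then show ?thesis using glued_function[OF spl] spl u unfolding rel_def by blast
qed

section \<open>Uniqueness and the dimension count\<close>

lemma rel_zero_left:
  assumes "rel 0 u" shows "u = 0"
proof -
  obtain p where p: "spl p" "\<forall>F\<in>T. \<forall>z\<in>F. (0 :: point \<Rightarrow> real) z = p F z" "coef p u" and u: "u \<in> data"
    using assms unfolding rel_def by blast
  have p0: "p F = 0" if F: "F \<in> T" for F
  proof -
    obtain a b c d where f: "a < b" "c < d" "F = {a..b} \<times> {c..d}" using F by (rule rectE)
    show ?thesis
      by (rule Pol_eq_0_on_rectangle[OF splD(1)[OF p(1) F] f(1,2)]) (use p(2) F f(3) in force)
  qed
  have cell: "cellv p x y = 0" for x y
  proof (cases "\<exists>F\<in>T. (x, y) \<in> F")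
    case True
    then have "(SOME F. F \<in> T \<and> (x, y) \<in> F) \<in> T" by (metis (mono_tags, lifting) someI_ex)
    then show ?thesis using p0 by (simp add: cellv_def)
  qed (simp add: cellv_def)
  then have j: "hjump p x y = 0" "vjump p x y = 0" "mjump p x y = 0" for x y
    by (simp_all add: hjump_def vjump_def mjump_def)
  have "u t = 0" for t
  proof (cases "t \<in> tags")
    case False
    then show ?thesis using u pfuns_outside[of u tags tsp t] unfolding data_def by simp
  next
    case True
    show ?thesis
    proof (cases t)
      case Base
      then show ?thesis using coefD(1)[OF p(3)] p0[OF F0] by simp
    next
      case (Vtx v)
      obtain x y where "v = (x, y)" by (metis surj_pair)
      then show ?thesis
        using coefD(2)[OF p(3), of x y] True Vtx j(3) bump_eq_0[OF data_Vtx[OF u], of v v] by (auto simp: tags_def)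
    next
      case (Cut s)
      then have s: "s \<in> cross_cuts T" using True by (auto simp: tags_def)
      then have "s \<in> l_edges T" by (simp add: cross_cuts_def)
      then show ?thesis
      proof (cases rule: l_edge_cases)
        case (horizontal a b y)
        have "(\<lambda>z. (snd z - y) ^ (\<beta> + 1) * u (Cut s) z) = 0"
          using coefD(3)[OF p(3) horizontal(1)] s horizontal(2) j(1) by simp
        then have "(snd z - y) ^ (\<beta> + 1) * u (Cut s) z = 0" for z by (metis zero_fun_apply)
        then show ?thesis unfolding Cut
          by (intro Pol_cancel[OF data_Cut(1)[OF u horizontal(3)], of 0 0 y "\<beta> + 1"]) simp
      next
        case (vertical a b x)
        have "(\<lambda>z. (fst z - x) ^ (\<alpha> + 1) * u (Cut s) z) = 0"
          using coefD(4)[OF p(3) vertical(1)] s vertical(2) j(2) by simp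
        then have "(fst z - x) ^ (\<alpha> + 1) * u (Cut s) z = 0" for z by (metis zero_fun_apply)
        then show ?thesis unfolding Cut
          by (intro Pol_cancel[OF data_Cut(2)[OF u vertical(4)], of x "\<alpha> + 1" 0 0]) simp
      qed
    qed
  qed
  then show ?thesis by (simp add: fun_eq_iff)
qed

text \<open>With zero coordinates every mixed jump vanishes, and so do the jumps at the first edges
  of cross-cuts; hence no l-edge carries a jump and all pieces equal the one on \<open>F0\<close>,
  which is zero.\<close>

lemma rel_zero_right:
  assumes "rel f 0" shows "f = 0"
proof -
  obtain p where p: "spl p" "\<forall>F\<in>T. \<forall>z\<in>F. f z = p F z" "coef p 0"
    and f: "\<forall>z. z \<notin> domain T \<longrightarrow> f z = 0"
    using assms unfolding rel_def by blast
  have m: "mjump p x y = 0" if "x \<in> X" "y \<in> Y" "(x, y) \<in> interior (domain T)" for x y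
    using mjump_vbump[OF p(3) that] by (simp add: vbump_def bump_0)
  have hj: "hjump p t y = 0" if t: "t \<notin> X" "y \<in> Y" "(t, y) \<in> interior (domain T)" for t y
  proof (cases "act (t, y)")
    case False
    then show ?thesis using hjump_inactive[OF t] by blast
  next
    case True
    obtain a b where r: "hrun a b y" "a < t" "t < b" by (rule hrun_exists[OF True t(1,2)])
    note d = hrunD[OF r(1)]
    show ?thesis
    proof (rule run_function_zero[OF _ r(1) _ _ _ r(2,3) t(1)])
      show "hjump p (a + e) y = 0" if "(a, y) \<notin> interior (domain T)" "(b, y) \<notin> interior (domain T)"
      proof -
        have "{a..b} \<times> {y} \<in> cross_cuts T" using hrun_interior_iff(2)[OF r(1)] that by (simp add: interior_vertices_eq)
        then show ?thesis using coefD(3)[OF p(3) r(1)] by (simp add: fun_eq_iff)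
      qed
      show "hjump p (x + e) y = hjump p (x - e) y" if "x \<in> X" "(x, y) \<in> interior (domain T)" for x
        using m[OF that(1) t(2) that(2)] by (simp add: mjump_def)
    qed (use hjump_gap[OF _ t(2)] hjump_inactive[OF _ t(2)] in blast)+
  qed
  have vj: "vjump p x t = 0" if t: "x \<in> X" "t \<notin> Y" "(x, t) \<in> interior (domain T)" for x t
  proof (cases "act (x, t)")
    case False
    then show ?thesis using vjump_inactive[OF t] by blast
  next
    case True
    obtain a b where r: "vrun a b x" "a < t" "t < b" by (rule vrun_exists[OF True t(2,1)])
    note d = vrunD[OF r(1)]
    show ?thesis
    proof (rule vrun_function_zero[OF _ r(1) _ _ _ r(2,3) t(2)])
      show "vjump p x (a + e) = 0" if "(x, a) \<notin> interior (domain T)" "(x, b) \<notin> interior (domain T)"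
      proof -
        have "{x} \<times> {a..b} \<in> cross_cuts T" using vrun_interior_iff(2)[OF r(1)] that by (simp add: interior_vertices_eq)
        then show ?thesis using coefD(4)[OF p(3) r(1)] by (simp add: fun_eq_iff)
      qed
      show "vjump p x (y + e) = vjump p x (y - e)" if "y \<in> Y" "(x, y) \<in> interior (domain T)" for y
        using m[OF t(1) that] by (simp add: mjump_eq)
    qed (use vjump_gap[OF _ t(1)] vjump_inactive[OF t(1)] in blast)+
  qed
  have "p F = p F0" if "F \<in> T" for F
  proof (rule globally_constant[OF regular con _ _ that F0])
    fix F G x y assume FG: "F \<in> T" "G \<in> T" "F \<noteq> G" "(x, y) \<in> F" "(x, y) \<in> G"
    show "p F = p G" if xy: "x \<notin> X" "y \<in> Y"
      using contact(2)[OF FG(1,4,2,5,3) xy, of p] hj[OF xy contact(1)[OF FG(1,4,2,5,3) xy]] by auto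
    show "p F = p G" if xy: "x \<in> X" "y \<notin> Y"
      using vertical_contact(2)[OF FG(1,4,2,5,3) xy, of p] vj[OF xy vertical_contact(1)[OF FG(1,4,2,5,3) xy]] by auto
  qed
  then have zero: "p F = 0" if "F \<in> T" for F using that coefD(1)[OF p(3)] by simp
  have "f z = 0" for z
  proof (cases "z \<in> domain T")
    case True
    then obtain F where "F \<in> T" "z \<in> F" unfolding domain_def by blast
    then show ?thesis using p(2) zero by simp
  qed (use f in blast)
  then show ?thesis by (simp add: fun_eq_iff)
qed

lemma dim_spline_space:
  assumes "diagonalizable d1 d2 \<alpha> \<beta> T"
  shows "dim (spline_space d1 d2 \<alpha> \<beta> T) + dim (pfuns (interior_l_edges T) (\<lambda>s. tsp (Cut s))) = dim data"
proof -
  obtain S where S: "finite S" "data \<subseteq> span S" using data_finite_span by blast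
  let ?U = "{u \<in> data. psi u = 0}"
  have sub: "subspace ?U"
    using subspace_data linear_psi
    by (auto simp: subspace_def linear_add linear_scale linear_0)
  have "dim (spline_space d1 d2 \<alpha> \<beta> T) = dim ?U"
  proof (rule dim_linear_relation[OF sub _ S(1), of rel])
    show "?U \<subseteq> span S" using S(2) by blast
    have "0 \<in> spline_space d1 d2 \<alpha> \<beta> T" by (rule subspace_0[OF subspace_spline_space])
    then obtain u where "rel 0 u" using rel_exists_data by blast
    then show "rel 0 0" using rel_zero_left by blast
    show "\<exists>u\<in>?U. rel f u" if f: "f \<in> spline_space d1 d2 \<alpha> \<beta> T" for f
    proof -
      obtain u where u: "rel f u" using rel_exists_data[OF f] ..
      then have "u \<in> ?U" by (simp add: rel_def)
      then show ?thesis using u by (intro bexI[of _ u])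
    qed
    show "\<exists>f. rel f u" if "u \<in> ?U" for u using rel_exists_spline[of u] that by blast
  qed (fact rel_add rel_scale rel_spline rel_zero_left rel_zero_right)+
  then show ?thesis
    using dim_kernel_image[OF linear_psi subspace_data S(2,1)] psi_surjective[OF assms] by simp
qed

end

section \<open>Choice of the shift and evaluation of the formula\<close>

lemma exists_gap:
  fixes Z :: "real set" assumes "finite Z"
  obtains e where "e > 0" "\<And>e' x x'. 0 < e' \<Longrightarrow> e' \<le> e \<Longrightarrow> x \<in> Z \<Longrightarrow> x' \<in> Z \<Longrightarrow> x < x' \<Longrightarrow> x + 2 * e' < x'"
proof -
  \<comment> \<open>The element 1 keeps the set nonempty when there are fewer than two
    coordinates.\<close>
  let ?D = "insert 1 ((\<lambda>(x, x'). x' - x) ` {(x, x') \<in> Z \<times> Z. x < x'})"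
  have fin: "finite ?D" using assms by (intro finite.insertI finite_imageI finite_subset[OF _ finite_cartesian_product]) auto
  have pos: "Min ?D > 0" using fin by (subst Min_gr_iff) auto
  have "x + 2 * e' < x'" if "0 < e'" "e' \<le> Min ?D / 3" "x \<in> Z" "x' \<in> Z" "x < x'" for e' x x'
  proof -
    have "x' - x \<in> ?D" using that by force
    then have "Min ?D \<le> x' - x" using fin by (intro Min_le)
    then show ?thesis using that pos by linarith
  qed
  then show ?thesis using pos by (intro that[of "Min ?D / 3"]) auto
qed

lemma mesh_exists:
  assumes "tmesh T" obtains e where "mesh T e"
proof -
  have finT: "finite T" using assms by (simp add: tmesh_def)
  have "finite (corners F)" if "F \<in> T" for F
  proof -
    have "is_rectangle F" using assms that by (simp add: tmesh_def)
    then obtain a b c d where F: "a < b" "c < d" "F = {a..b} \<times> {c..d}" unfolding is_rectangle_def by blast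
    have "corners F \<subseteq> {a, b} \<times> {c, d}"
    proof
      fix z assume "z \<in> corners F"
      then obtain a' b' c' d' where F': "a' < b'" "c' < d'" "F = {a'..b'} \<times> {c'..d'}" "z \<in> {a', b'} \<times> {c', d'}"
        unfolding corners_def by blast
      have "{a..b} = {a'..b'} \<and> {c..d} = {c'..d'}" using F F' by (simp add: times_eq_iff)
      then have "a = a' \<and> b = b' \<and> c = c' \<and> d = d'" using F F' by (simp add: Icc_eq_Icc)
      then show "z \<in> {a, b} \<times> {c, d}" using F'(4) by simp
    qed
    then show ?thesis using finite_subset by fastforce
  qed
  then have fin: "finite (vertices T)" using finT by (simp add: vertices_def)
  obtain e1 where e1: "e1 > 0" "\<And>e' x x'. 0 < e' \<Longrightarrow> e' \<le> e1 \<Longrightarrow> x \<in> fst ` vertices T \<Longrightarrow> x' \<in> fst ` vertices T \<Longrightarrow> x < x' \<Longrightarrow> x + 2 * e' < x'"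
    using exists_gap[of "fst ` vertices T"] fin by blast
  obtain e2 where e2: "e2 > 0" "\<And>e' x x'. 0 < e' \<Longrightarrow> e' \<le> e2 \<Longrightarrow> x \<in> snd ` vertices T \<Longrightarrow> x' \<in> snd ` vertices T \<Longrightarrow> x < x' \<Longrightarrow> x + 2 * e' < x'"
    using exists_gap[of "snd ` vertices T"] fin by blast
  \<comment> \<open>The separation holds for all smaller shifts too, so the smaller of the two
    serves both directions.\<close>
  have "mesh T (min e1 e2)"
    by unfold_locales (use assms fin e1(1) e2(1) e1(2)[of "min e1 e2"] e2(2)[of "min e1 e2"] in auto)
  then show ?thesis by (rule that)
qed

theorem theorem4p4:
  fixes d1 d2 \<alpha> \<beta> :: nat and T :: "(real \<times> real) set set"
  assumes "\<alpha> < d1" and "\<beta> < d2"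
    and "tmesh T" and "regular_tmesh T" and "without_holes T"
    and "diagonalizable d1 d2 \<alpha> \<beta> T"
    and "\<not> (\<exists>s. vanished d1 d2 \<alpha> \<beta> T s)"
  shows "int (dim (spline_space d1 d2 \<alpha> \<beta> T)) =
      (int d1 + 1) * (int d2 + 1)
    + (int (num_h_cross_cuts T) - int (num_h_interior_l_edges T)) * (int d1 + 1) * (int d2 - int \<beta>)
    + (int (num_v_cross_cuts T) - int (num_v_interior_l_edges T)) * (int d2 + 1) * (int d1 - int \<alpha>)
    + int (card (interior_vertices T)) * (int d1 - int \<alpha>) * (int d2 - int \<beta>)"
proof -
  obtain e where "mesh T e" using mesh_exists[OF assms(3)] .
  then interpret mesh T e .
  interpret spline_mesh T e d1 d2 \<alpha> \<beta>
    by unfold_locales (use assms in \<open>auto simp: without_holes_def\<close>)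
  \<comment> \<open>\<open>h\<close> and \<open>v\<close> are dimensions of the jump cofactors of a
    horizontal and of a vertical cross-cut, and equally of the conditions on interior l-edges;
    \<open>w\<close> belongs to a vertex.\<close>
  define h where "h = int ((d1 + 1) * (d2 - \<beta>))"
  define v where "v = int ((d1 - \<alpha>) * (d2 + 1))"
  define w where "w = int ((d1 - \<alpha>) * (d2 - \<beta>))"
  have dims: "int (dim (tsp Base)) = int ((d1 + 1) * (d2 + 1))" "int (dim (tsp (Vtx p))) = w"
    "int (dim (tsp (Cut s))) = (if horizontal s then h else v)" for s p
    using \<alpha> \<beta> by (simp_all add: tsp_def dim_Pol h_def v_def w_def Suc_diff_Suc)
  have cut_sum: "(\<Sum>s\<in>L. int (dim (tsp (Cut s)))) =
      int (card {s \<in> L. horizontal s}) * h + int (card {s \<in> L. vertical s}) * v"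
    if "finite L" "L \<subseteq> l_edges T" for L
  proof -
    have "{s \<in> L. \<not> horizontal s} = {s \<in> L. vertical s}"
      using that(2) by (auto elim: l_edge_cases)
    then show ?thesis
      using that(1) sum.If_cases[OF that(1), of horizontal "\<lambda>_. h" "\<lambda>_. v"]
      by (simp add: dims Collect_conj_eq[symmetric] Int_def)
  qed
  have cc: "cross_cuts T \<subseteq> l_edges T" "interior_l_edges T \<subseteq> l_edges T"
    by (auto simp: cross_cuts_def interior_l_edges_def)
  have "int (dim data) = (\<Sum>t\<in>tags. int (dim (tsp t)))"
    using dim_pfuns[OF finite_tags subspace_tsp tsp_finite_span] by (simp add: data_def)
  also have "\<dots> = int (dim (tsp Base)) + ((\<Sum>t\<in>Cut ` cross_cuts T. int (dim (tsp t))) + (\<Sum>t\<in>Vtx ` interior_vertices T. int (dim (tsp t))))"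
    unfolding tags_def using finite_cross_cuts finite_interior_vertices
    by (subst sum.insert) (auto intro!: sum.union_disjoint)
  also have "(\<Sum>t\<in>Cut ` cross_cuts T. int (dim (tsp t))) = int (num_h_cross_cuts T) * h + int (num_v_cross_cuts T) * v"
    using cut_sum[OF finite_cross_cuts cc(1)]
    by (simp add: sum.reindex inj_on_def num_h_cross_cuts_def num_v_cross_cuts_def)
  also have "(\<Sum>t\<in>Vtx ` interior_vertices T. int (dim (tsp t))) = int (card (interior_vertices T)) * w"
    by (simp add: sum.reindex inj_on_def dims)
  finally have D: "int (dim data) = int ((d1 + 1) * (d2 + 1)) +
      (int (num_h_cross_cuts T) * h + int (num_v_cross_cuts T) * v + int (card (interior_vertices T)) * w)"
    by (simp only: dims)
  have W: "int (dim (pfuns (interior_l_edges T) (\<lambda>s. tsp (Cut s)))) =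
      int (num_h_interior_l_edges T) * h + int (num_v_interior_l_edges T) * v"
    using dim_pfuns[OF finite_interior_l_edges subspace_tsp tsp_finite_span, of Cut]
      cut_sum[OF finite_interior_l_edges cc(2)]
    by (simp add: num_h_interior_l_edges_def num_v_interior_l_edges_def)
  have e1: "h = (int d1 + 1) * (int d2 - int \<beta>)" "v = (int d2 + 1) * (int d1 - int \<alpha>)"
    "w = (int d1 - int \<alpha>) * (int d2 - int \<beta>)" "int ((d1 + 1) * (d2 + 1)) = (int d1 + 1) * (int d2 + 1)"
    unfolding h_def v_def w_def of_nat_mult of_nat_add of_nat_1
      of_nat_diff[OF less_imp_le[OF \<alpha>]] of_nat_diff[OF less_imp_le[OF \<beta>]] by (simp_all only: mult.commute)
  have "int (dim (spline_space d1 d2 \<alpha> \<beta> T)) + (int (num_h_interior_l_edges T) * h + int (num_v_interior_l_edges T) * v) = int (dim data)"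
    using dim_spline_space[OF assms(6)] W by (simp flip: of_nat_add)
  then show ?thesis unfolding D e1 by (simp add: algebra_simps)
qed

end
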